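(* Let $d \geq 1$ be an integer and let $m_0, \ldots, m_d$ be $d+1$ probability measures on $\mathbb{R}^d$, each absolutely continuous (with respect to Lebesgue measure). Then there exists a point $p \in \mathbb{R}^d$ such that, if $v_0, \ldots, v_d$ are independent random points of $\mathbb{R}^d$ with $v_i$ distributed according to $m_i$ for each $i$, then $$\mathsf{Prob}\bigl(p \in \mathrm{conv}(v_0, \ldots, v_d)\bigr) \;\geq\; \frac{2d}{(d+1)\,(d+1)!}.$$
   Context: $\mathrm{conv}(v_0,\ldots,v_d)$ denotes the convex hull of the points $v_0,\ldots,v_d$. The measures $m_0,\ldots,m_d$ are arbitrary absolutely continuous probability measures; no two of them are assumed to coincide. *)

theory Defs
  imports "HOL-Probability.Probability"
begin

end

(* Suppose every point p is covered with probability at most delta, below the claimed bound. Take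
   a fine triangulation of a large ball. For a vertex p pick a point x_0 such that the ray from p
   away from x_0 meets conv(v_1,...,v_d) with probability at most delta. For an edge, the edge and
   the rays of its endpoints form a closed curve through infinity, meeting conv(v_1,...,v_d) with
   probability about 2 delta; cone it away from a suitable x_1, and continue dimension by
   dimension (Karasev). A k-face then yields a k-cycle mod 2 that meets conv(v_k,...,v_d) an odd
   number of times with probability about (k+1)! delta.
   A (d-1)-cycle two-colours space. If alpha and alpha' are the measures of one colour under
   m_{d-1} and m_d, then alpha(1-alpha') + alpha'(1-alpha) is at most about d! delta, so the
   average s of alpha and alpha' (or 1-s) satisfies 2s(1-s) <= d! delta, whence s < 1/(d+1)
   (Jiang). So the d+1 facets of a d-face do not cover everything, and the d-cycle of a d-face, being
   everything or nothing mod 2, is nothing. But these d-cycles add up to the whole ball.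
   All of this is expressed through intersection parities, so that no topology is needed.
   Measures of unbounded support are truncated to balls, and the points obtained have a limit. *)
theory Submission
  imports Defs
begin

section \<open>Parity of intersections in general position\<close>

text \<open>Replacing a random point by an apex amounts to fixing one coordinate of the product
  measure, and by Fubini some value of it does not raise the mean count. A k-face has k+1 facets,
  each coned once, whence the factor (k+1)!. Continuing with means up to the d-faces would only give
  the constant 1/(d+1)!; the two-colouring replaces the last averaging and gains the factor
  2d/(d+1). With u = 1/(d+1), the number 2u(1-u) = 2d/(d+1)^2 is d! times the claimed constant, and
  s < u is what lets d+1 facets of mass s sum to less than 1. As m_{d-1} and m_d may differ, only
  the average of the two masses is controlled, so the final union bound is summed over both measures
  and succeeds for at least one of them. The obstacle is degeneracy: parities obey the boundary
  formula only in general position. Every apex must avoid a null set and satisfy an inequality at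
  the same time; absolute continuity makes the two compatible. Bounded support keeps all apices in
  the ball, so that boundary faces of the triangulation, which miss the ball, contribute
  nothing.\<close>

lemma exists_linear_relation:
  fixes g :: "'i \<Rightarrow> 'v::euclidean_space"
  assumes "finite J" "DIM('v) < card J"
  obtains w where "(\<Sum>j\<in>J. w j *\<^sub>R g j) = 0" "\<exists>j\<in>J. w j \<noteq> (0::real)"
proof (cases "inj_on g J")
  case True
  have "card (g ` J) > DIM('v)" using True assms by (simp add: card_image)
  then have "dependent (g ` J)" using assms by (intro dependent_biggerset) auto
  then obtain u where u: "(\<Sum>v\<in>g ` J. u v *\<^sub>R v) = 0" "\<exists>v\<in>g ` J. u v \<noteq> 0"
    using assms by (auto simp: dependent_finite)
  have "(\<Sum>j\<in>J. u (g j) *\<^sub>R g j) = 0" using u(1) True by (simp add: sum.reindex)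
  then show ?thesis using u(2) by (intro that[of "\<lambda>j. u (g j)"]) auto
next
  case False
  then obtain i k where ik: "i \<in> J" "k \<in> J" "i \<noteq> k" "g i = g k" by (auto simp: inj_on_def)
  let ?w = "\<lambda>j. if j = i then 1 else if j = k then - 1 else (0::real)"
  have "(\<Sum>j\<in>J. ?w j *\<^sub>R g j) = (\<Sum>j\<in>{i,k}. ?w j *\<^sub>R g j)"
    using assms ik by (intro sum.mono_neutral_right) auto
  also have "\<dots> = 0" using ik by simp
  finally show ?thesis using ik by (intro that[of ?w]) auto
qed

text \<open>The feasible set is a bounded polytope of dimension at most one; it is empty or a segment
  with two endpoints, and each endpoint lies on exactly one coordinate hyperplane.\<close>
lemma even_card_facets:
  fixes g :: "'i \<Rightarrow> 'v::euclidean_space" and b :: 'v and J :: "'i set"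
  defines "feas \<equiv> \<lambda>u::'i \<Rightarrow> real. (\<forall>j\<in>J. 0 \<le> u j) \<and> (\<Sum>j\<in>J. u j *\<^sub>R g j) = b"
  assumes J: "finite J" "DIM('v) < card J"
    and bounded: "\<And>w. \<lbrakk>\<forall>j\<in>J. 0 \<le> w j; (\<Sum>j\<in>J. w j *\<^sub>R g j) = 0\<rbrakk> \<Longrightarrow> \<forall>j\<in>J. w j = (0::real)"
    and gen: "\<And>u i j. \<lbrakk>feas u; i \<in> J; j \<in> J; i \<noteq> j; u i = 0; u j = 0\<rbrakk> \<Longrightarrow> False"
  shows "even (card {j\<in>J. \<exists>u. feas u \<and> u j = 0})"
proof (cases "\<exists>u. feas u")
  case False
  then show ?thesis by simp
next
  case True
  then obtain u where u: "feas u" by blast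
  define ker where "ker w \<longleftrightarrow> (\<Sum>j\<in>J. w j *\<^sub>R g j) = 0" for w :: "'i \<Rightarrow> real"
  have ker_comb: "ker (\<lambda>j. s * w j + t * w' j)" if "ker w" "ker w'" for s t w w'
    using that by (simp add: ker_def scaleR_add_left sum.distrib flip: scaleR_scaleR scaleR_sum_right)
  have neg: "\<exists>j\<in>J. w j < 0" if "ker w" "\<exists>j\<in>J. w j \<noteq> 0" for w
    using bounded[of w] that unfolding ker_def by (meson not_less)
  \<comment> \<open>Walk from \<open>u\<close> along the kernel direction until the first coordinate
    vanishes; \<open>t\<close> is the minimal ratio over the decreasing coordinates. One exists
    because the cone of nonnegative kernel vectors is trivial.\<close>
  have move: "\<exists>t\<ge>0. \<exists>j\<in>J. feas (\<lambda>j. u j + t * w j) \<and> w j < 0 \<and> u j + t * w j = 0"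
    if "feas u" "ker w" "\<exists>j\<in>J. w j \<noteq> 0" for u w
  proof -
    define I where "I = {j\<in>J. w j < 0}"
    have I: "finite I" "I \<noteq> {}" using neg[OF that(2,3)] J by (auto simp: I_def)
    define t where "t = Min ((\<lambda>j. u j / (- w j)) ` I)"
    have "t \<in> (\<lambda>j. u j / (- w j)) ` I" unfolding t_def using I by (intro Min_in) auto
    then obtain i where i: "i \<in> I" "t = u i / (- w i)" by blast
    have le: "t \<le> u j / (- w j)" if "j \<in> I" for j unfolding t_def using that I by (intro Min_le) auto
    have t0: "t \<ge> 0" using i that(1) by (auto simp: I_def feas_def intro!: divide_nonneg_neg)
    have fu: "\<And>j. j \<in> J \<Longrightarrow> 0 \<le> u j" using that(1) by (simp add: feas_def)
    have nn: "u j + t * w j \<ge> 0" if j: "j \<in> J" for j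
    proof (cases "j \<in> I")
      case True
      have "t * (- w j) \<le> u j" using le[OF True] True by (simp add: I_def field_simps)
      then show ?thesis by simp
    next
      case False
      then show ?thesis using j t0 fu[OF j] by (simp add: I_def)
    qed
    have "(\<Sum>j\<in>J. (u j + t * w j) *\<^sub>R g j) = b"
      using that by (simp add: feas_def ker_def scaleR_add_left sum.distrib flip: scaleR_scaleR scaleR_sum_right)
    then have "feas (\<lambda>j. u j + t * w j)" using nn by (simp add: feas_def)
    moreover have "u i + t * w i = 0" "w i < 0" "i \<in> J" using i by (auto simp: I_def)
    ultimately show ?thesis using t0 by blast
  qed
  \<comment> \<open>Moving along \<open>w\<close> from a feasible point with \<open>u i = 0\<close>
    would keep coordinate i at zero and produce a second zero, against \<open>gen\<close>. Hence the
    kernel is at most a line.\<close>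
  have rigid: "\<forall>j\<in>J. w j = 0" if "feas u" "i \<in> J" "u i = 0" "ker w" "w i = 0" for u w i
  proof (rule ccontr)
    assume "\<not> ?thesis"
    with move[OF \<open>feas u\<close> \<open>ker w\<close>]
    obtain t j where tj: "j \<in> J" "feas (\<lambda>j. u j + t * w j)" "w j < 0" "u j + t * w j = 0"
      by blast
    have "i \<noteq> j" using tj(3) \<open>w i = 0\<close> by auto
    then show False using gen[OF tj(2) \<open>i \<in> J\<close> tj(1)] that tj by auto
  qed
  obtain w where w: "ker w" "\<exists>j\<in>J. w j \<noteq> 0"
    using exists_linear_relation[OF J, of g] unfolding ker_def by metis
  obtain t1 i1 where e1: "t1 \<ge> 0" "i1 \<in> J" "feas (\<lambda>j. u j + t1 * w j)" "w i1 < 0" "u i1 + t1 * w i1 = 0"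
    using move[OF u w] by blast
  have w': "ker (\<lambda>j. - w j)" using ker_comb[OF w(1) w(1), of "-1" 0] by simp
  obtain t2 i2 where e2: "t2 \<ge> 0" "i2 \<in> J" "feas (\<lambda>j. u j - t2 * w j)" "w i2 > 0" "u i2 - t2 * w i2 = 0"
    using move[OF u w'] w(2) by auto
  \<comment> \<open>A third zero would sit at \<open>u + c * w\<close> with c between -t2 and t1:
    subtracting the multiple c of \<open>w\<close> from \<open>e - u\<close> kills coordinate
    \<open>i1\<close>, and \<open>rigid\<close> applies. But coordinate \<open>i3\<close> is affine
    in c and positive at both ends.\<close>
  have "i3 = i1 \<or> i3 = i2" if i3: "i3 \<in> J" "feas e" "e i3 = 0" for i3 e
  proof (rule ccontr)
    assume ne: "\<not> ?thesis"
    define c where "c = (e i1 - u i1) / w i1"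
    have "ker (\<lambda>j. 1 * (e j - u j) + (- c) * w j)"
    proof (rule ker_comb)
      show "ker (\<lambda>j. e j - u j)" using i3 u by (simp add: ker_def feas_def scaleR_diff_left sum_subtractf)
    qed (rule w)
    moreover have "1 * (e i1 - u i1) + (- c) * w i1 = 0" using e1(4) by (simp add: c_def)
    ultimately have e0: "\<forall>j\<in>J. 1 * (e j - u j) + (- c) * w j = 0"
      by (rule rigid[OF e1(3,2,5)])
    have e: "e j = u j + c * w j" if "j \<in> J" for j using bspec[OF e0 that] by simp
    have "e i1 \<ge> 0" "e i2 \<ge> 0" using i3 e1 e2 by (auto simp: feas_def)
    moreover have "e i1 = (c - t1) * w i1" "e i2 = (c + t2) * w i2"
      using e[OF e1(2)] e[OF e2(2)] e1(5) e2(5) by (simp_all add: ring_distribs)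
    ultimately have "(c - t1) * w i1 \<ge> 0" "(c + t2) * w i2 \<ge> 0" by simp_all
    then have c: "c \<le> t1" "- t2 \<le> c"
      using e1(4) e2(4) unfolding zero_le_mult_iff by linarith+
    have "u i3 + t1 * w i3 \<noteq> 0" "u i3 - t2 * w i3 \<noteq> 0"
      using gen[OF e1(3,2) i3(1)] gen[OF e2(3,2) i3(1)] e1 e2 ne by auto
    moreover have "u i3 + t1 * w i3 \<ge> 0" "u i3 - t2 * w i3 \<ge> 0" using e1 e2 i3 by (auto simp: feas_def)
    ultimately have pos: "u i3 + t1 * w i3 > 0" "u i3 - t2 * w i3 > 0" by auto
    have 0: "u i3 + c * w i3 = 0" using e i3 by simp
    show False
    proof (cases "w i3 \<ge> 0")
      case True
      then have "(- t2) * w i3 \<le> c * w i3" using c by (intro mult_right_mono) auto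
      then show False using 0 pos by simp
    next
      case False
      then have "t1 * w i3 \<le> c * w i3" using c by (intro mult_right_mono_neg) auto
      then show False using 0 pos by simp
    qed
  qed
  then have "{j\<in>J. \<exists>u. feas u \<and> u j = 0} = {i1, i2}" using e1 e2 by auto
  moreover have "i1 \<noteq> i2" using e1 e2 by auto
  ultimately show ?thesis by simp
qed

text \<open>Intersections are counted modulo 2; hit and iter below are natural numbers whose parity matters.\<close>
definition hit :: "('i \<Rightarrow> 'a::real_vector) \<Rightarrow> 'i set \<Rightarrow> 'a set \<Rightarrow> nat" where
  "hit \<phi> P Y = of_bool (convex hull (\<phi> ` P) \<inter> convex hull Y \<noteq> {})"

text \<open>Dimensions \<open>card P' - 1\<close> and \<open>card Q - 1\<close> add up to less than
  d exactly when the cardinalities add up to at most d+1, so only the meetings excluded by dimension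
  are forbidden. On the left vertices are counted by labels, not by positions.\<close>

definition gp :: "('i \<Rightarrow> 'a::euclidean_space) \<Rightarrow> 'i set \<Rightarrow> 'a set \<Rightarrow> bool" where
  "gp \<phi> P Y \<longleftrightarrow> (\<forall>P' Q. P' \<subseteq> P \<longrightarrow> Q \<subseteq> Y \<longrightarrow> card P' + card Q \<le> DIM('a) + 1 \<longrightarrow>
     convex hull (\<phi> ` P') \<inter> convex hull Q = {})"

text \<open>Weights belong to labels rather than to points, so that several labels may share one
  position.\<close>

lemma convex_hull_image_iff:
  fixes \<phi> :: "'i \<Rightarrow> 'a::real_vector"
  assumes "finite P"
  shows "x \<in> convex hull (\<phi> ` P) \<longleftrightarrow>
    (\<exists>u. (\<forall>i\<in>P. 0 \<le> u i) \<and> sum u P = 1 \<and> (\<Sum>i\<in>P. u i *\<^sub>R \<phi> i) = x)" (is "_ = ?Q x")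
proof
  assume "x \<in> convex hull (\<phi> ` P)"
  moreover have "\<phi> ` P \<subseteq> Collect ?Q"
  proof
    fix y assume "y \<in> \<phi> ` P"
    then obtain i where i: "i \<in> P" "y = \<phi> i" by blast
    have "(\<Sum>j\<in>P. (of_bool (j = i) :: real) *\<^sub>R \<phi> j) = (\<Sum>j\<in>{i}. of_bool (j = i) *\<^sub>R \<phi> j)"
      by (rule sum.mono_neutral_right) (use i assms in auto)
    moreover have "(\<Sum>j\<in>P. of_bool (j = i) :: real) = (\<Sum>j\<in>{i}. of_bool (j = i))"
      by (rule sum.mono_neutral_right) (use i assms in auto)
    ultimately show "y \<in> Collect ?Q" using i by (intro CollectI exI[of _ "\<lambda>j. of_bool (j = i)"]) simp
  qed
  moreover have "convex (Collect ?Q)"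
    proof (rule convexI)
      fix x y and s t :: real
      assume x: "x \<in> Collect ?Q" and y: "y \<in> Collect ?Q" and st: "0 \<le> s" "0 \<le> t" "s + t = 1"
      from x obtain u where u: "\<forall>i\<in>P. 0 \<le> u i" "sum u P = 1" "(\<Sum>i\<in>P. u i *\<^sub>R \<phi> i) = x" by blast
      from y obtain v where v: "\<forall>i\<in>P. 0 \<le> v i" "sum v P = 1" "(\<Sum>i\<in>P. v i *\<^sub>R \<phi> i) = y" by blast
      have "(\<Sum>i\<in>P. (s * u i + t * v i) *\<^sub>R \<phi> i) = s *\<^sub>R x + t *\<^sub>R y"
        by (simp add: scaleR_add_left sum.distrib flip: u(3) v(3) scaleR_scaleR scaleR_sum_right)
      moreover have "(\<Sum>i\<in>P. s * u i + t * v i) = 1"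
        using u v st by (simp add: sum.distrib flip: sum_distrib_left)
      ultimately show "s *\<^sub>R x + t *\<^sub>R y \<in> Collect ?Q"
        using u v st by (intro CollectI exI[of _ "\<lambda>i. s * u i + t * v i"]) simp
    qed
  ultimately show "?Q x" using hull_minimal[of "\<phi> ` P" "Collect ?Q" convex] by blast
next
  assume "?Q x"
  then obtain u where u: "\<forall>i\<in>P. 0 \<le> u i" "sum u P = 1" "(\<Sum>i\<in>P. u i *\<^sub>R \<phi> i) = x" by blast
  have "(\<Sum>i\<in>P. u i *\<^sub>R \<phi> i) \<in> convex hull (\<phi> ` P)"
    using u assms by (intro convex_sum) (auto intro: hull_inc)
  then show "x \<in> convex hull (\<phi> ` P)" using u by simp
qed

text \<open>Two simplices whose dimensions add up to d+1 generically meet in a segment or not at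
  all, and each end of the segment lies on a facet of one of them. The pairs of barycentric weights
  are encoded by \<open>g\<close>: the target \<open>(0, 1, 1)\<close> says that the barycentres
  agree and that both weight families have sum 1. Facets are then vanishing weights, counted by
  \<open>even_card_facets\<close>.\<close>

lemma even_sum_hit_boundary:
  fixes \<phi> :: "'i \<Rightarrow> 'a::euclidean_space"
  assumes fin: "finite P" "finite Y" and card: "card P + card Y = DIM('a) + 3" and gp: "gp \<phi> P Y"
  shows "even ((\<Sum>v\<in>P. hit \<phi> (P - {v}) Y) + (\<Sum>y\<in>Y. hit \<phi> P (Y - {y})))"
proof -
  define g :: "'i + 'a \<Rightarrow> 'a \<times> real \<times> real"
    where "g = case_sum (\<lambda>i. (\<phi> i, 1, 0)) (\<lambda>y. (- y, 0, 1))"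
  define J where "J = P <+> Y"
  define feas where "feas u \<longleftrightarrow> (\<forall>j\<in>J. 0 \<le> u j) \<and> (\<Sum>j\<in>J. u j *\<^sub>R g j) = (0, 1, 1)" for u
  have sumJ: "(\<Sum>j\<in>J. u j *\<^sub>R g j) =
    ((\<Sum>i\<in>P. u (Inl i) *\<^sub>R \<phi> i) - (\<Sum>y\<in>Y. u (Inr y) *\<^sub>R y), (\<Sum>i\<in>P. u (Inl i)), (\<Sum>y\<in>Y. u (Inr y)))" for u
  proof -
    have "(\<Sum>j\<in>J. u j *\<^sub>R g j) = (\<Sum>i\<in>P. u (Inl i) *\<^sub>R g (Inl i)) + (\<Sum>y\<in>Y. u (Inr y) *\<^sub>R g (Inr y))"
      using fin by (simp add: J_def sum.Plus)
    also have "\<dots> = (\<Sum>i\<in>P. (u (Inl i) *\<^sub>R \<phi> i, u (Inl i), 0)) + (\<Sum>y\<in>Y. (- (u (Inr y) *\<^sub>R y), 0, u (Inr y)))"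
      by (simp add: g_def)
    also have "\<dots> = ((\<Sum>i\<in>P. u (Inl i) *\<^sub>R \<phi> i) - (\<Sum>y\<in>Y. u (Inr y) *\<^sub>R y), (\<Sum>i\<in>P. u (Inl i)), (\<Sum>y\<in>Y. u (Inr y)))"
      by (simp add: sum_prod sum_negf)
    finally show ?thesis .
  qed
  have key: "(\<exists>u. feas u \<and> (\<forall>j\<in>P <+> Y. j \<notin> P' <+> Y' \<longrightarrow> u j = 0)) \<longleftrightarrow> convex hull (\<phi> ` P') \<inter> convex hull Y' \<noteq> {}"
    if "P' \<subseteq> P" "Y' \<subseteq> Y" for P' Y'
  proof
    assume "\<exists>u. feas u \<and> (\<forall>j\<in>P <+> Y. j \<notin> P' <+> Y' \<longrightarrow> u j = 0)"
    then obtain u where u: "feas u" "\<forall>j\<in>P <+> Y. j \<notin> P' <+> Y' \<longrightarrow> u j = 0" by blast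
    have eq: "(\<Sum>i\<in>P. u (Inl i) *\<^sub>R \<phi> i) = (\<Sum>i\<in>P'. u (Inl i) *\<^sub>R \<phi> i)" "(\<Sum>i\<in>P. u (Inl i)) = (\<Sum>i\<in>P'. u (Inl i))"
      "(\<Sum>i\<in>Y. u (Inr i) *\<^sub>R i) = (\<Sum>i\<in>Y'. u (Inr i) *\<^sub>R i)" "(\<Sum>i\<in>Y. u (Inr i)) = (\<Sum>i\<in>Y'. u (Inr i))"
      by (rule sum.mono_neutral_right; use that fin u(2) in force)+
    have nn: "\<forall>i\<in>P'. 0 \<le> u (Inl i)" "\<forall>i\<in>Y'. 0 \<le> u (Inr i)" using u(1) that by (auto simp: feas_def J_def)
    have fin': "finite P'" "finite Y'" using that fin finite_subset by auto
    have "(\<Sum>i\<in>P'. u (Inl i) *\<^sub>R \<phi> i) \<in> convex hull (\<phi> ` P')"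
      using u(1) eq nn fin' unfolding convex_hull_image_iff[OF fin'(1)]
      by (intro exI[of _ "\<lambda>i. u (Inl i)"]) (auto simp: feas_def sumJ)
    moreover have "(\<Sum>i\<in>Y'. u (Inr i) *\<^sub>R i) \<in> convex hull ((\<lambda>y. y) ` Y')"
      using u(1) eq nn fin' unfolding convex_hull_image_iff[OF fin'(2)]
      by (intro exI[of _ "\<lambda>i. u (Inr i)"]) (auto simp: feas_def sumJ)
    moreover have "(\<Sum>i\<in>P'. u (Inl i) *\<^sub>R \<phi> i) = (\<Sum>i\<in>Y'. u (Inr i) *\<^sub>R i)"
      using u(1) eq by (simp add: feas_def sumJ)
    ultimately show "convex hull (\<phi> ` P') \<inter> convex hull Y' \<noteq> {}" by auto
  next
    assume "convex hull (\<phi> ` P') \<inter> convex hull Y' \<noteq> {}"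
    then obtain x where x: "x \<in> convex hull (\<phi> ` P')" "x \<in> convex hull ((\<lambda>y. y) ` Y')" by auto
    have fin': "finite P'" "finite Y'" using that fin finite_subset by auto
    obtain s where s: "\<forall>i\<in>P'. 0 \<le> s i" "sum s P' = 1" "(\<Sum>i\<in>P'. s i *\<^sub>R \<phi> i) = x"
      using x(1) unfolding convex_hull_image_iff[OF fin'(1)] by blast
    obtain t where t: "\<forall>i\<in>Y'. 0 \<le> t i" "sum t Y' = 1" "(\<Sum>i\<in>Y'. t i *\<^sub>R i) = x"
      using x(2) unfolding convex_hull_image_iff[OF fin'(2)] by blast
    define u where "u = case_sum (\<lambda>i. if i \<in> P' then s i else 0) (\<lambda>i. if i \<in> Y' then t i else 0)"
    have eq: "(\<Sum>i\<in>P. u (Inl i) *\<^sub>R \<phi> i) = (\<Sum>i\<in>P'. u (Inl i) *\<^sub>R \<phi> i)" "(\<Sum>i\<in>P. u (Inl i)) = (\<Sum>i\<in>P'. u (Inl i))"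
      "(\<Sum>i\<in>Y. u (Inr i) *\<^sub>R i) = (\<Sum>i\<in>Y'. u (Inr i) *\<^sub>R i)" "(\<Sum>i\<in>Y. u (Inr i)) = (\<Sum>i\<in>Y'. u (Inr i))"
      by (rule sum.mono_neutral_right; use that fin in \<open>force simp: u_def split: if_splits\<close>)+
    have "feas u" unfolding feas_def sumJ eq using s t by (auto simp: u_def J_def)
    moreover have "\<forall>j\<in>P <+> Y. j \<notin> P' <+> Y' \<longrightarrow> u j = 0" by (auto simp: u_def split: if_splits)
    ultimately show "\<exists>u. feas u \<and> (\<forall>j\<in>P <+> Y. j \<notin> P' <+> Y' \<longrightarrow> u j = 0)" by blast
  qed
  have "even (card {j\<in>J. \<exists>u. feas u \<and> u j = 0})"
    unfolding feas_def
  proof (rule even_card_facets)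
    show "finite J" "DIM('a \<times> real \<times> real) < card J"
      using fin card by (simp_all add: J_def card_Plus)
  next
    fix w assume w: "\<forall>j\<in>J. 0 \<le> w j" "(\<Sum>j\<in>J. w j *\<^sub>R g j) = 0"
    then have "(\<Sum>i\<in>P. w (Inl i)) = 0" "(\<Sum>y\<in>Y. w (Inr y)) = 0" by (auto simp: sumJ zero_prod_def)
    moreover have "\<And>i. i \<in> P \<Longrightarrow> 0 \<le> w (Inl i)" "\<And>y. y \<in> Y \<Longrightarrow> 0 \<le> w (Inr y)"
      using w(1) by (auto simp: J_def)
    ultimately have "\<forall>i\<in>P. w (Inl i) = 0" "\<forall>y\<in>Y. w (Inr y) = 0"
      using fin by (simp_all add: sum_nonneg_eq_0_iff)
    then show "\<forall>j\<in>J. w j = 0" by (auto simp: J_def)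
  next
    fix u i j
    assume u: "(\<forall>j\<in>J. 0 \<le> u j) \<and> (\<Sum>j\<in>J. u j *\<^sub>R g j) = (0, 1, 1)"
      and ij: "i \<in> J" "j \<in> J" "i \<noteq> j" "u i = 0" "u j = 0"
    \<comment> \<open>Two vanishing weights leave at most d+1 vertices in total, a configuration
      that \<open>gp\<close> excludes.\<close>
    define P' where "P' = {p\<in>P. Inl p \<noteq> i \<and> Inl p \<noteq> j}"
    define Y' where "Y' = {p\<in>Y. Inr p \<noteq> i \<and> Inr p \<noteq> j}"
    have "P' <+> Y' = (P <+> Y) - {i, j}" by (auto simp: P'_def Y'_def)
    moreover have "card ((P <+> Y) - {i, j}) = card (P <+> Y) - 2"
      using ij fin by (subst card_Diff_subset) (auto simp: J_def)
    moreover have "card (P' <+> Y') = card P' + card Y'"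
      using fin by (intro card_Plus) (auto simp: P'_def Y'_def)
    ultimately have "card P' + card Y' \<le> DIM('a) + 1"
      using card fin by (simp add: card_Plus)
    moreover have sub: "P' \<subseteq> P" "Y' \<subseteq> Y" by (auto simp: P'_def Y'_def)
    ultimately have "convex hull (\<phi> ` P') \<inter> convex hull Y' = {}" using gp by (simp add: gp_def)
    moreover have "\<exists>u. feas u \<and> (\<forall>j\<in>P <+> Y. j \<notin> P' <+> Y' \<longrightarrow> u j = 0)"
      using u ij by (intro exI[of _ u]) (auto simp: P'_def Y'_def feas_def)
    ultimately show False using key[OF sub] by blast
  qed
  also have "{j\<in>J. \<exists>u. feas u \<and> u j = 0} =
      {v\<in>P. hit \<phi> (P - {v}) Y = 1} <+> {y\<in>Y. hit \<phi> P (Y - {y}) = 1}" (is "?A = ?B")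
  proof -
    have "Inl v \<in> ?A \<longleftrightarrow> Inl v \<in> ?B" for v
    proof (cases "v \<in> P")
      case True
      have "(\<forall>j\<in>P <+> Y. j \<notin> (P - {v}) <+> Y \<longrightarrow> u j = 0) \<longleftrightarrow> u (Inl v) = 0" for u :: "'i + 'a \<Rightarrow> real"
        using True by auto
      then show ?thesis using key[of "P - {v}" Y] True by (auto simp: hit_def J_def)
    qed (auto simp: J_def)
    moreover have "Inr v \<in> ?A \<longleftrightarrow> Inr v \<in> ?B" for v
    proof (cases "v \<in> Y")
      case True
      have "(\<forall>j\<in>P <+> Y. j \<notin> P <+> (Y - {v}) \<longrightarrow> u j = 0) \<longleftrightarrow> u (Inr v) = 0" for u :: "'i + 'a \<Rightarrow> real"
        using True by auto
      then show ?thesis using key[of P "Y - {v}"] True by (auto simp: hit_def J_def)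
    qed (auto simp: J_def)
    ultimately show "?A = ?B" by (intro set_eqI, case_tac x) simp_all
  qed
  also have "card \<dots> = card {v\<in>P. hit \<phi> (P - {v}) Y = 1} + card {y\<in>Y. hit \<phi> P (Y - {y}) = 1}"
    using fin by (intro card_Plus) auto
  also have "card {v\<in>P. hit \<phi> (P - {v}) Y = 1} = (\<Sum>v\<in>P. hit \<phi> (P - {v}) Y)"
    using fin by (simp add: hit_def) (auto intro!: arg_cong[of _ _ card])
  also have "card {y\<in>Y. hit \<phi> P (Y - {y}) = 1} = (\<Sum>y\<in>Y. hit \<phi> P (Y - {y}))"
    using fin by (simp add: hit_def) (auto intro!: arg_cong[of _ _ card])
  finally show ?thesis .
qed

section \<open>General position by avoiding flats\<close>

lemma gp_mono: "\<lbrakk>gp \<phi> P Y; P' \<subseteq> P; Y' \<subseteq> Y\<rbrakk> \<Longrightarrow> gp \<phi> P' Y'"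
  by (auto simp: gp_def)

text \<open>At most d points span a proper affine subspace, so for finite \<open>W\<close> this is a
  null set; a point outside it may be added to \<open>W\<close> without spoiling general
  position.\<close>

definition flats :: "'a::euclidean_space set \<Rightarrow> 'a set" where
  "flats W = (\<Union>S\<in>{S. S \<subseteq> W \<and> card S \<le> DIM('a)}. affine hull S)"

lemma flats_mono: "W \<subseteq> W' \<Longrightarrow> flats W \<subseteq> flats W'"
  unfolding flats_def by (intro UN_mono) auto

lemma subset_flats: "W \<subseteq> flats (W :: 'a::euclidean_space set)"
proof
  fix x assume "x \<in> W"
  then show "x \<in> flats W"
    unfolding flats_def by (intro UN_I[of "{x}"]) (auto simp: Suc_le_eq)
qed

lemma notin_if_notin_flats: "x \<notin> flats W \<Longrightarrow> x \<notin> W"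
  using subset_flats by blast

lemma affine_hull_null_sets:
  fixes S :: "'a::euclidean_space set"
  assumes "finite S" "card S \<le> DIM('a)"
  shows "affine hull S \<in> null_sets lborel"
proof -
  have "negligible (affine hull S)"
    using empty_interior_affine_hull[OF assms]
    by (simp add: negligible_convex_interior affine_imp_convex affine_affine_hull)
  moreover have "affine hull S \<in> sets lborel"
    by (simp add: borel_closed closed_affine_hull)
  ultimately show ?thesis by (simp add: negligible_iff_null_sets null_sets_completion_iff)
qed

lemma flats_null_sets: "finite W \<Longrightarrow> flats (W :: 'a::euclidean_space set) \<in> null_sets lborel"
  unfolding flats_def
  by (intro null_sets_UN' countable_finite) (auto intro!: affine_hull_null_sets dest: finite_subset)

lemma notin_affine_hull_if_notin_flats:
  "\<lbrakk>x \<notin> flats W; S \<subseteq> W; card S \<le> DIM('a::euclidean_space)\<rbrakk> \<Longrightarrow> x \<notin> affine hull (S :: 'a set)"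
  by (auto simp: flats_def)

text \<open>Since \<open>x\<close> is not in the hull of \<open>Q\<close>, the point
  \<open>y\<close> enters \<open>x\<close> with positive weight s, and the equation can be solved
  for \<open>y\<close> as an affine combination of \<open>x\<close> and a point of the hull of
  \<open>Q\<close>.\<close>

lemma in_affine_hull_if_convex_hulls_meet:
  fixes A :: "'a::euclidean_space set"
  assumes "finite Q" "x \<in> convex hull (insert y Q)" "x \<in> convex hull A" "x \<notin> convex hull Q"
  shows "y \<in> affine hull (A \<union> Q)"
proof (cases "Q = {}")
  case True
  then show ?thesis using assms convex_hull_subset_affine_hull[of A] by auto
next
  case False
  then obtain s t q where st: "0 \<le> s" "0 \<le> t" "s + t = 1" "q \<in> convex hull Q" "x = s *\<^sub>R y + t *\<^sub>R q"
    using assms(2) by (auto simp: convex_hull_insert)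
  have "s \<noteq> 0" using st assms(4) by auto
  have aff: "q \<in> affine hull (A \<union> Q)" "x \<in> affine hull (A \<union> Q)"
    using st assms convex_hull_subset_affine_hull hull_mono[of _ "A \<union> Q" affine] by blast+
  have "y = (1 / s) *\<^sub>R x + (- t / s) *\<^sub>R q"
    using st(5) \<open>s \<noteq> 0\<close> by (simp add: algebra_simps)
  moreover have "1 / s + - t / s = 1" using st(3) \<open>s \<noteq> 0\<close> by (simp add: field_simps)
  ultimately show ?thesis
    using mem_affine[OF affine_affine_hull aff(2,1)] by metis
qed

text \<open>A forbidden meeting that involves \<open>y\<close> would put \<open>y\<close> into the
  affine hull of the at most d remaining points.\<close>

lemma gp_insert:
  fixes \<phi> :: "'i \<Rightarrow> 'a::euclidean_space"
  assumes fin: "finite P" "finite Y" and gp: "gp \<phi> P Y" and y: "y \<notin> flats (\<phi> ` P \<union> Y)"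
  shows "gp \<phi> P (insert y Y)"
  unfolding gp_def
proof (intro allI impI)
  fix P' Q assume P': "P' \<subseteq> P" and Q: "Q \<subseteq> insert y Y" and card: "card P' + card Q \<le> DIM('a) + 1"
  have finQ: "finite Q" "finite P'" using Q P' fin finite_subset by auto
  show "convex hull (\<phi> ` P') \<inter> convex hull Q = {}"
  proof (cases "y \<in> Q")
    case False
    then show ?thesis using gp P' Q card by (auto simp: gp_def subset_insert)
  next
    case True
    let ?R = "Q - {y}"
    have R: "?R \<subseteq> Y" "card ?R = card Q - 1" "card Q > 0" using Q True finQ by (auto simp: card_gt_0_iff)
    have "convex hull (\<phi> ` P') \<inter> convex hull ?R = {}"
      using gp[unfolded gp_def, rule_format, OF P' R(1)] R(2) card by linarith
    moreover have "y \<notin> affine hull (\<phi> ` P' \<union> ?R)"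
    proof (rule notin_affine_hull_if_notin_flats[OF y])
      have "card (\<phi> ` P' \<union> ?R) \<le> card P' + card ?R"
        by (metis add_le_mono1 card_Un_le card_image_le finQ(2) le_trans)
      then show "card (\<phi> ` P' \<union> ?R) \<le> DIM('a)" using card R by linarith
    qed (use P' R in auto)
    moreover have "insert y ?R = Q" using True by blast
    ultimately show ?thesis
      using in_affine_hull_if_convex_hulls_meet[of ?R _ y "\<phi> ` P'"] finQ(1)
      by (metis disjoint_iff finite_Diff)
  qed
qed

lemma gp_empty: "finite P \<Longrightarrow> gp \<phi> P {}"
  by (simp add: gp_def)

text \<open>The parity of iter a k \<sigma> Y is the intersection number of conv Y with a cycle built from the k-face \<sigma>:
  every facet cycle is coned away from its apex (a ray from p pointing away from x meets conv Y iff p lies in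
  conv (insert x Y)), and the cones are glued along \<sigma>. The number k is card \<sigma> - 1.\<close>
primrec iter :: "('i \<Rightarrow> 'a::real_vector) \<Rightarrow> ('i set \<Rightarrow> 'a) \<Rightarrow> nat \<Rightarrow> 'i set \<Rightarrow> 'a set \<Rightarrow> nat" where
  "iter \<phi> a 0 \<sigma> Y = hit \<phi> \<sigma> Y"
| "iter \<phi> a (Suc k) \<sigma> Y =
    hit \<phi> \<sigma> Y + (\<Sum>v\<in>\<sigma>. iter \<phi> a k (\<sigma> - {v}) (insert (a (\<sigma> - {v})) Y))"

text \<open>Ordered pairs cancel in twos. In use v and w are two deleted vertices, and this says
  that the boundary of a boundary vanishes mod 2.\<close>

lemma even_sum_sym:
  fixes f :: "'i \<Rightarrow> 'i \<Rightarrow> nat"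
  assumes "finite A" "\<And>v w. \<lbrakk>v \<in> A; w \<in> A\<rbrakk> \<Longrightarrow> f v w = f w v"
  shows "even (\<Sum>v\<in>A. \<Sum>w\<in>A - {v}. f v w)"
  using assms
proof (induction A)
  case (insert x A)
  have "(\<Sum>v\<in>insert x A. \<Sum>w\<in>insert x A - {v}. f v w) =
      (\<Sum>w\<in>A. f x w) + (\<Sum>v\<in>A. \<Sum>w\<in>insert x A - {v}. f v w)"
    using insert by simp
  also have "(\<Sum>v\<in>A. \<Sum>w\<in>insert x A - {v}. f v w) = (\<Sum>v\<in>A. f v x + (\<Sum>w\<in>A - {v}. f v w))"
  proof (rule sum.cong[OF refl])
    fix v assume v: "v \<in> A"
    then have "insert x A - {v} = insert x (A - {v})" using insert by auto
    then show "(\<Sum>w\<in>insert x A - {v}. f v w) = f v x + (\<Sum>w\<in>A - {v}. f v w)" using insert by simp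
  qed
  also have "(\<Sum>v\<in>A. f v x + (\<Sum>w\<in>A - {v}. f v w)) = (\<Sum>w\<in>A. f x w) + (\<Sum>v\<in>A. \<Sum>w\<in>A - {v}. f v w)"
    using insert.prems by (simp add: sum.distrib)
  finally show ?case using insert by simp
qed simp

lemma even_sum_cong:
  fixes f g :: "'i \<Rightarrow> nat"
  assumes "\<And>x. x \<in> A \<Longrightarrow> even (f x) = even (g x)"
  shows "even (sum f A) = even (sum g A)"
proof (cases "finite A")
  case True
  then show ?thesis using assms by induction auto
qed simp

text \<open>Exactly the range of apices that \<open>iter\<close> can consult on \<sigma>; the apex
  of \<sigma> itself enters only with faces of higher dimension.\<close>

definition faces :: "'i set \<Rightarrow> 'i set set" where
  "faces \<sigma> = {\<rho>. \<rho> \<subset> \<sigma> \<and> \<rho> \<noteq> {}}"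

lemma facet_in_faces:
  assumes "v \<in> \<sigma>" "card \<sigma> = Suc (Suc k)"
  shows "\<sigma> - {v} \<in> faces \<sigma>"
proof -
  have "card (\<sigma> - {v}) = Suc k" using assms by (simp add: card_ge_0_finite)
  then have "\<sigma> - {v} \<noteq> {}" by (metis card.empty nat.distinct(1))
  then show ?thesis using assms(1) unfolding faces_def by blast
qed

text \<open>The boundary of a facet sum vanishes because every codimension-two face lies in two facets.\<close>
lemma iter_cocycle:
  fixes \<phi> :: "'i \<Rightarrow> 'a::euclidean_space"
  assumes "card \<sigma> = Suc k" "finite Y" "card Y + k = DIM('a) + 2" "gp \<phi> \<sigma> (Y \<union> a ` faces \<sigma>)"
    "inj_on a (faces \<sigma>)" "Y \<inter> a ` faces \<sigma> = {}"
  shows "even (\<Sum>y\<in>Y. iter \<phi> a k \<sigma> (Y - {y}))"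
  using assms
proof (induction k arbitrary: \<sigma> Y)
  case 0
  then obtain p where p: "\<sigma> = {p}" by (auto simp: card_Suc_eq)
  have "even ((\<Sum>v\<in>\<sigma>. hit \<phi> (\<sigma> - {v}) Y) + (\<Sum>y\<in>Y. hit \<phi> \<sigma> (Y - {y})))"
    using 0 p by (intro even_sum_hit_boundary) (auto elim: gp_mono)
  moreover have "(\<Sum>v\<in>\<sigma>. hit \<phi> (\<sigma> - {v}) Y) = 0" by (simp add: p hit_def)
  ultimately show ?case by simp
next
  case (Suc k)
  have fin: "finite \<sigma>" using Suc.prems(1) by (simp add: card_ge_0_finite)
  have face: "\<sigma> - {v} \<in> faces \<sigma>" if "v \<in> \<sigma>" for v
    using that Suc.prems(1) by (rule facet_in_faces)
  define b where "b v = a (\<sigma> - {v})" for v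
  have sub: "faces (\<sigma> - {v}) \<subseteq> faces \<sigma>" "\<sigma> - {v} \<notin> faces (\<sigma> - {v})" for v
    by (auto simp: faces_def)
  have bY: "b v \<notin> Y" if "v \<in> \<sigma>" for v using Suc.prems(6) face[OF that] by (auto simp: b_def)
  \<comment> \<open>The induction hypothesis is applied to \<open>Y\<close> enlarged by the apex of
    the facet. The term deleting the apex leaves \<open>Y\<close> itself; the other terms are the
    cones in the definition of \<open>iter\<close>.\<close>
  have IH: "even (\<Sum>y\<in>Y. iter \<phi> a k (\<sigma> - {v}) (insert (b v) (Y - {y}))) = even (iter \<phi> a k (\<sigma> - {v}) Y)"
    if v: "v \<in> \<sigma>" for v
  proof -
    have "even (\<Sum>y\<in>insert (b v) Y. iter \<phi> a k (\<sigma> - {v}) (insert (b v) Y - {y}))"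
    proof (rule Suc.IH)
      show "card (\<sigma> - {v}) = Suc k" using Suc.prems v fin by simp
      show "gp \<phi> (\<sigma> - {v}) (insert (b v) Y \<union> a ` faces (\<sigma> - {v}))"
        using Suc.prems(4) by (rule gp_mono) (use sub[of v] face[OF v] in \<open>auto simp: b_def\<close>)
      show "inj_on a (faces (\<sigma> - {v}))" using Suc.prems(5) sub(1) by (rule inj_on_subset)
      have "b v \<notin> a ` faces (\<sigma> - {v})"
        using sub[of v] face[OF v] Suc.prems(5) by (auto simp: b_def inj_on_def)
      then show "insert (b v) Y \<inter> a ` faces (\<sigma> - {v}) = {}" using Suc.prems(6) sub[of v] by auto
    qed (use Suc.prems bY[OF v] in auto)
    also have "(\<Sum>y\<in>insert (b v) Y. iter \<phi> a k (\<sigma> - {v}) (insert (b v) Y - {y})) =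
        iter \<phi> a k (\<sigma> - {v}) Y + (\<Sum>y\<in>Y. iter \<phi> a k (\<sigma> - {v}) (insert (b v) (Y - {y})))"
      using bY[OF v] Suc.prems(2) by (auto simp: insert_Diff_if intro!: sum.cong)
    finally show ?thesis by simp
  qed
  have "(\<Sum>y\<in>Y. iter \<phi> a (Suc k) \<sigma> (Y - {y})) =
      (\<Sum>y\<in>Y. hit \<phi> \<sigma> (Y - {y})) + (\<Sum>v\<in>\<sigma>. \<Sum>y\<in>Y. iter \<phi> a k (\<sigma> - {v}) (insert (b v) (Y - {y})))"
    by (simp add: sum.distrib b_def) (rule sum.swap)
  moreover have "even (\<Sum>v\<in>\<sigma>. \<Sum>y\<in>Y. iter \<phi> a k (\<sigma> - {v}) (insert (b v) (Y - {y}))) =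
      even (\<Sum>v\<in>\<sigma>. iter \<phi> a k (\<sigma> - {v}) Y)"
    by (rule even_sum_cong) (rule IH)
  moreover have "even ((\<Sum>v\<in>\<sigma>. hit \<phi> (\<sigma> - {v}) Y) + (\<Sum>y\<in>Y. hit \<phi> \<sigma> (Y - {y})))"
    using Suc.prems fin by (intro even_sum_hit_boundary) (auto elim: gp_mono)
  moreover have "even ((\<Sum>v\<in>\<sigma>. hit \<phi> (\<sigma> - {v}) Y) + (\<Sum>v\<in>\<sigma>. iter \<phi> a k (\<sigma> - {v}) Y))"
  proof (cases k)
    case 0
    then show ?thesis by simp
  next
    case (Suc j)
    define f where "f v w = iter \<phi> a j (\<sigma> - {v} - {w}) (insert (a (\<sigma> - {v} - {w})) Y)" for v w
    have "\<sigma> - {v} - {w} = \<sigma> - {w} - {v}" for v w by blast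
    then have "f v w = f w v" for v w unfolding f_def by simp
    with fin have "even (\<Sum>v\<in>\<sigma>. \<Sum>w\<in>\<sigma> - {v}. f v w)" by (rule even_sum_sym)
    moreover have "(\<Sum>v\<in>\<sigma>. iter \<phi> a k (\<sigma> - {v}) Y) = (\<Sum>v\<in>\<sigma>. hit \<phi> (\<sigma> - {v}) Y) + (\<Sum>v\<in>\<sigma>. \<Sum>w\<in>\<sigma> - {v}. f v w)"
      by (simp add: Suc sum.distrib f_def)
    ultimately show ?thesis by simp
  qed
  moreover have "even s" if "s = h + d" "even d = even i" "even (f + h)" "even (f + i)" for s h d i f :: nat
    using that by auto
  ultimately show ?case by blast
qed

text \<open>This is what permits choosing the apices in order of increasing dimension: later choices
  do not alter earlier counts.\<close>

lemma iter_cong: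
  assumes "\<And>\<rho>. \<rho> \<in> faces \<sigma> \<Longrightarrow> a \<rho> = a' \<rho>" "card \<sigma> = Suc k"
  shows "iter \<phi> a k \<sigma> Y = iter \<phi> a' k \<sigma> Y"
  using assms
proof (induction k arbitrary: \<sigma> Y)
  case (Suc k)
  have fin: "finite \<sigma>" using Suc.prems(2) by (simp add: card_ge_0_finite)
  have "iter \<phi> a k (\<sigma> - {v}) (insert (a (\<sigma> - {v})) Y) = iter \<phi> a' k (\<sigma> - {v}) (insert (a' (\<sigma> - {v})) Y)"
    if v: "v \<in> \<sigma>" for v
  proof -
    have c: "card (\<sigma> - {v}) = Suc k" using Suc.prems v fin by simp
    have "a (\<sigma> - {v}) = a' (\<sigma> - {v})" using facet_in_faces[OF v Suc.prems(2)] by (rule Suc.prems(1))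
    moreover have "iter \<phi> a k (\<sigma> - {v}) Y' = iter \<phi> a' k (\<sigma> - {v}) Y'" for Y'
      using c by (intro Suc.IH Suc.prems(1)) (auto simp: faces_def)
    ultimately show ?thesis by simp
  qed
  then show ?case by simp
qed simp

text \<open>Every hull compared with a face of \<sigma> is spanned by points of the convex set
  \<open>U\<close>, which all these faces miss. With \<open>U\<close> the ball, this disposes of the
  boundary of the triangulation.\<close>

lemma iter_eq_0:
  assumes "convex hull (\<phi> ` \<sigma>) \<inter> U = {}" "convex U" "Y \<subseteq> U" "a ` faces \<sigma> \<subseteq> U" "card \<sigma> = Suc k"
  shows "iter \<phi> a k \<sigma> Y = 0"
  using assms
proof (induction k arbitrary: \<sigma> Y)
  case 0
  have "convex hull Y \<subseteq> U" using 0 by (simp add: hull_minimal)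
  then show ?case using 0 by (auto simp: hit_def)
next
  case (Suc k)
  have fin: "finite \<sigma>" using Suc.prems(5) by (simp add: card_ge_0_finite)
  have "convex hull Y \<subseteq> U" using Suc by (simp add: hull_minimal)
  then have "hit \<phi> \<sigma> Y = 0" using Suc.prems by (auto simp: hit_def)
  moreover have "iter \<phi> a k (\<sigma> - {v}) (insert (a (\<sigma> - {v})) Y) = 0" if v: "v \<in> \<sigma>" for v
  proof (rule Suc.IH)
    have c: "card (\<sigma> - {v}) = Suc k" using Suc.prems v fin by simp
    then show "card (\<sigma> - {v}) = Suc k" .
    have "convex hull (\<phi> ` (\<sigma> - {v})) \<subseteq> convex hull (\<phi> ` \<sigma>)" by (intro hull_mono) auto
    then show "convex hull (\<phi> ` (\<sigma> - {v})) \<inter> U = {}" using Suc.prems by auto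
    have "\<sigma> - {v} \<in> faces \<sigma>" using v Suc.prems(5) by (rule facet_in_faces)
    then show "insert (a (\<sigma> - {v})) Y \<subseteq> U" using Suc.prems by auto
    show "a ` faces (\<sigma> - {v}) \<subseteq> U" using Suc.prems(4) by (rule order_trans[rotated]) (auto simp: faces_def)
  qed (use Suc.prems in auto)
  ultimately show ?case by simp
qed

section \<open>Fine mod 2 triangulations\<close>

text \<open>A mod 2 version of a triangulation of a convex body containing the ball of radius r. Vertices are
  labels located by \<phi>; no injectivity or geometric non-degeneracy is needed.\<close>
definition triangulation :: "real \<Rightarrow> 'a::euclidean_space set \<Rightarrow> (nat \<Rightarrow> 'a) \<Rightarrow> nat set set \<Rightarrow> bool" where
  "triangulation r K \<phi> T \<longleftrightarrow> finite T \<and> (\<forall>\<sigma>\<in>T. card \<sigma> = Suc DIM('a)) \<and> \<phi> ` \<Union>T \<subseteq> K \<and>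
    (\<forall>\<tau>. card \<tau> = DIM('a) \<longrightarrow> odd (\<Sum>\<sigma>\<in>T. of_bool (\<tau> \<subseteq> \<sigma>) :: nat) \<longrightarrow>
      convex hull (\<phi> ` \<tau>) \<inter> ball 0 r = {}) \<and>
    (\<forall>z\<in>ball 0 r. z \<notin> flats (\<phi> ` \<Union>T) \<longrightarrow> odd (\<Sum>\<sigma>\<in>T. hit \<phi> \<sigma> {z}))"

section \<open>Edge bisection and mesh refinement\<close>

definition edges :: "'i set set \<Rightarrow> ('i \<times> 'i) set" where
  "edges T = {(u, v). u \<noteq> v \<and> (\<exists>\<sigma>\<in>T. u \<in> \<sigma> \<and> v \<in> \<sigma>)}"

text \<open>Combinatorially the stellar subdivision of the edge uv with new vertex n.\<close>

definition bisect :: "'i \<Rightarrow> 'i \<Rightarrow> 'i \<Rightarrow> 'i set set \<Rightarrow> 'i set set" where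
  "bisect u v n T = {\<sigma>\<in>T. \<not> (u \<in> \<sigma> \<and> v \<in> \<sigma>)} \<union>
    ((\<lambda>\<sigma>. insert n (\<sigma> - {v})) ` {\<sigma>\<in>T. u \<in> \<sigma> \<and> v \<in> \<sigma>} \<union>
     (\<lambda>\<sigma>. insert n (\<sigma> - {u})) ` {\<sigma>\<in>T. u \<in> \<sigma> \<and> v \<in> \<sigma>})"

text \<open>Freshness of \<open>n\<close> makes the two families of halves injective images,
  disjoint from each other and from the untouched cells.\<close>

lemma sum_bisect:
  fixes f :: "'i set \<Rightarrow> nat"
  assumes "finite T" "u \<noteq> v" "n \<notin> \<Union>T"
  shows "sum f (bisect u v n T) = (\<Sum>\<sigma>\<in>T. if u \<in> \<sigma> \<and> v \<in> \<sigma> then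
    f (insert n (\<sigma> - {v})) + f (insert n (\<sigma> - {u})) else f \<sigma>)"
proof -
  let ?T0 = "{\<sigma>\<in>T. u \<in> \<sigma> \<and> v \<in> \<sigma>}" and ?T1 = "{\<sigma>\<in>T. \<not> (u \<in> \<sigma> \<and> v \<in> \<sigma>)}"
  let ?g = "\<lambda>w \<sigma>. insert n (\<sigma> - {w})"
  have inj: "inj_on (?g w) ?T0" if "w = u \<or> w = v" for w
  proof (rule inj_on_inverseI[where g = "\<lambda>\<sigma>. insert w (\<sigma> - {n})"])
    fix \<sigma> assume "\<sigma> \<in> ?T0"
    then have "n \<notin> \<sigma>" "w \<in> \<sigma>" using assms(3) that by auto
    then show "insert w (?g w \<sigma> - {n}) = \<sigma>" by auto
  qed
  have "?g v \<sigma> \<noteq> ?g u \<sigma>'" if "\<sigma> \<in> ?T0" "\<sigma>' \<in> ?T0" for \<sigma> \<sigma>'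
  proof -
    have "v \<in> ?g u \<sigma>'" "v \<notin> ?g v \<sigma>" using that assms(2,3) by auto
    then show ?thesis by blast
  qed
  then have disj: "?g v ` ?T0 \<inter> ?g u ` ?T0 = {}" by blast
  have "sum f (bisect u v n T) = sum f ?T1 + sum f (?g v ` ?T0 \<union> ?g u ` ?T0)"
    unfolding bisect_def using assms by (intro sum.union_disjoint) auto
  also have "sum f (?g v ` ?T0 \<union> ?g u ` ?T0) = sum f (?g v ` ?T0) + sum f (?g u ` ?T0)"
    using assms disj by (intro sum.union_disjoint) auto
  also have "\<dots> = (\<Sum>\<sigma>\<in>?T0. f (?g v \<sigma>) + f (?g u \<sigma>))"
    by (simp add: sum.reindex inj sum.distrib)
  finally have "sum f (bisect u v n T) = sum f ?T1 + (\<Sum>\<sigma>\<in>?T0. f (?g v \<sigma>) + f (?g u \<sigma>))" .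
  then show ?thesis
    using assms by (simp add: sum.If_cases Int_def Compl_eq add.commute conj_commute)
qed

lemma Union_subset_Union_bisect: "u \<noteq> v \<Longrightarrow> \<Union>T \<subseteq> \<Union>(bisect u v n T)"
  unfolding bisect_def by auto

lemma edges_bisect: "u \<noteq> v \<Longrightarrow> n \<notin> \<Union>T \<Longrightarrow> edges (bisect u v n T) \<subseteq> (edges T - {(u, v)}) \<union>
    {(x, y). \<exists>\<sigma>\<in>T. u \<in> \<sigma> \<and> v \<in> \<sigma> \<and> (x = n \<and> y \<in> \<sigma> \<or> y = n \<and> x \<in> \<sigma>)}"
  unfolding edges_def bisect_def by auto

text \<open>Apollonius' median formula. If ab is a longest side of the triangle, the squared median
  is at most 3/4 of its squared length; this is the source of the factor 3/4 below.\<close>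

lemma dist_midpoint_sq:
  fixes a b c :: "'a::real_inner"
  shows "(dist (midpoint a b) c)\<^sup>2 = ((dist a c)\<^sup>2 + (dist b c)\<^sup>2) / 2 - (dist a b)\<^sup>2 / 4"
  unfolding dist_norm midpoint_def power2_norm_eq_inner
  by (simp add: inner_simps inner_commute algebra_simps) (simp add: field_simps)

text \<open>The boundary formula for the degenerate simplex on \<sigma> and \<open>n\<close>, which
  has d+2 vertices. Omitting a vertex other than n, u, v leaves a face in which \<open>n\<close> is
  redundant, so its hull is that of d points and the generic \<open>z\<close> misses it. The three
  remaining facets are \<sigma> and its two halves.\<close>

lemma hit_bisect:
  fixes \<phi> :: "nat \<Rightarrow> 'a::euclidean_space"
  assumes \<sigma>: "card \<sigma> = Suc DIM('a)" "u \<in> \<sigma>" "v \<in> \<sigma>" "u \<noteq> v" "n \<notin> \<sigma>"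
    and n: "\<phi> n = midpoint (\<phi> u) (\<phi> v)" and z: "z \<notin> flats (\<phi> ` insert n \<sigma>)"
  shows "even (hit \<phi> \<sigma> {z} + (hit \<phi> (insert n (\<sigma> - {v})) {z} + hit \<phi> (insert n (\<sigma> - {u})) {z}))"
proof -
  let ?P = "insert n \<sigma>"
  have fin: "finite \<sigma>" using \<sigma>(1) by (simp add: card_ge_0_finite)
  have z': "z \<notin> convex hull (\<phi> ` P)" if "P \<subseteq> ?P" "card P \<le> DIM('a)" for P
  proof -
    have "card (\<phi> ` P) \<le> DIM('a)" using that fin by (meson card_image_le finite.insertI finite_subset le_trans)
    then have "z \<notin> affine hull (\<phi> ` P)" using z that by (intro notin_affine_hull_if_notin_flats[OF z]) auto
    then show ?thesis using convex_hull_subset_affine_hull by blast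
  qed
  have "gp \<phi> ?P {z}"
    unfolding gp_def
  proof (intro allI impI)
    fix P' Q assume *: "P' \<subseteq> ?P" "Q \<subseteq> {z}" "card P' + card Q \<le> DIM('a) + 1"
    then consider "Q = {}" | "Q = {z}" by auto
    then show "convex hull (\<phi> ` P') \<inter> convex hull Q = {}"
    proof cases
      case 2
      then show ?thesis using z'[of P'] * by auto
    qed simp
  qed
  then have "even ((\<Sum>w\<in>?P. hit \<phi> (?P - {w}) {z}) + (\<Sum>y\<in>{z}. hit \<phi> ?P ({z} - {y})))"
    using fin \<sigma> by (intro even_sum_hit_boundary) auto
  moreover have "(\<Sum>y\<in>{z}. hit \<phi> ?P ({z} - {y})) = 0" by (simp add: hit_def)
  moreover have "(\<Sum>w\<in>?P. hit \<phi> (?P - {w}) {z}) = (\<Sum>w\<in>{n, u, v}. hit \<phi> (?P - {w}) {z})"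
  proof (rule sum.mono_neutral_right)
    show "\<forall>w\<in>?P - {n, u, v}. hit \<phi> (?P - {w}) {z} = 0"
    proof
      fix w assume w: "w \<in> ?P - {n, u, v}"
      have "\<phi> n \<in> convex hull {\<phi> u, \<phi> v}"
        using n by (simp add: midpoint_in_closed_segment flip: segment_convex_hull)
      also have "\<dots> \<subseteq> convex hull (\<phi> ` (\<sigma> - {w}))" using w \<sigma> by (intro hull_mono) auto
      finally have "convex hull (\<phi> ` (?P - {w})) = convex hull (\<phi> ` (\<sigma> - {w}))"
        using w by (simp add: insert_Diff_if hull_redundant)
      moreover have "z \<notin> convex hull (\<phi> ` (\<sigma> - {w}))" using w \<sigma> fin by (intro z') auto
      ultimately show "hit \<phi> (?P - {w}) {z} = 0" by (simp add: hit_def)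
    qed
  qed (use fin \<sigma> in auto)
  moreover have "?P - {n} = \<sigma>" "?P - {v} = insert n (\<sigma> - {v})" "?P - {u} = insert n (\<sigma> - {u})" using \<sigma> by auto
  moreover have "n \<noteq> u" "n \<noteq> v" using \<sigma> by auto
  ultimately show ?thesis using \<sigma>(4) by (simp add: add_ac)
qed

text \<open>A facet containing both u and v lies in no new cell. One through \<open>n\<close> that
  avoids both lies in both halves of a bisected cell or in neither, and cancels. So an odd facet is
  an odd old one, or half of an odd old facet whose missing endpoint is \<open>w\<close>.\<close>

lemma even_sum_face_bisect:
  assumes T: "\<And>\<sigma>. \<sigma> \<in> T \<Longrightarrow> card \<sigma> = Suc (card \<tau>)" and fin: "finite T" "finite \<tau>"
    and uv: "u \<noteq> v" "n \<notin> \<Union>T" "n \<noteq> u" "n \<noteq> v"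
    and odd: "odd (\<Sum>\<sigma>\<in>bisect u v n T. of_bool (\<tau> \<subseteq> \<sigma>) :: nat)"
  obtains (old) "n \<notin> \<tau>" "odd (\<Sum>\<sigma>\<in>T. of_bool (\<tau> \<subseteq> \<sigma>) :: nat)"
  | (new) w where "w = u \<or> w = v" "n \<in> \<tau>" "w \<notin> \<tau>" "u \<in> \<tau> \<or> v \<in> \<tau>" 
      "odd (\<Sum>\<sigma>\<in>T. of_bool (insert w (\<tau> - {n}) \<subseteq> \<sigma>) :: nat)"
proof -
  define S where "S \<rho> = (\<Sum>\<sigma>\<in>T. of_bool (\<rho> \<subseteq> \<sigma>) :: nat)" for \<rho>
  define c where "c \<sigma> = (if u \<in> \<sigma> \<and> v \<in> \<sigma> then
      of_bool (\<tau> \<subseteq> insert n (\<sigma> - {v})) + of_bool (\<tau> \<subseteq> insert n (\<sigma> - {u})) else of_bool (\<tau> \<subseteq> \<sigma>) :: nat)" for \<sigma>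
  have odd': "odd (sum c T)"
    using odd unfolding sum_bisect[OF fin(1) uv(1,2)] c_def .
  have notboth: "\<not> (u \<in> \<tau> \<and> v \<in> \<tau>)"
  proof
    assume "u \<in> \<tau> \<and> v \<in> \<tau>"
    then have "c \<sigma> = 0" if "\<sigma> \<in> T" for \<sigma> using uv that unfolding c_def by auto
    then show False using odd' by simp
  qed
  show ?thesis
  proof (cases "n \<in> \<tau>")
    case False
    have "even (c \<sigma>) = even (of_bool (\<tau> \<subseteq> \<sigma>) :: nat)" if \<sigma>: "\<sigma> \<in> T" for \<sigma>
    proof (cases "u \<in> \<sigma> \<and> v \<in> \<sigma> \<and> \<tau> \<subseteq> \<sigma>")
      case True
      have "u \<in> \<tau> \<or> v \<in> \<tau>"
      proof (rule ccontr)
        assume "\<not> ?thesis"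
        then have "\<tau> \<subseteq> \<sigma> - {u, v}" using True by auto
        then have "card \<tau> \<le> card (\<sigma> - {u, v})"
          using T[OF \<sigma>] by (intro card_mono) (auto simp: card_ge_0_finite)
        also have "\<dots> = card \<sigma> - 2" using True uv by (subst card_Diff_subset) auto
        finally have "card \<tau> \<le> card \<sigma> - 2" .
        moreover have "card {u, v} \<le> card \<sigma>"
          using T[OF \<sigma>] True by (intro card_mono) (auto simp: card_ge_0_finite)
        ultimately show False using T[OF \<sigma>] uv by simp
      qed
      then show ?thesis using True notboth False unfolding c_def by auto
    next
      case *: False
      then show ?thesis using False notboth unfolding c_def by auto
    qed
    then have "even (sum c T) = even (S \<tau>)" unfolding S_def by (rule even_sum_cong)
    then show ?thesis using False odd' old by (simp add: S_def)
  next
    case True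
    have neither: "u \<in> \<tau> \<or> v \<in> \<tau>"
    proof (rule ccontr)
      assume "\<not> ?thesis"
      then have "even (c \<sigma>)" if "\<sigma> \<in> T" for \<sigma> using that True uv(2) unfolding c_def by (auto simp: subset_insert_iff)
      then have "even (sum c T)" by (rule dvd_sum)
      then show False using odd' by simp
    qed
    define w where "w = (if u \<in> \<tau> then v else u)"
    have w: "w \<notin> \<tau>" "w = u \<or> w = v" using notboth unfolding w_def by auto
    have "c \<sigma> = of_bool (insert w (\<tau> - {n}) \<subseteq> \<sigma>)" if "\<sigma> \<in> T" for \<sigma>
    proof -
      have n: "n \<notin> \<sigma>" using that uv(2) by blast
      then have sub: "\<not> \<tau> \<subseteq> \<sigma>" using True by blast
      show ?thesis
      proof (cases "u \<in> \<sigma> \<and> v \<in> \<sigma>")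
        case uv\<sigma>: True
        have "\<tau> \<subseteq> insert n (\<sigma> - {x}) \<longleftrightarrow> \<tau> - {n} \<subseteq> \<sigma> \<and> x \<notin> \<tau>" if "x \<in> \<sigma>" for x
          using n that by blast
        then have "c \<sigma> = of_bool (\<tau> - {n} \<subseteq> \<sigma> \<and> v \<notin> \<tau>) + of_bool (\<tau> - {n} \<subseteq> \<sigma> \<and> u \<notin> \<tau>)"
          using uv\<sigma> unfolding c_def by simp
        also have "\<dots> = of_bool (\<tau> - {n} \<subseteq> \<sigma>)" using neither notboth by auto
        also have "(\<tau> - {n} \<subseteq> \<sigma>) = (insert w (\<tau> - {n}) \<subseteq> \<sigma>)" using w uv\<sigma> by auto
        finally show ?thesis .
      next
        case False
        moreover have "\<not> insert w (\<tau> - {n}) \<subseteq> \<sigma>"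
          using False neither uv(3,4) unfolding w_def by auto
        ultimately show ?thesis using sub unfolding c_def by auto
      qed
    qed
    then have "sum c T = S (insert w (\<tau> - {n}))" unfolding S_def by simp
    then show ?thesis using new[OF w(2) True w(1) neither] odd' by (simp add: S_def)
  qed
qed

text \<open>Odd facets stay or shrink to halves, so they still miss the ball; the covering parity of
  a generic point is preserved cell by cell by \<open>hit_bisect\<close>. Old vertices survive, so
  genericity for the new complex implies genericity for the old one.\<close>

lemma triangulation_bisect:
  fixes \<phi> :: "nat \<Rightarrow> 'a::euclidean_space"
  assumes tri: "triangulation r K \<phi> T" and K: "convex K" and uv: "u \<noteq> v" "n \<notin> \<Union>T" "n \<noteq> u" "n \<noteq> v"
  shows "triangulation r K (\<phi>(n := midpoint (\<phi> u) (\<phi> v))) (bisect u v n T)"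
proof -
  define \<psi> where "\<psi> = \<phi>(n := midpoint (\<phi> u) (\<phi> v))"
  let ?T' = "bisect u v n T"
  have T: "finite T" "\<And>\<sigma>. \<sigma> \<in> T \<Longrightarrow> card \<sigma> = Suc DIM('a)" "\<phi> ` \<Union>T \<subseteq> K"
    "\<And>\<tau>. \<lbrakk>card \<tau> = DIM('a); odd (\<Sum>\<sigma>\<in>T. of_bool (\<tau> \<subseteq> \<sigma>) :: nat)\<rbrakk> \<Longrightarrow> convex hull (\<phi> ` \<tau>) \<inter> ball 0 r = {}"
    "\<And>z. \<lbrakk>z \<in> ball 0 r; z \<notin> flats (\<phi> ` \<Union>T)\<rbrakk> \<Longrightarrow> odd (\<Sum>\<sigma>\<in>T. hit \<phi> \<sigma> {z})"
    using tri unfolding triangulation_def by blast+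
  have eq: "\<psi> ` A = \<phi> ` A" if "n \<notin> A" for A using that by (auto simp: \<psi>_def)
  have nT: "n \<notin> \<sigma>" if "\<sigma> \<in> T" for \<sigma> using that uv by auto
  have finT: "finite \<sigma>" if "\<sigma> \<in> T" for \<sigma> using T(2)[OF that] by (simp add: card_ge_0_finite)
  have "finite ?T'" using T(1) by (simp add: bisect_def)
  moreover have "card \<sigma> = Suc DIM('a)" if "\<sigma> \<in> ?T'" for \<sigma>
    using that T(2) nT finT unfolding bisect_def by auto
  moreover have "\<psi> ` \<Union>?T' \<subseteq> K"
  proof -
    have "\<psi> n \<in> K" if "\<sigma> \<in> T" "u \<in> \<sigma>" "v \<in> \<sigma>" for \<sigma>
    proof -
      have "\<phi> u \<in> K" "\<phi> v \<in> K" using that T(3) by auto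
      then have "midpoint (\<phi> u) (\<phi> v) \<in> K"
        using K midpoint_in_closed_segment[of "\<phi> u" "\<phi> v"] closed_segment_subset by blast
      then show ?thesis by (simp add: \<psi>_def)
    qed
    moreover have "\<psi> w \<in> K" if "\<sigma> \<in> T" "w \<in> \<sigma>" for w \<sigma>
      using that T(3) nT[OF that(1)] by (auto simp: \<psi>_def)
    ultimately show ?thesis unfolding bisect_def by auto
  qed
  moreover have "convex hull (\<psi> ` \<tau>) \<inter> ball 0 r = {}"
    if \<tau>: "card \<tau> = DIM('a)" "odd (\<Sum>\<sigma>\<in>?T'. of_bool (\<tau> \<subseteq> \<sigma>) :: nat)" for \<tau>
  proof -
    have fin\<tau>: "finite \<tau>" using \<tau>(1) by (simp add: card_ge_0_finite)
    show ?thesis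
    proof (rule even_sum_face_bisect[OF _ T(1) fin\<tau> uv \<tau>(2)])
      assume "n \<notin> \<tau>" "odd (\<Sum>\<sigma>\<in>T. of_bool (\<tau> \<subseteq> \<sigma>) :: nat)"
      then show ?thesis using T(4) \<tau>(1) eq by metis
    next
      fix w assume w: "w = u \<or> w = v" "n \<in> \<tau>" "w \<notin> \<tau>" "u \<in> \<tau> \<or> v \<in> \<tau>"
        and odd: "odd (\<Sum>\<sigma>\<in>T. of_bool (insert w (\<tau> - {n}) \<subseteq> \<sigma>) :: nat)"
      let ?\<rho> = "insert w (\<tau> - {n})"
      have wn: "w \<noteq> n" "u \<noteq> n" "v \<noteq> n" using w(1) uv by auto
      have "card ?\<rho> = DIM('a)" using w \<tau>(1) fin\<tau> by (simp add: card_gt_0_iff)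
      then have "convex hull (\<phi> ` ?\<rho>) \<inter> ball 0 r = {}" using odd by (rule T(4))
      moreover have "convex hull (\<psi> ` \<tau>) \<subseteq> convex hull (\<phi> ` ?\<rho>)"
      proof (rule hull_minimal)
        have "\<psi> n \<in> closed_segment (\<phi> u) (\<phi> v)" by (simp add: \<psi>_def midpoint_in_closed_segment)
        also have "\<dots> \<subseteq> convex hull (\<phi> ` ?\<rho>)"
          unfolding segment_convex_hull using w wn by (intro hull_mono) auto
        finally have "\<psi> n \<in> convex hull (\<phi> ` ?\<rho>)" .
        moreover have "\<psi> x \<in> convex hull (\<phi> ` ?\<rho>)" if "x \<in> \<tau>" "x \<noteq> n" for x
          using that by (intro hull_inc) (auto simp: \<psi>_def)
        ultimately show "\<psi> ` \<tau> \<subseteq> convex hull (\<phi> ` ?\<rho>)" by auto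
      qed simp
      ultimately show ?thesis by blast
    qed (use T(2) \<tau>(1) in auto)
  qed
  moreover have "odd (\<Sum>\<sigma>\<in>?T'. hit \<psi> \<sigma> {z})" if z: "z \<in> ball 0 r" "z \<notin> flats (\<psi> ` \<Union>?T')" for z
  proof -
    have "\<phi> ` \<Union>T = \<psi> ` \<Union>T" using eq[of "\<Union>T"] uv by simp
    also have "\<dots> \<subseteq> \<psi> ` \<Union>?T'" using Union_subset_Union_bisect[OF uv(1)] by (rule image_mono)
    finally have "z \<notin> flats (\<phi> ` \<Union>T)" using z flats_mono by blast
    then have "odd (\<Sum>\<sigma>\<in>T. hit \<phi> \<sigma> {z})" using T(5) z by blast
    moreover have "even (\<Sum>\<sigma>\<in>?T'. hit \<psi> \<sigma> {z}) = even (\<Sum>\<sigma>\<in>T. hit \<phi> \<sigma> {z})"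
      unfolding sum_bisect[OF T(1) uv(1,2)]
    proof (rule even_sum_cong)
      fix \<sigma> assume \<sigma>: "\<sigma> \<in> T"
      have hit: "hit \<psi> \<sigma> {z} = hit \<phi> \<sigma> {z}" using eq[OF nT[OF \<sigma>]] by (simp add: hit_def)
      show "even (if u \<in> \<sigma> \<and> v \<in> \<sigma> then hit \<psi> (insert n (\<sigma> - {v})) {z} + hit \<psi> (insert n (\<sigma> - {u})) {z}
          else hit \<psi> \<sigma> {z}) = even (hit \<phi> \<sigma> {z})"
      proof (cases "u \<in> \<sigma> \<and> v \<in> \<sigma>")
        case True
        then have ne: "n \<noteq> u" "n \<noteq> v" using nT[OF \<sigma>] by auto
        have "insert n (\<sigma> - {v}) \<in> ?T'" using True \<sigma> by (auto simp: bisect_def)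
        then have "insert n \<sigma> \<subseteq> \<Union>?T'" using Union_subset_Union_bisect[OF uv(1), of T n] \<sigma> by auto
        then have "z \<notin> flats (\<psi> ` insert n \<sigma>)" using z flats_mono by (metis image_mono subsetD)
        then have "even (hit \<psi> \<sigma> {z} + (hit \<psi> (insert n (\<sigma> - {v})) {z} + hit \<psi> (insert n (\<sigma> - {u})) {z}))"
          using True nT[OF \<sigma>] T(2)[OF \<sigma>] uv ne by (intro hit_bisect) (auto simp: \<psi>_def)
        then show ?thesis using True hit by simp
      next
        case False
        then show ?thesis using hit by auto
      qed
    qed
    ultimately show ?thesis by simp
  qed
  ultimately show ?thesis unfolding triangulation_def \<psi>_def[symmetric] by blast
qed

text \<open>Bisect a longest edge. All new edges are its halves or medians over it, hence not long,
  and one long edge disappears; so the number of long edges is a termination measure.\<close>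

lemma triangulation_shrink:
  fixes \<phi> :: "nat \<Rightarrow> 'a::euclidean_space"
  assumes "triangulation r K \<phi> T" "convex K" "\<And>x y. (x, y) \<in> edges T \<Longrightarrow> (dist (\<phi> x) (\<phi> y))\<^sup>2 \<le> L"
  shows "\<exists>\<psi> T'. triangulation r K \<psi> T' \<and> (\<forall>(x, y)\<in>edges T'. (dist (\<psi> x) (\<psi> y))\<^sup>2 \<le> 3 / 4 * L)"
  using assms(1,3)
proof (induction "card {(x, y) \<in> edges T. (dist (\<phi> x) (\<phi> y))\<^sup>2 > 3 / 4 * L}" arbitrary: \<phi> T rule: less_induct)
  case less
  let ?long = "\<lambda>\<phi> T. {(x, y) \<in> edges T. (dist (\<phi> x) (\<phi> y))\<^sup>2 > 3 / 4 * L}"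
  have finT: "finite T" using less.prems(1) by (simp add: triangulation_def)
  moreover have "finite \<sigma>" if "\<sigma> \<in> T" for \<sigma>
    using that less.prems(1) by (auto simp: triangulation_def intro: card_ge_0_finite)
  ultimately have finUT: "finite (\<Union>T)" by blast
  then have fin: "finite (edges T)"
    by (intro finite_subset[of "edges T" "\<Union>T \<times> \<Union>T"] finite_cartesian_product) (auto simp: edges_def)
  show ?case
  proof (cases "?long \<phi> T = {}")
    case True
    then show ?thesis using less.prems(1) by (intro exI[of _ \<phi>] exI[of _ T]) (auto simp: not_less)
  next
    case False
    define D where "D = (\<lambda>(x, y). dist (\<phi> x) (\<phi> y))"
    have ne: "edges T \<noteq> {}" using False by auto
    have "Max (D ` edges T) \<in> D ` edges T" using fin ne by (intro Max_in) auto
    then obtain u v where uv: "(u, v) \<in> edges T" "D (u, v) = Max (D ` edges T)" by (metis (no_types, lifting) imageE surj_pair)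
    have max: "dist (\<phi> x) (\<phi> y) \<le> dist (\<phi> u) (\<phi> v)" if "(x, y) \<in> edges T" for x y
    proof -
      have "D (x, y) \<le> D (u, v)" unfolding uv(2) using that fin by (intro Max_ge) auto
      then show ?thesis by (simp add: D_def)
    qed
    define M where "M = (dist (\<phi> u) (\<phi> v))\<^sup>2"
    have M: "M \<le> L" using less.prems(2)[OF uv(1)] by (simp add: M_def)
    have maxM: "(dist (\<phi> x) (\<phi> y))\<^sup>2 \<le> M" if "(x, y) \<in> edges T" for x y
      unfolding M_def using max[OF that] by (intro power_mono) auto
    obtain n where n: "n \<notin> \<Union>T" using finUT ex_new_if_finite infinite_UNIV_nat by blast
    have ne_uv: "u \<noteq> v" and nuv: "n \<noteq> u" "n \<noteq> v" using uv(1) n by (auto simp: edges_def)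
    define \<psi> where "\<psi> = \<phi>(n := midpoint (\<phi> u) (\<phi> v))"
    define T' where "T' = bisect u v n T"
    have tri: "triangulation r K \<psi> T'"
      unfolding \<psi>_def T'_def using less.prems(1) assms(2) ne_uv n nuv by (rule triangulation_bisect)
    have new: "(dist (midpoint (\<phi> u) (\<phi> v)) (\<phi> y))\<^sup>2 \<le> 3 / 4 * M" if "\<sigma> \<in> T" "u \<in> \<sigma>" "v \<in> \<sigma>" "y \<in> \<sigma>" for \<sigma> y
    proof -
      have "(dist (\<phi> u) (\<phi> y))\<^sup>2 + (dist (\<phi> v) (\<phi> y))\<^sup>2 \<le> 2 * M"
      proof (cases "y = u \<or> y = v")
        case True
        then show ?thesis by (auto simp: M_def dist_commute)
      next
        case False
        then have "(u, y) \<in> edges T" "(v, y) \<in> edges T" using that by (auto simp: edges_def)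
        from this[THEN maxM] show ?thesis by simp
      qed
      then show ?thesis unfolding dist_midpoint_sq M_def[symmetric] by (simp add: field_simps)
    qed
    have M0: "M \<ge> 0" by (simp add: M_def)
    have old_or_new: "(x, y) \<in> edges T - {(u, v)} \<and> dist (\<psi> x) (\<psi> y) = dist (\<phi> x) (\<phi> y) \<or> (dist (\<psi> x) (\<psi> y))\<^sup>2 \<le> 3 / 4 * M"
      if xy: "(x, y) \<in> edges T'" for x y
    proof -
      consider "(x, y) \<in> edges T - {(u, v)}"
        | \<sigma> where "\<sigma> \<in> T" "u \<in> \<sigma>" "v \<in> \<sigma>" "x = n" "y \<in> \<sigma>"
        | \<sigma> where "\<sigma> \<in> T" "u \<in> \<sigma>" "v \<in> \<sigma>" "y = n" "x \<in> \<sigma>"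
        using edges_bisect[OF ne_uv n] xy unfolding T'_def by blast
      then show ?thesis
      proof cases
        case 1
        then have "x \<noteq> n" "y \<noteq> n" using n by (auto simp: edges_def)
        then show ?thesis using 1 by (simp add: \<psi>_def)
      next
        case 2
        then have "y \<noteq> n" using n by auto
        then show ?thesis using 2 new[of \<sigma> y] by (simp add: \<psi>_def)
      next
        case 3
        then have "x \<noteq> n" using n by auto
        then show ?thesis using 3 new[of \<sigma> x] by (simp add: \<psi>_def dist_commute)
      qed
    qed
    have "?long \<psi> T' \<subseteq> ?long \<phi> T - {(u, v)}"
    proof clarify
      fix x y assume xy: "(x, y) \<in> edges T'" "(dist (\<psi> x) (\<psi> y))\<^sup>2 > 3 / 4 * L"
      then have "\<not> (dist (\<psi> x) (\<psi> y))\<^sup>2 \<le> 3 / 4 * M" using M by simp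
      then have "(x, y) \<in> edges T - {(u, v)} \<and> dist (\<psi> x) (\<psi> y) = dist (\<phi> x) (\<phi> y)"
        using old_or_new[OF xy(1)] by blast
      then show "(x, y) \<in> ?long \<phi> T - {(u, v)}" using xy by auto
    qed
    moreover have "(u, v) \<in> ?long \<phi> T"
    proof -
      obtain x y where "(x, y) \<in> edges T" "(dist (\<phi> x) (\<phi> y))\<^sup>2 > 3 / 4 * L" using False by auto
      then have "3 / 4 * L < M" using maxM[of x y] by linarith
      then show ?thesis using uv(1) by (simp add: M_def)
    qed
    ultimately have "?long \<psi> T' \<subset> ?long \<phi> T" by blast
    moreover have "finite (?long \<phi> T)" using fin by (rule finite_subset[rotated]) auto
    ultimately have "card (?long \<psi> T') < card (?long \<phi> T)" by (rule psubset_card_mono[rotated])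
    moreover have "(dist (\<psi> x) (\<psi> y))\<^sup>2 \<le> L" if "(x, y) \<in> edges T'" for x y
      using old_or_new[OF that] less.prems(2)[of x y] M M0 by auto
    ultimately show ?thesis using less.hyps tri by blast
  qed
qed

text \<open>A single cell suffices: the standard simplex, enlarged so that an inscribed ball becomes
  the given one. Its proper faces miss its interior.\<close>

lemma triangulation_simplex:
  fixes r :: real
  assumes r: "r > 0"
  shows "\<exists>K \<phi> T. compact K \<and> convex K \<and> triangulation r (K :: 'a::euclidean_space set) \<phi> T"
proof -
  define S where "S = insert 0 (Basis :: 'a set)"
  have S: "finite S" "card S = Suc DIM('a)" by (auto simp: S_def)
  have indep: "\<not> affine_dependent S"
    unfolding S_def by (subst affine_dependent_iff_dependent) (auto simp: independent_Basis)
  have "interior (convex hull S) \<noteq> {}"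
    unfolding S_def using interior_simplex_nonempty[of "Basis :: 'a set"] independent_Basis by auto
  then obtain c e where ce: "e > 0" "ball c e \<subseteq> interior (convex hull S)"
    by (metis equals0I open_contains_ball open_interior)
  \<comment> \<open>The dilation with translation that takes \<open>ball c e\<close> to
    \<open>ball 0 r\<close>.\<close>
  define f where "f x = - (r / e) *\<^sub>R c + (r / e) *\<^sub>R x" for x :: 'a
  have hull_f: "convex hull (f ` A) = f ` (convex hull A)" for A
    unfolding f_def by (rule convex_hull_affinity)
  have f_ball: "x \<in> ball c e" if "f x \<in> ball 0 r" for x
  proof -
    have "f x = (r / e) *\<^sub>R (x - c)" by (simp add: f_def algebra_simps)
    then have "norm (f x) = r / e * norm (x - c)" using r ce by simp
    then have "r / e * norm (x - c) < r / e * e" using that r ce by simp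
    then have "norm (x - c) < e" using r ce by (subst (asm) mult_less_cancel_left_pos) auto
    then show ?thesis by (simp add: dist_norm norm_minus_commute)
  qed
  have surj: "\<exists>x. z = f x" for z
    using r ce by (intro exI[of _ "c + (e / r) *\<^sub>R z"]) (simp add: f_def algebra_simps)
  obtain g where g: "bij_betw g {..DIM('a)} S"
    using S by (metis bij_betw_iff_card card_atMost finite_atMost)
  define \<phi> where "\<phi> = f \<circ> g"
  define K where "K = convex hull (f ` S)"
  have gS: "g ` {..DIM('a)} = S" using g by (simp add: bij_betw_def)
  have "triangulation r K \<phi> {{..DIM('a)}}"
    unfolding triangulation_def
  proof (intro conjI ballI allI impI)
    show "\<phi> ` \<Union>{{..DIM('a)}} \<subseteq> K" using gS by (auto simp: \<phi>_def K_def hull_inc image_image)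
  next
    fix \<tau> :: "nat set"
    assume \<tau>: "card \<tau> = DIM('a)" "odd (\<Sum>\<sigma>\<in>{{..DIM('a)}}. of_bool (\<tau> \<subseteq> \<sigma>) :: nat)"
    then have sub: "\<tau> \<subseteq> {..DIM('a)}" by (cases "\<tau> \<subseteq> {..DIM('a)}") (simp_all del: sum_of_bool_eq)
    have "g ` \<tau> \<subseteq> S" using sub gS by auto
    have card: "card (g ` \<tau>) = DIM('a)" using g sub \<tau>(1) by (metis bij_betw_def card_image inj_on_subset)
    have "convex hull (g ` \<tau>) face_of convex hull S"
      using face_of_convex_hull_affine_independent[OF indep] \<open>g ` \<tau> \<subseteq> S\<close> by blast
    moreover have "convex hull (g ` \<tau>) \<noteq> convex hull S"
    proof
      assume "convex hull (g ` \<tau>) = convex hull S"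
      then have "interior (convex hull S) \<subseteq> interior (affine hull (g ` \<tau>))"
        by (metis convex_hull_subset_affine_hull interior_mono)
      moreover have "interior (affine hull (g ` \<tau>)) = {}"
        using card \<open>g ` \<tau> \<subseteq> S\<close> S(1) by (intro empty_interior_affine_hull) (auto dest: finite_subset)
      ultimately show False using ce by auto
    qed
    ultimately have "convex hull (g ` \<tau>) \<inter> interior (convex hull S) = {}" by (rule face_of_disjoint_interior)
    then have "x \<notin> ball c e" if "x \<in> convex hull (g ` \<tau>)" for x using ce that by blast
    then show "convex hull (\<phi> ` \<tau>) \<inter> ball 0 r = {}"
      using f_ball by (simp only: \<phi>_def image_comp[symmetric] hull_f) blast
  next
    fix z :: 'a assume z: "z \<in> ball 0 r"
    obtain x where x: "z = f x" using surj by blast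
    then have "x \<in> convex hull S" using f_ball z ce interior_subset by blast
    then have "z \<in> convex hull (\<phi> ` {..DIM('a)})" using x gS by (simp add: \<phi>_def hull_f flip: image_image)
    then show "odd (\<Sum>\<sigma>\<in>{{..DIM('a)}}. hit \<phi> \<sigma> {z})" by (simp add: hit_def)
  qed auto
  moreover have "compact K" "convex K" using S(1) by (simp_all add: K_def compact_convex_hull finite_imp_compact)
  ultimately show ?thesis by blast
qed

text \<open>The order of quantifiers matters: \<open>K\<close> is fixed before the mesh, because the
  mesh will be chosen from an estimate uniform over \<open>K\<close>.\<close>

lemma fine_triangulation:
  fixes r :: real
  assumes r: "r > 0"
  shows "\<exists>K. compact (K :: 'a::euclidean_space set) \<and> (\<forall>\<eta>>0. \<exists>\<phi> T. triangulation r K \<phi> T \<and>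
    (\<forall>\<sigma>\<in>T. \<forall>x\<in>\<sigma>. \<forall>y\<in>\<sigma>. dist (\<phi> x) (\<phi> y) \<le> \<eta>))"
proof -
  obtain K \<phi> T where K: "compact K" "convex K" and tri: "triangulation r (K :: 'a set) \<phi> T"
    using triangulation_simplex[OF r] by blast
  obtain L where L: "\<And>x y. \<lbrakk>x \<in> K; y \<in> K\<rbrakk> \<Longrightarrow> dist x y \<le> L"
    using compact_imp_bounded[OF K(1)] by (metis bounded_two_points)
  have iter: "\<exists>\<psi> T'. triangulation r K \<psi> T' \<and> (\<forall>(x, y)\<in>edges T'. (dist (\<psi> x) (\<psi> y))\<^sup>2 \<le> (3 / 4) ^ j * L\<^sup>2)" for j
  proof (induction j)
    case 0
    have "dist (\<phi> x) (\<phi> y) \<le> L" if "(x, y) \<in> edges T" for x y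
      using that tri by (intro L) (auto simp: edges_def triangulation_def)
    then show ?case using tri by (intro exI[of _ \<phi>] exI[of _ T]) (auto intro!: power_mono)
  next
    case (Suc j)
    then obtain \<psi> T' where "triangulation r K \<psi> T'" "\<forall>(x, y)\<in>edges T'. (dist (\<psi> x) (\<psi> y))\<^sup>2 \<le> (3 / 4) ^ j * L\<^sup>2" by blast
    then have "\<exists>\<psi> T'. triangulation r K \<psi> T' \<and> (\<forall>(x, y)\<in>edges T'. (dist (\<psi> x) (\<psi> y))\<^sup>2 \<le> 3 / 4 * ((3 / 4) ^ j * L\<^sup>2))"
      using K(2) by (intro triangulation_shrink[of r K \<psi> T']) auto
    then show ?case by (simp only: power_Suc mult.assoc)
  qed
  have "\<exists>\<phi> T. triangulation r K \<phi> T \<and> (\<forall>\<sigma>\<in>T. \<forall>x\<in>\<sigma>. \<forall>y\<in>\<sigma>. dist (\<phi> x) (\<phi> y) \<le> \<eta>)" if \<eta>: "\<eta> > 0" for \<eta> :: real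
  proof -
    have "(\<lambda>j. (3 / 4) ^ j * L\<^sup>2) \<longlonglongrightarrow> 0 * L\<^sup>2" by (intro tendsto_mult LIMSEQ_power_zero tendsto_const) auto
    then have "\<forall>\<^sub>F j in sequentially. (3 / 4) ^ j * L\<^sup>2 < \<eta>\<^sup>2" using \<eta> by (intro order_tendstoD) auto
    then obtain j where j: "(3 / 4) ^ j * L\<^sup>2 < \<eta>\<^sup>2" by (meson eventually_sequentially order_refl)
    obtain \<psi> T' where T': "triangulation r K \<psi> T'" "\<forall>(x, y)\<in>edges T'. (dist (\<psi> x) (\<psi> y))\<^sup>2 \<le> (3 / 4) ^ j * L\<^sup>2"
      using iter by blast
    have "dist (\<psi> x) (\<psi> y) \<le> \<eta>" if "\<sigma> \<in> T'" "x \<in> \<sigma>" "y \<in> \<sigma>" for \<sigma> x y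
    proof (cases "x = y")
      case False
      then have "(x, y) \<in> edges T'" using that by (auto simp: edges_def)
      then have "(dist (\<psi> x) (\<psi> y))\<^sup>2 \<le> (3 / 4) ^ j * L\<^sup>2" using T' by blast
      then have "(dist (\<psi> x) (\<psi> y))\<^sup>2 \<le> \<eta>\<^sup>2" using j by simp
      then show ?thesis using \<eta> by (simp add: power2_le_iff_abs_le)
    qed (use \<eta> in simp)
    then show ?thesis using T' by blast
  qed
  then show ?thesis using K by blast
qed

section \<open>Random convex hulls\<close>

text \<open>The Minkowski sum of the perturbed hull and a ball of radius e is convex and contains
  all original generators.\<close>

lemma convex_hull_perturb:
  fixes x y :: "'i \<Rightarrow> 'a::euclidean_space"
  assumes "p \<in> convex hull (A \<union> x ` I)" "\<And>i. i \<in> I \<Longrightarrow> dist (x i) (y i) \<le> e" "0 \<le> e"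
  obtains q where "q \<in> convex hull (A \<union> y ` I)" "dist p q \<le> e"
proof -
  let ?S = "\<Union>a\<in>convex hull (A \<union> y ` I). \<Union>b\<in>cball 0 e. {a + b}"
  have "convex hull (A \<union> x ` I) \<subseteq> ?S"
  proof (rule hull_minimal)
    show "A \<union> x ` I \<subseteq> ?S"
    proof
      fix z assume "z \<in> A \<union> x ` I"
      then consider "z \<in> A" | i where "i \<in> I" "z = x i" by blast
      then show "z \<in> ?S"
      proof cases
        case 1
        then have "z \<in> convex hull (A \<union> y ` I)" by (intro hull_inc) simp
        then show ?thesis using assms(3) by (intro UN_I[of z] UN_I[of 0]) auto
      next
        case 2
        then have "y i \<in> convex hull (A \<union> y ` I)" "x i - y i \<in> cball 0 e"
          using assms(2)[of i] by (auto intro: hull_inc simp: dist_norm norm_minus_commute)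
        then show ?thesis using 2 by (intro UN_I[of "y i"] UN_I[of "x i - y i"]) auto
      qed
    qed
  qed (intro convex_sums convex_convex_hull convex_cball)
  then have "p \<in> ?S" using assms(1) by blast
  then obtain a b where ab: "a \<in> convex hull (A \<union> y ` I)" "norm b \<le> e" "p = a + b" by auto
  then show ?thesis using that[of a] by (simp add: dist_norm)
qed

lemma setdist_convex_hull_perturb:
  fixes x y :: "'i \<Rightarrow> 'a::euclidean_space"
  assumes "C \<noteq> {}" "A \<union> x ` I \<noteq> {}" "\<And>i. i \<in> I \<Longrightarrow> dist (x i) (y i) \<le> e" "0 \<le> e"
  shows "setdist C (convex hull (A \<union> y ` I)) \<le> setdist C (convex hull (A \<union> x ` I)) + e"
proof -
  have "setdist C (convex hull (A \<union> y ` I)) - e \<le> setdist C (convex hull (A \<union> x ` I))"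
  proof (rule le_setdistI)
    fix s p assume s: "s \<in> C" and p: "p \<in> convex hull (A \<union> x ` I)"
    obtain q where q: "q \<in> convex hull (A \<union> y ` I)" "dist p q \<le> e"
      using convex_hull_perturb[OF p assms(3,4)] by blast
    have "setdist C (convex hull (A \<union> y ` I)) \<le> dist s q" using s q(1) by (rule setdist_le_dist)
    also have "\<dots> \<le> dist s p + dist p q" by (rule dist_triangle)
    finally show "setdist C (convex hull (A \<union> y ` I)) - e \<le> dist s p" using q(2) by simp
  qed (use assms in auto)
  then show ?thesis by simp
qed

lemma continuous_on_setdist_convex_hull:
  fixes C :: "'a::euclidean_space set"
  assumes "finite I"
  shows "continuous_on UNIV (\<lambda>x :: 'i \<Rightarrow> 'a. setdist C (convex hull (A \<union> x ` I)))"
proof (cases "C = {} \<or> (A = {} \<and> I = {})")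
  case False
  then have ne: "C \<noteq> {}" "A \<union> x ` I \<noteq> {}" for x :: "'i \<Rightarrow> 'a" by auto
  have "\<forall>\<^sub>F y in at x. dist (setdist C (convex hull (A \<union> y ` I))) (setdist C (convex hull (A \<union> x ` I))) < e"
    if e: "0 < e" for x :: "'i \<Rightarrow> 'a" and e
  proof -
    have "((\<lambda>y. y i) \<longlongrightarrow> x i) (at x)" for i
      using continuous_on_product_coordinates[where ?'b = 'a, of i] by (simp add: continuous_on_def)
    then have "\<forall>\<^sub>F y in at x. dist (y i) (x i) < e / 2" for i
      using e by (intro tendstoD) auto
    then have "\<forall>\<^sub>F y in at x. \<forall>i\<in>I. dist (y i) (x i) < e / 2" using assms by (simp add: eventually_ball_finite)
    then show ?thesis
    proof (rule eventually_mono)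
      fix y assume y: "\<forall>i\<in>I. dist (y i) (x i) < e / 2"
      then have "dist (y i) (x i) \<le> e / 2" "dist (x i) (y i) \<le> e / 2" if "i \<in> I" for i
        using that by (force simp: dist_commute)+
      then have "setdist C (convex hull (A \<union> y ` I)) \<le> setdist C (convex hull (A \<union> x ` I)) + e / 2"
        "setdist C (convex hull (A \<union> x ` I)) \<le> setdist C (convex hull (A \<union> y ` I)) + e / 2"
        using ne e by (intro setdist_convex_hull_perturb; simp)+
      then show "dist (setdist C (convex hull (A \<union> y ` I))) (setdist C (convex hull (A \<union> x ` I))) < e"
        using e by (simp add: dist_real_def abs_if)
    qed
  qed
  then show ?thesis by (simp add: continuous_on_def tendsto_iff)
qed auto

lemma setdist_convex_hull_measurable:
  fixes C :: "'a::euclidean_space set" and M :: "nat \<Rightarrow> 'a measure"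
  assumes "finite I" and sets: "\<And>i. sets (M i) = sets borel"
  shows "(\<lambda>x. setdist C (convex hull (A \<union> x ` I))) \<in> borel_measurable (PiM I M)"
proof -
  \<comment> \<open>Extension by zero outside \<open>I\<close>, which reduces the claim to
    continuity on the whole function space.\<close>
  define E :: "(nat \<Rightarrow> 'a) \<Rightarrow> nat \<Rightarrow> 'a" where "E x = (\<lambda>i. if i \<in> I then x i else 0)" for x
  have "E \<in> borel_measurable (PiM I M)"
  proof (rule measurable_coordinatewise_then_product)
    fix i
    show "(\<lambda>x. E x i) \<in> borel_measurable (PiM I M)"
    proof (cases "i \<in> I")
      case True
      then have "(\<lambda>x. x i) \<in> measurable (PiM I M) (M i)" by (rule measurable_component_singleton)
      then show ?thesis using True sets[of i] by (simp add: E_def cong: measurable_cong_sets)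
    qed (simp add: E_def)
  qed
  moreover have "(\<lambda>x :: nat \<Rightarrow> 'a. setdist C (convex hull (A \<union> x ` I))) \<in> borel_measurable borel"
    using assms(1) by (intro borel_measurable_continuous_onI continuous_on_setdist_convex_hull)
  ultimately have "(\<lambda>x. setdist C (convex hull (A \<union> E x ` I))) \<in> borel_measurable (PiM I M)"
    by (rule measurable_compose)
  moreover have "E x ` I = x ` I" for x by (auto simp: E_def)
  ultimately show ?thesis by simp
qed

lemma setdist_eq_0_convex_hulls:
  assumes "compact C" "C \<noteq> {}" "finite Y" "Y \<noteq> {}"
  shows "setdist C (convex hull Y) = 0 \<longleftrightarrow> C \<inter> convex hull (Y :: 'a::euclidean_space set) \<noteq> {}"
  using setdist_eq_0_compact_closed[of C "convex hull Y"] assms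
  by (simp add: compact_imp_closed compact_convex_hull finite_imp_compact)

text \<open>For compact sets, meeting means distance zero. The set \<open>A\<close> collects the
  points already fixed, in use the apices.\<close>

lemma convex_hulls_meet_measurable:
  fixes C :: "'a::euclidean_space set" and M :: "nat \<Rightarrow> 'a measure"
  assumes "finite I" "compact C" "finite A" and sets: "\<And>i. sets (M i) = sets borel"
  shows "Measurable.pred (PiM I M) (\<lambda>x. C \<inter> convex hull (A \<union> x ` I) \<noteq> {})"
proof (cases "C = {} \<or> (A = {} \<and> I = {})")
  case True
  then have "C \<inter> convex hull (A \<union> x ` I) = {}" for x :: "nat \<Rightarrow> 'a" by auto
  then show ?thesis by simp
next
  case False
  then have "setdist C (convex hull (A \<union> x ` I)) = 0 \<longleftrightarrow> C \<inter> convex hull (A \<union> x ` I) \<noteq> {}" for x :: "nat \<Rightarrow> 'a"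
    using assms by (intro setdist_eq_0_convex_hulls) auto
  moreover have "Measurable.pred (PiM I M) (\<lambda>x. setdist C (convex hull (A \<union> x ` I)) = 0)"
    using setdist_convex_hull_measurable[OF assms(1) sets, of C A] by measurable
  ultimately show ?thesis by simp
qed

lemma hit_measurable:
  fixes \<phi> :: "'i \<Rightarrow> 'a::euclidean_space" and M :: "nat \<Rightarrow> 'a measure"
  assumes "finite I" "finite P" "finite A" and sets: "\<And>i. sets (M i) = sets borel"
  shows "(\<lambda>x. hit \<phi> P (A \<union> x ` I)) \<in> borel_measurable (PiM I M)"
proof -
  have "compact (convex hull (\<phi> ` P))" using assms by (simp add: compact_convex_hull finite_imp_compact)
  note convex_hulls_meet_measurable[OF assms(1) this assms(3) sets, measurable]
  show ?thesis unfolding hit_def of_bool_def by measurable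
qed

lemma iter_measurable:
  fixes \<phi> :: "'i \<Rightarrow> 'a::euclidean_space" and M :: "nat \<Rightarrow> 'a measure"
  assumes "finite I" "finite P" "finite A" and sets: "\<And>i. sets (M i) = sets borel"
  shows "(\<lambda>x. iter \<phi> a k P (A \<union> x ` I)) \<in> borel_measurable (PiM I M)"
  using assms(2,3)
proof (induction k arbitrary: P A)
  case 0
  then show ?case using hit_measurable[OF assms(1) 0 sets] by simp
next
  case (Suc k)
  have "(\<lambda>x. iter \<phi> a k (P - {v}) (insert b A \<union> x ` I)) \<in> borel_measurable (PiM I M)" for v b
    using Suc.prems by (intro Suc.IH) auto
  then show ?case
    using hit_measurable[OF assms(1) Suc.prems sets, of \<phi>]
    by (auto simp del: Un_insert_left simp add: Un_insert_left[symmetric] intro!: borel_measurable_add borel_measurable_sum)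
qed

lemma iter_insert_measurable:
  fixes \<phi> :: "'i \<Rightarrow> 'a::euclidean_space" and M :: "'a measure"
  assumes "finite P" "finite A" and sets: "sets M = sets borel"
  shows "(\<lambda>y. iter \<phi> a k P (insert y A)) \<in> borel_measurable M"
proof -
  have "(\<lambda>y. \<lambda>i\<in>{0::nat}. y) \<in> measurable M (PiM {0} (\<lambda>_. M))"
    by (intro measurable_restrict) simp
  then have "(\<lambda>y. iter \<phi> a k P (A \<union> (\<lambda>i\<in>{0::nat}. y) ` {0})) \<in> borel_measurable M"
    by (rule measurable_compose) (intro iter_measurable assms finite.intros)
  then show ?thesis by simp
qed

section \<open>Absolutely continuous families and almost sure avoidance\<close>

locale ac_family =
  fixes M :: "nat \<Rightarrow> 'a::euclidean_space measure"
  assumes prob: "prob_space (M i)" and sets[measurable_cong]: "sets (M i) = sets borel"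
    and ac: "absolutely_continuous lborel (M i)"
begin

sublocale product_sigma_finite M
  using prob by (simp add: product_sigma_finite_def prob_space_imp_sigma_finite)

sublocale P: prob_space "PiM I M" for I
  using prob by (rule prob_space_PiM)

sublocale N: prob_space "M i" for i
  by (rule prob)

lemma AE_notin: "Z \<in> null_sets lborel \<Longrightarrow> AE x in M i. x \<notin> Z"
  using ac by (intro AE_not_in) (auto simp: absolutely_continuous_def)

lemma insert_comp_measurable:
  "i \<notin> I \<Longrightarrow> x \<in> space (PiM I M) \<Longrightarrow> (\<lambda>y. x(i := y)) \<in> measurable (M i) (PiM (insert i I) M)"
  by measurable

text \<open>The last point entering the hull would have to lie in a flat spanned by at most d others.\<close>
lemma emeasure_convex_hulls_meet_eq_0:
  assumes "finite I" "finite W" "W \<noteq> {}" "card W + card I \<le> Suc DIM('a)"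
  shows "emeasure (PiM I M) {x \<in> space (PiM I M). convex hull W \<inter> convex hull (x ` I) \<noteq> {}} = 0"
  using assms(1,4)
proof (induction I)
  case empty
  then show ?case by simp
next
  case (insert i I)
  have compact: "compact (convex hull W)" using assms by (simp add: compact_convex_hull finite_imp_compact)
  have meas: "Measurable.pred (PiM J M) (\<lambda>x. convex hull W \<inter> convex hull (x ` J) \<noteq> {})" if "finite J" for J
    using convex_hulls_meet_measurable[OF that compact, of "{}" M] sets by simp
  define f where "f x = (of_bool (convex hull W \<inter> convex hull (x ` insert i I) \<noteq> {}) :: ennreal)" for x :: "nat \<Rightarrow> 'a"
  have fm: "f \<in> borel_measurable (PiM (insert i I) M)"
  proof -
    have [measurable]: "Measurable.pred (PiM (insert i I) M) (\<lambda>x. convex hull W \<inter> convex hull (x ` insert i I) \<noteq> {})"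
      using insert.hyps by (intro meas) simp
    show ?thesis unfolding f_def of_bool_def by measurable
  qed
  have IH: "AE x in PiM I M. convex hull W \<inter> convex hull (x ` I) = {}"
    using insert.IH insert.prems insert.hyps meas[of I]
    by (subst AE_iff_measurable[OF _ refl]) auto
  have "AE x in PiM I M. (\<integral>\<^sup>+ y. f (x(i := y)) \<partial>M i) = 0"
    using IH AE_space
  proof eventually_elim
    case (elim x)
    have fin: "finite (W \<union> x ` I)" using assms insert by auto
    have card: "card (W \<union> x ` I) \<le> DIM('a)"
    proof -
      have "card (W \<union> x ` I) \<le> card W + card (x ` I)" by (rule card_Un_le)
      also have "\<dots> \<le> card W + card I" using insert.hyps by (simp add: card_image_le)
      finally show ?thesis using insert by simp
    qed
    have "AE y in M i. y \<notin> affine hull (W \<union> x ` I)"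
      using fin card by (intro AE_notin affine_hull_null_sets)
    then have "AE y in M i. f (x(i := y)) = 0"
    proof eventually_elim
      case (elim y)
      have "x(i := y) ` insert i I = insert y (x ` I)" using insert.hyps by auto
      moreover have "convex hull W \<inter> convex hull (insert y (x ` I)) = {}"
        using in_affine_hull_if_convex_hulls_meet[of "x ` I" _ y W] elim \<open>convex hull W \<inter> convex hull (x ` I) = {}\<close>
          insert.hyps by (meson disjoint_iff finite_imageI)
      ultimately show ?case unfolding f_def by simp
    qed
    moreover have "(\<lambda>y. f (x(i := y))) \<in> borel_measurable (M i)"
      using insert_comp_measurable[OF insert.hyps(2) elim(2)] fm by (rule measurable_compose)
    ultimately show ?case by (simp add: nn_integral_0_iff_AE)
  qed
  then have "(\<integral>\<^sup>+ x. (\<integral>\<^sup>+ y. f (x(i := y)) \<partial>M i) \<partial>PiM I M) = (\<integral>\<^sup>+ x. 0 \<partial>PiM I M)"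
    by (rule nn_integral_cong_AE)
  then have "integral\<^sup>N (PiM (insert i I) M) f = 0"
    using product_nn_integral_insert[OF insert.hyps fm] by simp
  moreover define E where "E = {x \<in> space (PiM (insert i I) M). convex hull W \<inter> convex hull (x ` insert i I) \<noteq> {}}"
  have "integral\<^sup>N (PiM (insert i I) M) f = integral\<^sup>N (PiM (insert i I) M) (indicator E)"
    by (intro nn_integral_cong) (simp add: f_def E_def indicator_def)
  also have "\<dots> = emeasure (PiM (insert i I) M) E"
    using meas[of "insert i I"] insert.hyps unfolding E_def by (intro nn_integral_indicator) (simp only: pred_def finite.insertI)
  ultimately have "emeasure (PiM (insert i I) M) E = 0" by simp
  then show ?case by (simp add: E_def)
qed

end

text \<open>The probability that p lies in the random hull is upper semicontinuous in p.\<close>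
lemma measure_in_convex_hull_ge:
  fixes M :: "nat \<Rightarrow> 'a::euclidean_space measure"
  assumes prob: "\<And>i. prob_space (M i)" and sets: "\<And>i. sets (M i) = sets borel"
    and I: "finite I" "I \<noteq> {}"
    and lim: "p \<longlonglongrightarrow> q" "\<eta> \<longlonglongrightarrow> 0" "c \<longlonglongrightarrow> c'"
    and ge: "\<And>n. measure (PiM I M) {x \<in> space (PiM I M). setdist {p n} (convex hull (x ` I)) \<le> \<eta> n} \<ge> c n"
  shows "measure (PiM I M) {x \<in> space (PiM I M). q \<in> convex hull (x ` I)} \<ge> c'"
proof -
  interpret prob_space "PiM I M" using prob by (rule prob_space_PiM)
  define h where "h q x = setdist {q} (convex hull (x ` I))" for q and x :: "nat \<Rightarrow> 'a"
  have h[measurable]: "h q \<in> borel_measurable (PiM I M)" for q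
    using setdist_convex_hull_measurable[where M = M and C = "{q}" and A = "{}", OF I(1) sets] by (simp add: h_def[abs_def])
  \<comment> \<open>These events decrease to the event that \<open>q\<close> lies in the closed
    hull. Since the distance is 1-Lipschitz in the point, the event at \<open>p n\<close> is
    eventually contained in \<open>D j\<close>.\<close>
  define D where "D j = {x \<in> space (PiM I M). h q x \<le> inverse (Suc j)}" for j
  have "(\<lambda>j. measure (PiM I M) (D j)) \<longlonglongrightarrow> measure (PiM I M) (\<Inter>j. D j)"
  proof (rule finite_Lim_measure_decseq)
    show "range D \<subseteq> events" unfolding D_def by auto
    have "inverse (real (Suc n)) \<le> inverse (real (Suc m))" if "m \<le> n" for m n using that by (simp add: field_simps)
    then show "decseq D" unfolding D_def decseq_def by (auto intro: order_trans)
  qed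
  moreover have "measure (PiM I M) (D j) \<ge> c'" for j
  proof -
    have pos: "inverse (real (Suc j)) > 0" by simp
    have "(\<lambda>n. dist (p n) q + \<eta> n) \<longlonglongrightarrow> 0 + 0"
      using lim by (intro tendsto_add) (simp_all add: tendsto_dist_iff[symmetric])
    then have "\<forall>\<^sub>F n in sequentially. dist (p n) q + \<eta> n < inverse (Suc j)"
      using pos by (intro order_tendstoD) auto
    then have "\<forall>\<^sub>F n in sequentially. c n \<le> measure (PiM I M) (D j)"
    proof (rule eventually_mono)
      fix n assume n: "dist (p n) q + \<eta> n < inverse (real (Suc j))"
      have "h q x \<le> inverse (real (Suc j))" if "h (p n) x \<le> \<eta> n" for x
        using that n setdist_Lipschitz[of "p n" "convex hull (x ` I)" q] unfolding h_def by linarith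
      then have "{x \<in> space (PiM I M). h (p n) x \<le> \<eta> n} \<subseteq> D j" unfolding D_def by auto
      then have "measure (PiM I M) {x \<in> space (PiM I M). h (p n) x \<le> \<eta> n} \<le> measure (PiM I M) (D j)"
        by (rule finite_measure_mono) (simp add: D_def)
      then show "c n \<le> measure (PiM I M) (D j)" using ge[of n] unfolding h_def by simp
    qed
    then show ?thesis using lim(3) by (intro tendsto_upperbound[of c c' sequentially]) auto
  qed
  ultimately have "c' \<le> measure (PiM I M) (\<Inter>j. D j)" by (intro LIMSEQ_le_const) auto
  also have "(\<Inter>j. D j) = {x \<in> space (PiM I M). q \<in> convex hull (x ` I)}"
  proof -
    have "(\<forall>j. h q x \<le> inverse (real (Suc j))) \<longleftrightarrow> q \<in> convex hull (x ` I)" for x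
    proof -
      have "(\<forall>j. h q x \<le> inverse (real (Suc j))) \<longleftrightarrow> h q x \<le> 0"
      proof
        assume *: "\<forall>j. h q x \<le> inverse (real (Suc j))"
        show "h q x \<le> 0" using LIMSEQ_le_const[OF LIMSEQ_inverse_real_of_nat, of "h q x"] * by auto
      next
        assume "h q x \<le> 0"
        then show "\<forall>j. h q x \<le> inverse (real (Suc j))" by (meson inverse_nonnegative_iff_nonnegative of_nat_0_le_iff order_trans)
      qed
      also have "\<dots> \<longleftrightarrow> h q x = 0" using setdist_pos_le[of "{q}"] by (auto simp: h_def intro: antisym)
      also have "\<dots> \<longleftrightarrow> q \<in> convex hull (x ` I)"
        unfolding h_def using I by (subst setdist_eq_0_convex_hulls) auto
      finally show ?thesis .
    qed
    then show ?thesis unfolding D_def by auto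
  qed
  finally show ?thesis .
qed

context ac_family begin

text \<open>Otherwise points of \<open>K\<close> violating the bound at radii tending to 0 would
  accumulate at some q lying in the hull of at most d random points with probability at least
  \<epsilon>; but that probability is 0.\<close>

lemma uniformly_rarely_near_convex_hull:
  assumes I: "finite I" "I \<noteq> {}" "card I \<le> DIM('a)" and K: "compact K" and \<epsilon>: "\<epsilon> > 0"
  shows "\<exists>\<eta>>0. \<forall>p\<in>K. measure (PiM I M) {x \<in> space (PiM I M). setdist {p} (convex hull (x ` I)) \<le> \<eta>} \<le> \<epsilon>"
proof (rule ccontr)
  define m where "m p \<eta> = measure (PiM I M) {x \<in> space (PiM I M). setdist {p} (convex hull (x ` I)) \<le> \<eta>}" for p \<eta>
  assume "\<not> ?thesis"
  then have neg: "\<exists>p\<in>K. m p \<eta> > \<epsilon>" if "\<eta> > 0" for \<eta> using that unfolding m_def by (meson not_le)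
  have "\<exists>p. p \<in> K \<and> m p (inverse (real (Suc n))) > \<epsilon>" for n using neg[of "inverse (real (Suc n))"] by auto
  then obtain p where p: "\<And>n. p n \<in> K" "\<And>n. m (p n) (inverse (real (Suc n))) > \<epsilon>" by metis
  obtain q s where q: "q \<in> K" "strict_mono (s :: nat \<Rightarrow> nat)" "(p \<circ> s) \<longlonglongrightarrow> q"
    using K p(1) unfolding compact_eq_seq_compact_metric seq_compact_def by metis
  have "measure (PiM I M) {x \<in> space (PiM I M). q \<in> convex hull (x ` I)} \<ge> \<epsilon>"
  proof (rule measure_in_convex_hull_ge)
    show "(\<lambda>n. inverse (real (Suc (s n)))) \<longlonglongrightarrow> 0"
      using LIMSEQ_subseq_LIMSEQ[OF LIMSEQ_inverse_real_of_nat q(2)] by (simp add: o_def)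
    show "(\<lambda>_. \<epsilon>) \<longlonglongrightarrow> \<epsilon>" by simp
    show "measure (PiM I M) {x \<in> space (PiM I M). setdist {(p \<circ> s) n} (convex hull (x ` I)) \<le> inverse (real (Suc (s n)))} \<ge> \<epsilon>" for n
      using p(2)[of "s n"] by (simp add: m_def)
  qed (use I q prob sets in \<open>auto simp: o_def\<close>)
  moreover have "emeasure (PiM I M) {x \<in> space (PiM I M). convex hull {q} \<inter> convex hull (x ` I) \<noteq> {}} = 0"
    using I by (intro emeasure_convex_hulls_meet_eq_0) auto
  then have "measure (PiM I M) {x \<in> space (PiM I M). q \<in> convex hull (x ` I)} = 0"
    by (simp add: measure_def)
  ultimately show False using \<epsilon> by simp
qed

end

section \<open>Generic choice of cone apices\<close>

text \<open>The cocycle relation for the three points w, x, y and a (d-1)-cycle: with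
  \<open>w\<close> fixed, the parity at \<open>{w, x}\<close> is a colour of x, and a pair is odd
  exactly when its colours differ. The genericity hypotheses follow the order in which the points
  are picked.\<close>

lemma iter_cocycle_triple:
  fixes \<phi> :: "nat \<Rightarrow> 'a::euclidean_space"
  assumes V: "finite V" "\<tau> \<subseteq> V" "card \<tau> = DIM('a)" and A: "finite A" "gp \<phi> V A" "a ` faces \<tau> \<subseteq> A" "inj_on a (faces \<tau>)"
    and gen: "w \<notin> flats (\<phi> ` V \<union> A)" "x \<notin> flats (\<phi> ` V \<union> insert w A)" "y \<notin> flats (\<phi> ` V \<union> insert x (insert w A))"
  shows "odd (iter \<phi> a (DIM('a) - 1) \<tau> {x, y}) \<longleftrightarrow>
    odd (iter \<phi> a (DIM('a) - 1) \<tau> {w, x}) \<noteq> odd (iter \<phi> a (DIM('a) - 1) \<tau> {w, y})"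
proof -
  have gp: "gp \<phi> V (insert y (insert x (insert w A)))"
    using A gen V(1) by (intro gp_insert) auto
  have notin: "w \<notin> A" "x \<notin> insert w A" "y \<notin> insert x (insert w A)"
    using gen[THEN notin_if_notin_flats] by simp_all
  have "even (\<Sum>u\<in>{w, x, y}. iter \<phi> a (DIM('a) - 1) \<tau> ({w, x, y} - {u}))"
  proof (rule iter_cocycle)
    show "gp \<phi> \<tau> ({w, x, y} \<union> a ` faces \<tau>)" using gp by (rule gp_mono) (use V A in auto)
    show "card {w, x, y} + (DIM('a) - 1) = DIM('a) + 2" using notin by (auto simp: card_insert_if Suc_diff_le)
    show "card \<tau> = Suc (DIM('a) - 1)" using V(3) by simp
    show "{w, x, y} \<inter> a ` faces \<tau> = {}" using notin A(3) by auto
  qed (use A in auto)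
  also have "(\<Sum>u\<in>{w, x, y}. iter \<phi> a (DIM('a) - 1) \<tau> ({w, x, y} - {u})) =
      iter \<phi> a (DIM('a) - 1) \<tau> {x, y} + (iter \<phi> a (DIM('a) - 1) \<tau> {w, y} + iter \<phi> a (DIM('a) - 1) \<tau> {w, x})"
    using notin by (auto simp: insert_Diff_if)
  finally show ?thesis by auto
qed

text \<open>The cocycle relation for two points and a d-cycle: mod 2 a top-dimensional cycle covers
  all generic points or none.\<close>

lemma iter_cocycle_pair:
  fixes \<phi> :: "nat \<Rightarrow> 'a::euclidean_space"
  assumes "card \<tau> = Suc DIM('a)" "gp \<phi> \<tau> ({w, x} \<union> a ` faces \<tau>)" "inj_on a (faces \<tau>)"
    and wx: "w \<noteq> x" "{w, x} \<inter> a ` faces \<tau> = {}"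
  shows "odd (iter \<phi> a DIM('a) \<tau> {x}) \<longleftrightarrow> odd (iter \<phi> a DIM('a) \<tau> {w})"
proof -
  have "even (\<Sum>u\<in>{w, x}. iter \<phi> a DIM('a) \<tau> ({w, x} - {u}))"
    using assms by (intro iter_cocycle) auto
  also have "(\<Sum>u\<in>{w, x}. iter \<phi> a DIM('a) \<tau> ({w, x} - {u})) =
      iter \<phi> a DIM('a) \<tau> {x} + iter \<phi> a DIM('a) \<tau> {w}"
    using wx(1) by (auto simp: insert_Diff_if)
  finally show ?thesis by auto
qed

text \<open>Greedy choice by increasing cardinality. The condition at a face reads only apices of
  strictly smaller faces, so it survives all later choices. Each new apex avoids the flats of the
  vertices and of all earlier apices, including those of faces of equal cardinality.\<close>

lemma generic_choice:
  fixes \<phi> :: "nat \<Rightarrow> 'a::euclidean_space" and F :: "nat set set" and V :: "nat set"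
  assumes "finite F" and V: "finite V"
    and cong: "\<And>a a' \<tau> y. \<lbrakk>\<tau> \<in> F; \<And>\<rho>. \<lbrakk>\<rho> \<in> F; card \<rho> < card \<tau>\<rbrakk> \<Longrightarrow> a \<rho> = a' \<rho>\<rbrakk> \<Longrightarrow> Q a \<tau> y = Q a' \<tau> y"
    and ex: "\<And>a \<tau> Z. \<lbrakk>\<tau> \<in> F; Z \<in> null_sets lborel; inj_on a {\<rho>\<in>F. card \<rho> < card \<tau>};
      gp \<phi> V (a ` {\<rho>\<in>F. card \<rho> < card \<tau>}); \<And>\<rho>. \<lbrakk>\<rho> \<in> F; card \<rho> < card \<tau>\<rbrakk> \<Longrightarrow> Q a \<rho> (a \<rho>)\<rbrakk>
      \<Longrightarrow> \<exists>y. y \<notin> Z \<and> Q a \<tau> y"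
  shows "\<exists>a. inj_on a F \<and> gp \<phi> V (a ` F) \<and> (\<forall>\<tau>\<in>F. Q a \<tau> (a \<tau>))"
  using assms(1) cong ex
proof (induction F rule: finite_ranking_induct[where f = card])
  case empty
  then show ?case using V by (simp add: gp_empty)
next
  case (insert \<sigma> S)
  show ?case
  proof (cases "\<sigma> \<in> S")
    case True
    show ?thesis
      unfolding insert_absorb[OF True]
      by (rule insert.IH; rule insert.prems[unfolded insert_absorb[OF True]]; assumption)
  next
    case False
    have below: "{\<rho>\<in>insert \<sigma> S. card \<rho> < card \<tau>} = {\<rho>\<in>S. card \<rho> < card \<tau>}" if "\<tau> \<in> insert \<sigma> S" for \<tau>
      using insert.hyps(2) that by (auto dest: leD)
    have lt: "\<rho> \<in> S" if "\<rho> \<in> insert \<sigma> S" "card \<rho> < card \<tau>" "\<tau> \<in> insert \<sigma> S" for \<rho> \<tau>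
      using below[OF that(3)] that by blast
    have "\<exists>a. inj_on a S \<and> gp \<phi> V (a ` S) \<and> (\<forall>\<tau>\<in>S. Q a \<tau> (a \<tau>))"
    proof (rule insert.IH)
      show "Q a \<tau> y = Q a' \<tau> y" if "\<tau> \<in> S" "\<And>\<rho>. \<lbrakk>\<rho> \<in> S; card \<rho> < card \<tau>\<rbrakk> \<Longrightarrow> a \<rho> = a' \<rho>" for a a' \<tau> y
        using that lt[of _ \<tau>] by (intro insert.prems(1)) auto
      show "\<exists>y. y \<notin> Z \<and> Q a \<tau> y" if "\<tau> \<in> S" "Z \<in> null_sets lborel" "inj_on a {\<rho>\<in>S. card \<rho> < card \<tau>}"
        "gp \<phi> V (a ` {\<rho>\<in>S. card \<rho> < card \<tau>})" "\<And>\<rho>. \<lbrakk>\<rho> \<in> S; card \<rho> < card \<tau>\<rbrakk> \<Longrightarrow> Q a \<rho> (a \<rho>)" for a \<tau> Z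
        using that lt[of _ \<tau>] below[of \<tau>] by (intro insert.prems(2)) auto
    qed
    then obtain a where a: "inj_on a S" "gp \<phi> V (a ` S)" "\<And>\<tau>. \<tau> \<in> S \<Longrightarrow> Q a \<tau> (a \<tau>)" by blast
    have "\<exists>y. y \<notin> flats (\<phi> ` V \<union> a ` S) \<and> Q a \<sigma> y"
    proof (rule insert.prems(2))
      show "flats (\<phi> ` V \<union> a ` S) \<in> null_sets lborel" using V insert.hyps(1) by (intro flats_null_sets) auto
      show "inj_on a {\<rho>\<in>insert \<sigma> S. card \<rho> < card \<sigma>}" using a(1) by (rule inj_on_subset) auto
      show "gp \<phi> V (a ` {\<rho>\<in>insert \<sigma> S. card \<rho> < card \<sigma>})" using a(2) by (rule gp_mono) auto
    qed (use a(3) in auto)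
    then obtain y where y: "y \<notin> flats (\<phi> ` V \<union> a ` S)" "Q a \<sigma> y" by blast
    define a' where "a' = a(\<sigma> := y)"
    have eq: "a' \<rho> = a \<rho>" if "\<rho> \<in> S" for \<rho> using that False by (auto simp: a'_def)
    then have img: "a' ` S = a ` S" by (rule image_cong[OF refl])
    have "y \<notin> a ` S" using notin_if_notin_flats[OF y(1)] by simp
    then have "inj_on a' (insert \<sigma> S)"
      using False a(1) img eq inj_on_cong[of S a' a] by (simp add: a'_def)
    moreover have "gp \<phi> V (a' ` insert \<sigma> S)"
    proof -
      have "a' ` insert \<sigma> S = insert y (a ` S)" unfolding image_insert img by (simp add: a'_def)
      then show ?thesis using gp_insert[OF V _ a(2) y(1)] insert.hyps(1) by simp
    qed
    moreover have "Q a' \<tau> (a' \<tau>)" if \<tau>: "\<tau> \<in> insert \<sigma> S" for \<tau>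
    proof -
      have "Q a' \<tau> (a' \<tau>) = Q a \<tau> (a' \<tau>)"
        using \<tau> lt[of _ \<tau>] eq by (intro insert.prems(1)) auto
      then show ?thesis using a(3) y(2) eq \<tau> by (cases "\<tau> = \<sigma>") (auto simp: a'_def)
    qed
    ultimately show ?thesis by blast
  qed
qed

lemma of_nat_ennreal_measurable: "(of_nat :: nat \<Rightarrow> ennreal) \<in> borel_measurable borel"
  by (intro borel_measurable_continuous_onI) (simp add: continuous_on_open_vimage open_discrete)

context ac_family begin

lemma iter_ennreal_measurable:
  assumes "finite I" "finite P"
  shows "(\<lambda>x. of_nat (iter \<phi> a k P (x ` I)) :: ennreal) \<in> borel_measurable (PiM I M)"
proof -
  have "(\<lambda>x. iter \<phi> a k P ({} \<union> x ` I)) \<in> borel_measurable (PiM I M)"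
    using assms sets by (intro iter_measurable) auto
  then show ?thesis by (intro measurable_compose[OF _ of_nat_ennreal_measurable]) simp
qed

text \<open>One cone for each facet: the factor \<open>card \<sigma>\<close> is where the factorial
  comes from.\<close>

lemma nn_integral_iter_Suc_le:
  fixes b \<epsilon> :: real
  assumes fin: "finite \<sigma>" "finite I" and "0 \<le> b" "0 \<le> \<epsilon>"
    and hit: "(\<integral>\<^sup>+ x. of_nat (hit \<phi> \<sigma> (x ` I)) \<partial>PiM I M) \<le> ennreal \<epsilon>"
    and le: "\<And>v. v \<in> \<sigma> \<Longrightarrow>
      (\<integral>\<^sup>+ x. of_nat (iter \<phi> a k (\<sigma> - {v}) (insert (a (\<sigma> - {v})) (x ` I))) \<partial>PiM I M) \<le> ennreal b"
  shows "(\<integral>\<^sup>+ x. of_nat (iter \<phi> a (Suc k) \<sigma> (x ` I)) \<partial>PiM I M) \<le> ennreal (\<epsilon> + card \<sigma> * b)"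
proof -
  have meas: "(\<lambda>x. of_nat (iter \<phi> a k (\<sigma> - {v}) (insert (a (\<sigma> - {v})) (x ` I))) :: ennreal) \<in> borel_measurable (PiM I M)" for v
    using iter_measurable[where A = "{a (\<sigma> - {v})}" and P = "\<sigma> - {v}", OF fin(2) _ _ sets] fin
    by (intro measurable_compose[OF _ of_nat_ennreal_measurable]) auto
  have hitm: "(\<lambda>x. of_nat (hit \<phi> \<sigma> (x ` I)) :: ennreal) \<in> borel_measurable (PiM I M)"
    using hit_measurable[where A = "{}", OF fin(2,1) _ sets]
    by (intro measurable_compose[OF _ of_nat_ennreal_measurable]) auto
  have "(\<integral>\<^sup>+ x. of_nat (iter \<phi> a (Suc k) \<sigma> (x ` I)) \<partial>PiM I M) =
      (\<integral>\<^sup>+ x. of_nat (hit \<phi> \<sigma> (x ` I)) \<partial>PiM I M) +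
      (\<Sum>v\<in>\<sigma>. \<integral>\<^sup>+ x. of_nat (iter \<phi> a k (\<sigma> - {v}) (insert (a (\<sigma> - {v})) (x ` I))) \<partial>PiM I M)"
    using meas hitm by (simp add: nn_integral_add nn_integral_sum)
  also have "\<dots> \<le> ennreal \<epsilon> + (\<Sum>v\<in>\<sigma>. ennreal b)"
    using hit le by (intro add_mono sum_mono)
  also have "\<dots> = ennreal (\<epsilon> + card \<sigma> * b)"
    using assms(3,4) by (simp add: ennreal_plus ennreal_mult ennreal_of_nat_eq_real_of_nat)
  finally show ?thesis .
qed

text \<open>In a probability space a function cannot exceed its mean almost everywhere; hence an
  admissible value of coordinate i exists even after null sets have been discarded.\<close>

lemma exists_slice_le:
  assumes I: "finite I" "i \<notin> I" and f[measurable]: "f \<in> borel_measurable (PiM (insert i I) M)"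
    and le: "(\<integral>\<^sup>+ x. f x \<partial>PiM (insert i I) M) \<le> ennreal c"
    and Z: "Z \<in> null_sets lborel" and R: "AE y in M i. R y"
  shows "\<exists>y. y \<notin> Z \<and> R y \<and> (\<integral>\<^sup>+ x. f (x(i := y)) \<partial>PiM I M) \<le> ennreal c"
proof (rule ccontr)
  assume neg: "\<not> ?thesis"
  interpret S: sigma_finite_measure "PiM I M" by (rule P.sigma_finite_measure_axioms)
  define g where "g y = (\<integral>\<^sup>+ x. f (x(i := y)) \<partial>PiM I M)" for y
  have [measurable]: "g \<in> borel_measurable (M i)" unfolding g_def by measurable
  have gt: "AE y in M i. ennreal c < g y"
    using AE_notin[OF Z] R by eventually_elim (use neg in \<open>auto simp: g_def not_le\<close>)
  have "(\<integral>\<^sup>+ y. ennreal c \<partial>M i) < (\<integral>\<^sup>+ y. g y \<partial>M i)"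
  proof (rule nn_integral_less)
    show "AE y in M i. ennreal c \<le> g y" using gt by eventually_elim simp
    show "\<not> (AE y in M i. g y \<le> ennreal c)"
    proof
      assume "AE y in M i. g y \<le> ennreal c"
      with gt have "AE y in M i. False" by eventually_elim simp
      then show False by simp
    qed
  qed (auto simp: N.emeasure_space_1)
  moreover have "(\<integral>\<^sup>+ y. g y \<partial>M i) \<le> ennreal c"
    using le product_nn_integral_insert_rev[OF I f] by (simp add: g_def)
  ultimately show False by (simp add: N.emeasure_space_1)
qed

text \<open>With masses \<alpha> and \<alpha>' of the colour, the double integral is \<alpha> +
  \<alpha>' - 2\<alpha>\<alpha>'. As the product is at most the square of the average s, this is at
  least 2s - 2s^2.\<close>

lemma discordance_le:
  assumes h: "\<And>k. Measurable.pred (M k) h"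
    and disc: "AE x in M i. AE y in M j. b x y = (h x \<noteq> h y)"
    and le: "(\<integral>\<^sup>+ x. (\<integral>\<^sup>+ y. of_bool (b x y) \<partial>M j) \<partial>M i) \<le> ennreal \<beta>" and \<beta>: "0 \<le> \<beta>"
  defines "s \<equiv> (measure (M i) {x \<in> space (M i). h x} + measure (M j) {x \<in> space (M j). h x}) / 2"
  shows "2 * s * (1 - s) \<le> \<beta>"
proof -
  define \<alpha> \<alpha>' where "\<alpha> = measure (M i) {x \<in> space (M i). h x}" and "\<alpha>' = measure (M j) {x \<in> space (M j). h x}"
  have le1: "\<alpha> \<le> 1" "\<alpha>' \<le> 1" "0 \<le> \<alpha>" "0 \<le> \<alpha>'" unfolding \<alpha>_def \<alpha>'_def by auto
  note h[measurable]
  have inner: "(\<integral>\<^sup>+ y. of_bool (c \<noteq> h y) \<partial>M j) = ennreal (if c then 1 - \<alpha>' else \<alpha>')" for c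
  proof -
    have "(\<integral>\<^sup>+ y. of_bool (c \<noteq> h y) \<partial>M j) = (\<integral>\<^sup>+ y. indicator {y \<in> space (M j). c \<noteq> h y} y \<partial>M j)"
      by (intro nn_integral_cong) (simp add: indicator_def)
    also have "\<dots> = emeasure (M j) {y \<in> space (M j). c \<noteq> h y}" by (intro nn_integral_indicator) simp
    also have "\<dots> = ennreal (if c then 1 - \<alpha>' else \<alpha>')"
      using N.prob_neg[of j h] by (simp add: N.emeasure_eq_measure \<alpha>'_def)
    finally show ?thesis .
  qed
  have "AE x in M i. (\<integral>\<^sup>+ y. of_bool (b x y) \<partial>M j) = ennreal (if h x then 1 - \<alpha>' else \<alpha>')"
    using disc
  proof eventually_elim
    case (elim x)
    then have "AE y in M j. (of_bool (b x y) :: ennreal) = of_bool (h x \<noteq> h y)"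
      by eventually_elim simp
    then have "(\<integral>\<^sup>+ y. of_bool (b x y) \<partial>M j) = (\<integral>\<^sup>+ y. of_bool (h x \<noteq> h y) \<partial>M j)"
      by (rule nn_integral_cong_AE)
    then show ?case using inner by simp
  qed
  then have "(\<integral>\<^sup>+ x. (\<integral>\<^sup>+ y. of_bool (b x y) \<partial>M j) \<partial>M i) = (\<integral>\<^sup>+ x. ennreal (if h x then 1 - \<alpha>' else \<alpha>') \<partial>M i)"
    by (rule nn_integral_cong_AE)
  also have "\<dots> = (\<integral>\<^sup>+ x. ennreal (1 - \<alpha>') * indicator {x \<in> space (M i). h x} x +
      ennreal \<alpha>' * indicator {x \<in> space (M i). \<not> h x} x \<partial>M i)"
    by (intro nn_integral_cong) (auto simp: indicator_def)
  also have "\<dots> = ennreal (1 - \<alpha>') * ennreal \<alpha> + ennreal \<alpha>' * ennreal (1 - \<alpha>)"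
    using N.prob_neg[of i h] by (simp add: nn_integral_add nn_integral_cmult N.emeasure_eq_measure \<alpha>_def)
  also have "\<dots> = ennreal ((1 - \<alpha>') * \<alpha> + \<alpha>' * (1 - \<alpha>))"
    using le1 by (simp add: ennreal_mult ennreal_plus)
  finally have "(1 - \<alpha>') * \<alpha> + \<alpha>' * (1 - \<alpha>) \<le> \<beta>" using le \<beta> by (simp add: ennreal_le_iff)
  moreover have "4 * (\<alpha> * \<alpha>') \<le> (\<alpha> + \<alpha>')\<^sup>2"
    using sum_squares_bound[of \<alpha> \<alpha>'] by (simp add: power2_sum ac_simps)
  ultimately show ?thesis
    unfolding s_def \<alpha>_def[symmetric] \<alpha>'_def[symmetric]
    by (simp add: field_simps power2_eq_square)
qed

end

section \<open>The contradiction for a fine triangulation\<close>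

text \<open>These hypotheses are contradictory, see the last lemma of the locale.\<close>
locale counterexample = ac_family M for M :: "nat \<Rightarrow> 'a::euclidean_space measure" +
  fixes r \<delta> \<epsilon> s :: real and K :: "'a set" and \<phi> :: "nat \<Rightarrow> 'a" and T :: "nat set set"
  assumes supp: "AE x in M i. x \<in> ball 0 r" and r: "0 < r"
    and tri: "triangulation r K \<phi> T"
    and \<delta>: "0 \<le> \<delta>" and \<epsilon>: "0 \<le> \<epsilon>"
    and hit_vertex: "v \<in> \<Union>T \<Longrightarrow> (\<integral>\<^sup>+ x. of_nat (hit \<phi> {v} (x ` {..DIM('a)})) \<partial>PiM {..DIM('a)} M) \<le> ennreal \<delta>"
    and hit_face: "\<lbrakk>\<tau> \<subseteq> \<sigma>; \<sigma> \<in> T; card \<tau> = Suc k; 1 \<le> k; k \<le> DIM('a)\<rbrakk> \<Longrightarrow>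
      (\<integral>\<^sup>+ x. of_nat (hit \<phi> \<tau> (x ` {k..DIM('a)})) \<partial>PiM {k..DIM('a)} M) \<le> ennreal \<epsilon>"
    and hit_cell: "\<lbrakk>\<sigma> \<in> T; i \<in> {DIM('a) - 1, DIM('a)}\<rbrakk> \<Longrightarrow> measure (M i) {x \<in> space (M i). odd (hit \<phi> \<sigma> {x})} \<le> \<epsilon>"
    and s: "\<And>t. \<lbrakk>t \<le> 1 / 2; 2 * t * (1 - t) \<le> fact DIM('a) * (\<delta> + real (DIM('a) - 1) * \<epsilon>)\<rbrakk> \<Longrightarrow> t \<le> s"
    and small: "\<epsilon> + real (Suc DIM('a)) * s < 1"
begin

abbreviation V :: "nat set" where "V \<equiv> \<Union>T"
abbreviation F :: "nat set set" where "F \<equiv> {\<tau>. \<tau> \<noteq> {} \<and> (\<exists>\<sigma>\<in>T. \<tau> \<subseteq> \<sigma>)}"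

text \<open>The mean (k+1)! \<delta> plus an error, in the simplest form satisfying the recursion
  \<open>bound_Suc\<close>: a face of dimension k+1 contributes \<epsilon> itself and has k+2
  facets.\<close>

definition bound :: "nat \<Rightarrow> real" where
  "bound k = fact (Suc k) * (\<delta> + real k * \<epsilon>)"

text \<open>Apices of k-faces with k < d-1 keep the conditional expectation of the intersection count below its mean.
  For (d-1)-faces both M (d-1) and M d have to be controlled at once, and on d-faces the apex lies off the cycle.\<close>
definition good :: "(nat set \<Rightarrow> 'a) \<Rightarrow> nat set \<Rightarrow> 'a \<Rightarrow> bool" where
  "good a \<tau> y \<longleftrightarrow> y \<in> ball 0 r \<and>
    (if card \<tau> < DIM('a) then
      (\<integral>\<^sup>+ x. of_nat (iter \<phi> a (card \<tau> - 1) \<tau> (insert y (x ` {card \<tau>..DIM('a)}))) \<partial>PiM {card \<tau>..DIM('a)} M)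
        \<le> ennreal (bound (card \<tau> - 1))
     else if card \<tau> = DIM('a) then
      (\<Sum>i\<in>{DIM('a) - 1, DIM('a)}. measure (M i) {x \<in> space (M i). odd (iter \<phi> a (DIM('a) - 1) \<tau> {y, x})}) \<le> 2 * s
     else even (iter \<phi> a DIM('a) \<tau> {y}))"

lemma T: "finite T" "\<sigma> \<in> T \<Longrightarrow> card \<sigma> = Suc DIM('a)" "\<sigma> \<in> T \<Longrightarrow> finite \<sigma>"
  using tri by (auto simp: triangulation_def intro: card_ge_0_finite)

lemma finite_V: "finite V" and finite_F: "finite F"
proof -
  show "finite V" using T by blast
  have "F \<subseteq> (\<Union>\<sigma>\<in>T. Pow \<sigma>)" by auto
  then show "finite F" using T by (auto intro: finite_subset)
qed

lemma F: assumes "\<tau> \<in> F" shows "finite \<tau>" "0 < card \<tau>" "card \<tau> \<le> Suc DIM('a)" "\<tau> \<subseteq> V"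
proof -
  obtain \<sigma> where \<sigma>: "\<sigma> \<in> T" "\<tau> \<subseteq> \<sigma>" "\<tau> \<noteq> {}" using assms by blast
  then show "finite \<tau>" "\<tau> \<subseteq> V" using T finite_subset by blast+
  then show "0 < card \<tau>" "card \<tau> \<le> Suc DIM('a)"
    using \<sigma> T(2,3)[OF \<sigma>(1)] card_mono[of \<sigma> \<tau>] by (auto simp: card_gt_0_iff)
qed

lemma faces_F:
  assumes "\<tau> \<in> F" "\<rho> \<in> faces \<tau>"
  shows "\<rho> \<in> F" "card \<rho> < card \<tau>"
proof -
  have \<rho>: "\<rho> \<subset> \<tau>" "\<rho> \<noteq> {}" using assms(2) by (simp_all add: faces_def)
  obtain \<sigma> where "\<sigma> \<in> T" "\<tau> \<subseteq> \<sigma>" using assms(1) by blast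
  then show "\<rho> \<in> F" using \<rho> by blast
  show "card \<rho> < card \<tau>" using F(1)[OF assms(1)] \<rho>(1) by (rule psubset_card_mono)
qed

lemma F_top:
  assumes "\<tau> \<in> F" "card \<tau> = Suc DIM('a)"
  shows "\<tau> \<in> T"
proof -
  obtain \<sigma> where \<sigma>: "\<sigma> \<in> T" "\<tau> \<subseteq> \<sigma>" using assms(1) by blast
  then have "\<tau> = \<sigma>" using T(2,3)[OF \<sigma>(1)] assms(2) by (intro card_subset_eq) auto
  then show ?thesis using \<sigma>(1) by simp
qed

lemma exists_generic:
  assumes "Z \<in> null_sets lborel" "\<not> (AE y in M i. \<not> R y)"
  shows "\<exists>y. y \<notin> Z \<and> y \<in> ball 0 r \<and> R y"
proof (rule ccontr)
  assume neg: "\<not> ?thesis"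
  have "AE y in M i. \<not> R y"
    using AE_notin[OF assms(1)] supp by eventually_elim (use neg in blast)
  then show False using assms(2) by simp
qed

lemma good_cong:
  assumes "\<tau> \<in> F" "\<And>\<rho>. \<lbrakk>\<rho> \<in> F; card \<rho> < card \<tau>\<rbrakk> \<Longrightarrow> a \<rho> = a' \<rho>"
  shows "good a \<tau> y = good a' \<tau> y"
proof -
  have "iter \<phi> a k \<tau> Y = iter \<phi> a' k \<tau> Y" if "card \<tau> = Suc k" for k Y
    using that assms(2) faces_F[OF assms(1)] by (intro iter_cong) auto
  from this[of "card \<tau> - 1"] show ?thesis
    using F(2,3)[OF assms(1)] unfolding good_def by (auto simp: le_Suc_eq)
qed

lemma bound_nonneg: "0 \<le> bound k"
  using \<delta> \<epsilon> by (simp add: bound_def)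

lemma bound_Suc: "\<epsilon> + real (Suc (Suc k)) * bound k \<le> bound (Suc k)"
proof -
  have "1 * \<epsilon> \<le> fact (Suc (Suc k)) * \<epsilon>" using \<epsilon> by (intro mult_right_mono fact_ge_1)
  then show ?thesis unfolding bound_def fact_Suc[of "Suc k"] by (simp add: algebra_simps)
qed

text \<open>A facet has cardinality k, so the goodness of its apex is an estimate over the same
  variables v_k, ..., v_d, and these add up over the facets. At k = 0 the bound is the covering
  probability of a vertex.\<close>

lemma nn_integral_iter_le:
  assumes \<tau>: "\<tau> \<in> F" "card \<tau> = Suc k" "k < DIM('a)"
    and good: "\<And>\<rho>. \<lbrakk>\<rho> \<in> F; card \<rho> < card \<tau>\<rbrakk> \<Longrightarrow> good a \<rho> (a \<rho>)"
  shows "(\<integral>\<^sup>+ x. of_nat (iter \<phi> a k \<tau> (x ` {k..DIM('a)})) \<partial>PiM {k..DIM('a)} M) \<le> ennreal (bound k)"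
proof (cases k)
  case 0
  then obtain v where v: "\<tau> = {v}" using \<tau>(2) by (auto simp: card_Suc_eq)
  then have "v \<in> V" using F(4)[OF \<tau>(1)] by blast
  then show ?thesis using hit_vertex[of v] 0 v by (simp add: bound_def atLeast0AtMost)
next
  case (Suc j)
  obtain \<sigma> where \<sigma>: "\<sigma> \<in> T" "\<tau> \<subseteq> \<sigma>" using \<tau>(1) by blast
  have "(\<integral>\<^sup>+ x. of_nat (iter \<phi> a (Suc j) \<tau> (x ` {k..DIM('a)})) \<partial>PiM {k..DIM('a)} M)
      \<le> ennreal (\<epsilon> + card \<tau> * bound j)"
  proof (rule nn_integral_iter_Suc_le)
    show "(\<integral>\<^sup>+ x. of_nat (hit \<phi> \<tau> (x ` {k..DIM('a)})) \<partial>PiM {k..DIM('a)} M) \<le> ennreal \<epsilon>"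
      using \<tau>(2,3) Suc by (intro hit_face[OF \<sigma>(2,1)]) simp_all
    fix v assume v: "v \<in> \<tau>"
    have fr: "\<tau> - {v} \<in> faces \<tau>" using v \<tau>(2) Suc by (intro facet_in_faces) auto
    have "good a (\<tau> - {v}) (a (\<tau> - {v}))" by (rule good[OF faces_F[OF \<tau>(1) fr]])
    moreover have "card (\<tau> - {v}) = k" using v \<tau>(2) F(1)[OF \<tau>(1)] by simp
    ultimately show "(\<integral>\<^sup>+ x. of_nat (iter \<phi> a j (\<tau> - {v}) (insert (a (\<tau> - {v})) (x ` {k..DIM('a)}))) \<partial>PiM {k..DIM('a)} M)
        \<le> ennreal (bound j)"
      using \<tau>(3) Suc by (simp add: good_def)
  qed (use F(1)[OF \<tau>(1)] \<epsilon> bound_nonneg in auto)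
  also have "\<dots> \<le> ennreal (bound k)"
    using bound_Suc[of j] \<tau>(2) Suc by (intro ennreal_leI) simp
  finally show ?thesis by (simp add: Suc)
qed

text \<open>With k = \<open>card \<tau> - 1\<close>, the variable v_k is frozen at a value
  \<open>y\<close> that does not raise the mean; this value becomes the apex, and v_{k+1}, ..., v_d
  stay random.\<close>

lemma exists_good_small:
  assumes \<tau>: "\<tau> \<in> F" "card \<tau> < DIM('a)" and Z: "Z \<in> null_sets lborel"
    and good: "\<And>\<rho>. \<lbrakk>\<rho> \<in> F; card \<rho> < card \<tau>\<rbrakk> \<Longrightarrow> good a \<rho> (a \<rho>)"
  shows "\<exists>y. y \<notin> Z \<and> good a \<tau> y"
proof -
  obtain k where k: "card \<tau> = Suc k" using F(2)[OF \<tau>(1)] by (cases "card \<tau>") auto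
  define f where "f x = (of_nat (iter \<phi> a k \<tau> (x ` {k..DIM('a)})) :: ennreal)" for x
  have ins: "{k..DIM('a)} = insert k {Suc k..DIM('a)}" using \<tau>(2) k by auto
  have fm: "f \<in> borel_measurable (PiM (insert k {Suc k..DIM('a)}) M)"
    unfolding f_def ins using F(1)[OF \<tau>(1)] by (intro iter_ennreal_measurable) auto
  have "(\<integral>\<^sup>+ x. f x \<partial>PiM (insert k {Suc k..DIM('a)}) M) \<le> ennreal (bound k)"
    using nn_integral_iter_le[OF \<tau>(1) k _ good] \<tau>(2) k unfolding f_def ins[symmetric] by simp
  then obtain y where y: "y \<notin> Z" "y \<in> ball 0 r" "(\<integral>\<^sup>+ x. f (x(k := y)) \<partial>PiM {Suc k..DIM('a)} M) \<le> ennreal (bound k)"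
    using exists_slice_le[OF _ _ fm _ Z supp] by auto
  have "f (x(k := y)) = of_nat (iter \<phi> a k \<tau> (insert y (x ` {Suc k..DIM('a)})))" for x
  proof -
    have "x(k := y) ` {k..DIM('a)} = insert y (x ` {Suc k..DIM('a)})" unfolding ins by auto
    then show ?thesis by (simp add: f_def)
  qed
  then show ?thesis using y k \<tau>(2) by (intro exI[of _ y]) (simp add: good_def)
qed

lemma odd_iter_measurable:
  assumes "finite P" "finite A"
  shows "Measurable.pred (M i) (\<lambda>y. odd (iter \<phi> a k P (insert y A)))"
proof -
  have "Measurable.pred borel (odd :: nat \<Rightarrow> bool)"
    by (simp add: pred_def borel_open discrete_topology_class.open_discrete)
  with iter_insert_measurable[OF assms sets] show ?thesis by (rule measurable_compose)
qed

text \<open>By the cocycle property the odd pairs of points are those separated by the two-colouring h, which is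
  odd(w, -) for one generic point w; the two choices of the new point select h or its complement.\<close>
lemma exists_good_facet:
  assumes \<tau>: "\<tau> \<in> F" "card \<tau> = DIM('a)" and Z: "Z \<in> null_sets lborel"
    and good: "\<And>\<rho>. \<lbrakk>\<rho> \<in> F; card \<rho> < card \<tau>\<rbrakk> \<Longrightarrow> good a \<rho> (a \<rho>)"
    and inj: "inj_on a {\<rho>\<in>F. card \<rho> < card \<tau>}" and gp: "gp \<phi> V (a ` {\<rho>\<in>F. card \<rho> < card \<tau>})"
  shows "\<exists>y. y \<notin> Z \<and> good a \<tau> y"
proof -
  define d where "d = DIM('a)"
  define A where "A = a ` {\<rho>\<in>F. card \<rho> < card \<tau>}"
  have finA: "finite A" unfolding A_def using finite_F by (intro finite_imageI) (rule finite_subset[OF _ finite_F], auto)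
  have faces_sub: "faces \<tau> \<subseteq> {\<rho>\<in>F. card \<rho> < card \<tau>}" using faces_F[OF \<tau>(1)] by blast
  have A: "a ` faces \<tau> \<subseteq> A" "inj_on a (faces \<tau>)"
    using faces_sub inj by (auto simp: A_def intro: inj_on_subset)
  define b where "b x y = odd (iter \<phi> a (d - 1) \<tau> {x, y})" for x y
  have cocycle: "b x y = (b w x \<noteq> b w y)"
    if "w \<notin> flats (\<phi> ` V \<union> A)" "x \<notin> flats (\<phi> ` V \<union> insert w A)" "y \<notin> flats (\<phi> ` V \<union> insert x (insert w A))" for w x y
    unfolding b_def d_def using that finite_V F(4)[OF \<tau>(1)] \<tau>(2) finA gp A
    by (intro iter_cocycle_triple) (auto simp: A_def)
  have null: "flats (\<phi> ` V \<union> B) \<in> null_sets lborel" if "finite B" for B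
    using that finite_V by (intro flats_null_sets) auto
  \<comment> \<open>The base point of the colouring also avoids \<open>Z\<close> and lies in the
    ball, since it may itself become the apex.\<close>
  obtain w where w: "w \<notin> Z \<union> flats (\<phi> ` V \<union> A)" "w \<in> ball 0 r"
    using exists_generic[of "Z \<union> flats (\<phi> ` V \<union> A)" "\<lambda>_. True" 0] Z null[OF finA] by auto
  define h where "h = b w"
  have bm: "Measurable.pred (M k) (b x)" for k x
  proof -
    have "Measurable.pred (M k) (\<lambda>y. odd (iter \<phi> a (d - 1) \<tau> (insert y {x})))"
      using F(1)[OF \<tau>(1)] by (intro odd_iter_measurable) auto
    then show ?thesis by (simp add: b_def[abs_def] insert_commute)
  qed
  have AE_flats: "AE x in M i. x \<notin> flats (\<phi> ` V \<union> B)" if "finite B" for B i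
    using null[OF that] by (rule AE_notin)
  have disc: "AE x in M i. AE y in M j. b x y = (h x \<noteq> h y)" for i j
  proof -
    have "AE x in M i. x \<notin> flats (\<phi> ` V \<union> insert w A)" using finA by (intro AE_flats) simp
    then show ?thesis
    proof eventually_elim
      case (elim x)
      have "AE y in M j. y \<notin> flats (\<phi> ` V \<union> insert x (insert w A))" using finA by (intro AE_flats) simp
      then show ?case
      proof eventually_elim
        case (elim y)
        then show ?case using cocycle[of w x y] w \<open>x \<notin> _\<close> by (simp add: h_def)
      qed
    qed
  qed
  define t where "t = (measure (M (d - 1)) {x \<in> space (M (d - 1)). h x} + measure (M d) {x \<in> space (M d). h x}) / 2"
  have d0: "d > 0" "d - 1 \<noteq> d" unfolding d_def using DIM_positive[where 'a = 'a] by linarith+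
  have "2 * t * (1 - t) \<le> bound (d - 1)"
    unfolding t_def
  proof (rule discordance_le[OF _ disc])
    show "Measurable.pred (M k) h" for k unfolding h_def by (rule bm)
    show "0 \<le> bound (d - 1)" by (rule bound_nonneg)
    define f where "f x = (of_nat (iter \<phi> a (d - 1) \<tau> (x ` {d - 1..d})) :: ennreal)" for x
    have ins: "{d - 1..d} = insert (d - 1) {d}" using d0 by auto
    have fm: "f \<in> borel_measurable (PiM (insert (d - 1) {d}) M)"
      unfolding f_def ins using F(1)[OF \<tau>(1)] by (intro iter_ennreal_measurable) auto
    have "(\<integral>\<^sup>+ x. \<integral>\<^sup>+ y. of_bool (b x y) \<partial>M d \<partial>M (d - 1)) \<le> (\<integral>\<^sup>+ y. \<integral>\<^sup>+ x. f (x(d - 1 := y)) \<partial>PiM {d} M \<partial>M (d - 1))"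
    proof (rule nn_integral_mono)
      fix y
      define g where "g x = (of_nat (iter \<phi> a (d - 1) \<tau> {y, x}) :: ennreal)" for x
      have "f (x(d - 1 := y)) = g (x d)" for x
        using d0 unfolding f_def g_def ins by (simp add: insert_commute)
      moreover have "g \<in> borel_measurable (M d)"
        using iter_insert_measurable[OF F(1)[OF \<tau>(1)], of "{y}" "M d" \<phi> a "d - 1"] sets unfolding g_def
        by (intro measurable_compose[OF _ of_nat_ennreal_measurable]) (simp add: insert_commute)
      ultimately have "(\<integral>\<^sup>+ x. f (x(d - 1 := y)) \<partial>PiM {d} M) = (\<integral>\<^sup>+ x. g x \<partial>M d)"
        by (simp add: product_nn_integral_singleton)
      \<comment> \<open>An odd count is at least 1, so the mean count bounds the probability of
        oddness.\<close>
      moreover have "of_bool (b y x) \<le> g x" for x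
        unfolding b_def g_def by (cases "iter \<phi> a (d - 1) \<tau> {y, x}") auto
      ultimately show "(\<integral>\<^sup>+ x. of_bool (b y x) \<partial>M d) \<le> (\<integral>\<^sup>+ x. f (x(d - 1 := y)) \<partial>PiM {d} M)"
        by (simp add: nn_integral_mono)
    qed
    also have "\<dots> = (\<integral>\<^sup>+ x. f x \<partial>PiM (insert (d - 1) {d}) M)"
      using d0 by (intro product_nn_integral_insert_rev[symmetric] fm) auto
    also have "\<dots> \<le> ennreal (bound (d - 1))"
    proof -
      have "card \<tau> = Suc (d - 1)" "d - 1 < DIM('a)" using \<tau>(2) d0 by (simp_all add: d_def)
      then have "(\<integral>\<^sup>+ x. f x \<partial>PiM {d - 1..d} M) \<le> ennreal (bound (d - 1))"
        using nn_integral_iter_le[OF \<tau>(1) _ _ good, of "d - 1"] unfolding f_def by (simp add: d_def)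
      then show ?thesis unfolding ins .
    qed
    finally show "(\<integral>\<^sup>+ x. \<integral>\<^sup>+ y. of_bool (b x y) \<partial>M d \<partial>M (d - 1)) \<le> ennreal (bound (d - 1))" .
  qed
  moreover have "bound (d - 1) = fact DIM('a) * (\<delta> + real (DIM('a) - 1) * \<epsilon>)"
    using d0 by (simp add: bound_def d_def)
  ultimately have ts: "2 * t * (1 - t) \<le> fact DIM('a) * (\<delta> + real (DIM('a) - 1) * \<epsilon>)" by simp
  have sum2: "(\<Sum>i\<in>{d - 1, d}. f i) = f (d - 1) + f d" for f :: "nat \<Rightarrow> real" using d0 by simp
  have goodI: "good a \<tau> y" if "y \<in> ball 0 r" "(\<Sum>i\<in>{d - 1, d}. measure (M i) {x \<in> space (M i). b y x}) \<le> 2 * s" for y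
    using that \<tau>(2) by (simp add: good_def b_def d_def)
  show ?thesis
  proof (cases "t \<le> 1 / 2")
    case True
    then have "t \<le> s" using ts by (rule s)
    moreover have "(\<Sum>i\<in>{d - 1, d}. measure (M i) {x \<in> space (M i). b w x}) = 2 * t"
      unfolding sum2 t_def h_def by simp
    ultimately have "good a \<tau> w" using w by (intro goodI) simp_all
    then show ?thesis using w by blast
  next
    case False
    then have "1 - t \<le> s" using ts by (intro s) (simp_all add: mult_ac)
    \<comment> \<open>As t > 1/2, the colour \<open>h\<close> has positive mass under some measure,
      so a generic apex of that colour exists. Seen from it, the odd points are those of the
      opposite colour, with average mass 1 - t.\<close>
    have "\<exists>i. \<not> (AE y in M i. \<not> h y)"
    proof (rule ccontr)
      assume "\<not> ?thesis"
      then have "AE y in M i. \<not> h y" for i by blast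
      moreover have [measurable]: "Measurable.pred (M i) h" for i unfolding h_def by (rule bm)
      ultimately have "measure (M i) {x \<in> space (M i). h x} = 0" for i
        by (subst N.prob_eq_0) auto
      then show False using False by (simp add: t_def)
    qed
    then obtain y where y: "y \<notin> Z \<union> flats (\<phi> ` V \<union> insert w A)" "y \<in> ball 0 r" "h y"
      using exists_generic[of "Z \<union> flats (\<phi> ` V \<union> insert w A)"] Z null[of "insert w A"] finA by blast
    have meq: "measure (M i) {x \<in> space (M i). b y x} = 1 - measure (M i) {x \<in> space (M i). h x}" for i
    proof -
      have [measurable]: "Measurable.pred (M i) h" unfolding h_def by (rule bm)
      note bm[measurable]
      have "AE x in M i. x \<notin> flats (\<phi> ` V \<union> insert y (insert w A))" using finA by (intro AE_flats) simp
      then have "AE x in M i. b y x = (\<not> h x)"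
      proof eventually_elim
        case (elim x)
        then show ?case using cocycle[of w y x] w y by (simp add: h_def)
      qed
      then have "measure (M i) {x \<in> space (M i). b y x} = measure (M i) {x \<in> space (M i). \<not> h x}"
        by (intro N.finite_measure_eq_AE) (auto elim: eventually_mono)
      then show ?thesis using N.prob_neg[of i h] by simp
    qed
    have "X + X' = 2 * (1 - (Y + Y') / 2)" if "X = 1 - Y" "X' = 1 - Y'" for X X' Y Y' :: real
      using that by (simp add: field_simps)
    then have "(\<Sum>i\<in>{d - 1, d}. measure (M i) {x \<in> space (M i). b y x}) = 2 * (1 - t)"
      unfolding sum2 t_def using meq by blast
    also have "\<dots> \<le> 2 * s" using \<open>1 - t \<le> s\<close> by simp
    finally have "good a \<tau> y" using y(2) by (intro goodI)
    then show ?thesis using y by blast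
  qed
qed

text \<open>A point with odd count is hit by the cell itself or lies in the odd set of one of its
  d+1 facets. Summed over the two measures, these masses total at most 2(\<epsilon> + (d+1)s) < 2,
  so under one of the measures the even points have positive mass.\<close>

lemma exists_good_cell:
  assumes \<tau>: "\<tau> \<in> F" "card \<tau> = Suc DIM('a)" and Z: "Z \<in> null_sets lborel"
    and good: "\<And>\<rho>. \<lbrakk>\<rho> \<in> F; card \<rho> < card \<tau>\<rbrakk> \<Longrightarrow> good a \<rho> (a \<rho>)"
  shows "\<exists>y. y \<notin> Z \<and> good a \<tau> y"
proof -
  define d where "d = DIM('a)"
  have d0: "d = Suc (d - 1)" "d - 1 \<noteq> d" unfolding d_def using DIM_positive[where 'a = 'a] by linarith+
  have \<tau>T: "\<tau> \<in> T" using \<tau> by (rule F_top)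
  have fin: "finite \<tau>" by (rule F(1)[OF \<tau>(1)])
  define B where "B v i = {x \<in> space (M i). odd (iter \<phi> a (d - 1) (\<tau> - {v}) {a (\<tau> - {v}), x})}" for v i
  define H where "H i = {x \<in> space (M i). odd (hit \<phi> \<tau> {x})}" for i
  define G where "G i = {x \<in> space (M i). odd (iter \<phi> a d \<tau> {x})}" for i
  have meas: "B v i \<in> sets (M i)" "H i \<in> sets (M i)" "G i \<in> sets (M i)" for v i
  proof -
    have "Measurable.pred (M i) (\<lambda>y. odd (iter \<phi> a (d - 1) (\<tau> - {v}) (insert y {a (\<tau> - {v})})))"
      "Measurable.pred (M i) (\<lambda>y. odd (iter \<phi> a 0 \<tau> (insert y {})))"
      "Measurable.pred (M i) (\<lambda>y. odd (iter \<phi> a d \<tau> (insert y {})))"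
      using fin by (intro odd_iter_measurable; simp)+
    then show "B v i \<in> sets (M i)" "H i \<in> sets (M i)" "G i \<in> sets (M i)"
      by (simp_all add: B_def H_def G_def pred_def insert_commute)
  qed
  have le: "measure (M i) (G i) \<le> measure (M i) (H i) + (\<Sum>v\<in>\<tau>. measure (M i) (B v i))" for i
  proof -
    have "odd (hit \<phi> \<tau> {x}) \<or> (\<exists>v\<in>\<tau>. odd (iter \<phi> a (d - 1) (\<tau> - {v}) {a (\<tau> - {v}), x}))"
      if odd: "odd (iter \<phi> a d \<tau> {x})" for x
    proof (rule ccontr)
      assume neg: "\<not> ?thesis"
      have "iter \<phi> a d \<tau> {x} = hit \<phi> \<tau> {x} + (\<Sum>v\<in>\<tau>. iter \<phi> a (d - 1) (\<tau> - {v}) {a (\<tau> - {v}), x})"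
        by (subst d0(1)) simp
      moreover have "even (\<Sum>v\<in>\<tau>. iter \<phi> a (d - 1) (\<tau> - {v}) {a (\<tau> - {v}), x})"
        using neg by (intro dvd_sum) blast
      ultimately show False using neg odd by simp
    qed
    then have "G i \<subseteq> H i \<union> (\<Union>v\<in>\<tau>. B v i)" unfolding G_def H_def B_def by blast
    then have "measure (M i) (G i) \<le> measure (M i) (H i \<union> (\<Union>v\<in>\<tau>. B v i))"
      using meas fin by (intro N.finite_measure_mono) auto
    also have "\<dots> \<le> measure (M i) (H i) + measure (M i) (\<Union>v\<in>\<tau>. B v i)"
      using meas fin by (intro measure_Un_le) auto
    also have "measure (M i) (\<Union>v\<in>\<tau>. B v i) \<le> (\<Sum>v\<in>\<tau>. measure (M i) (B v i))"
      using meas fin by (intro measure_UNION_le) auto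
    finally show ?thesis by simp
  qed
  have Bs: "measure (M (d - 1)) (B v (d - 1)) + measure (M d) (B v d) \<le> 2 * s" if v: "v \<in> \<tau>" for v
  proof -
    have fr: "\<tau> - {v} \<in> faces \<tau>" using v \<tau>(2) d0 unfolding d_def by (intro facet_in_faces[where k = "DIM('a) - 1"]) auto
    have "good a (\<tau> - {v}) (a (\<tau> - {v}))" by (rule good[OF faces_F[OF \<tau>(1) fr]])
    moreover have "card (\<tau> - {v}) = DIM('a)" using v \<tau>(2) fin by simp
    ultimately show ?thesis using d0 by (simp add: good_def B_def d_def)
  qed
  have "measure (M (d - 1)) (G (d - 1)) + measure (M d) (G d) \<le>
      (\<epsilon> + (\<Sum>v\<in>\<tau>. measure (M (d - 1)) (B v (d - 1)))) + (\<epsilon> + (\<Sum>v\<in>\<tau>. measure (M d) (B v d)))"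
    using le[of "d - 1"] le[of d] hit_cell[OF \<tau>T, of "d - 1"] hit_cell[OF \<tau>T, of d] unfolding H_def d_def by simp
  also have "\<dots> = 2 * \<epsilon> + (\<Sum>v\<in>\<tau>. measure (M (d - 1)) (B v (d - 1)) + measure (M d) (B v d))"
    by (simp add: sum.distrib)
  also have "\<dots> \<le> 2 * \<epsilon> + (\<Sum>v\<in>\<tau>. 2 * s)" using Bs by (intro add_left_mono sum_mono)
  also have "\<dots> = 2 * (\<epsilon> + real (Suc DIM('a)) * s)" using \<tau>(2) by (simp add: algebra_simps)
  also have "\<dots> < 2" using small by simp
  finally have "measure (M (d - 1)) (G (d - 1)) < 1 \<or> measure (M d) (G d) < 1" by linarith
  then obtain i where i: "measure (M i) (G i) < 1" by blast
  have "\<not> (AE y in M i. \<not> even (iter \<phi> a d \<tau> {y}))"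
  proof
    assume "AE y in M i. \<not> even (iter \<phi> a d \<tau> {y})"
    then have "measure (M i) (G i) = 1" using meas(3)[of i] unfolding G_def by (subst N.prob_Collect_eq_1) auto
    then show False using i by simp
  qed
  then obtain y where "y \<notin> Z" "y \<in> ball 0 r" "even (iter \<phi> a d \<tau> {y})"
    using exists_generic[OF Z, of "\<lambda>y. even (iter \<phi> a d \<tau> {y})" i] by blast
  then show ?thesis using \<tau>(2) by (intro exI[of _ y]) (simp add: good_def d_def)
qed

text \<open>Reindexing by facets; after summation over the cells each facet is weighted by the
  number of cells containing it.\<close>

lemma sum_facets:
  fixes G :: "nat set \<Rightarrow> nat"
  assumes \<sigma>: "\<sigma> \<in> T"
  shows "(\<Sum>v\<in>\<sigma>. G (\<sigma> - {v})) = (\<Sum>\<tau> | \<tau> \<in> F \<and> card \<tau> = DIM('a). of_bool (\<tau> \<subseteq> \<sigma>) * G \<tau>)"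
proof -
  let ?Fd = "{\<tau>. \<tau> \<in> F \<and> card \<tau> = DIM('a)}"
  have fin: "finite ?Fd" using finite_F by (rule finite_subset[rotated]) auto
  have eq: "{\<tau>\<in>?Fd. \<tau> \<subseteq> \<sigma>} = (\<lambda>v. \<sigma> - {v}) ` \<sigma>"
  proof
    show "(\<lambda>v. \<sigma> - {v}) ` \<sigma> \<subseteq> {\<tau>\<in>?Fd. \<tau> \<subseteq> \<sigma>}"
    proof
      fix \<tau> assume "\<tau> \<in> (\<lambda>v. \<sigma> - {v}) ` \<sigma>"
      then obtain v where v: "v \<in> \<sigma>" "\<tau> = \<sigma> - {v}" by blast
      then have "card \<tau> = DIM('a)" using T(2,3)[OF \<sigma>] by simp
      then have "\<tau> \<noteq> {}" by (metis DIM_positive card.empty less_irrefl)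
      then show "\<tau> \<in> {\<tau>\<in>?Fd. \<tau> \<subseteq> \<sigma>}" using v \<sigma> \<open>card \<tau> = DIM('a)\<close> by blast
    qed
    show "{\<tau>\<in>?Fd. \<tau> \<subseteq> \<sigma>} \<subseteq> (\<lambda>v. \<sigma> - {v}) ` \<sigma>"
    proof
      fix \<tau> assume \<tau>: "\<tau> \<in> {\<tau>\<in>?Fd. \<tau> \<subseteq> \<sigma>}"
      then have "card (\<sigma> - \<tau>) = 1" using T(2,3)[OF \<sigma>] by (subst card_Diff_subset) (auto dest: finite_subset)
      then obtain v where "\<sigma> - \<tau> = {v}" by (auto simp: card_1_singleton_iff)
      then have "v \<in> \<sigma>" "\<tau> = \<sigma> - {v}" using \<tau> by auto
      then show "\<tau> \<in> (\<lambda>v. \<sigma> - {v}) ` \<sigma>" by blast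
    qed
  qed
  have "(\<Sum>\<tau>\<in>?Fd. of_bool (\<tau> \<subseteq> \<sigma>) * G \<tau>) = (\<Sum>\<tau>\<in>{\<tau>\<in>?Fd. \<tau> \<subseteq> \<sigma>}. G \<tau>)"
    using fin by (intro sum.mono_neutral_cong_right) auto
  also have "\<dots> = (\<Sum>v\<in>\<sigma>. G (\<sigma> - {v}))"
    unfolding eq by (subst sum.reindex) (auto simp: inj_on_def)
  finally show ?thesis by simp
qed

lemma contradiction: False
proof -
  have "\<exists>a. inj_on a F \<and> gp \<phi> V (a ` F) \<and> (\<forall>\<tau>\<in>F. good a \<tau> (a \<tau>))"
  proof (rule generic_choice[OF finite_F finite_V good_cong])
    fix a \<tau> and Z :: "'a set"
    assume *: "\<tau> \<in> F" "Z \<in> null_sets lborel" "inj_on a {\<rho>\<in>F. card \<rho> < card \<tau>}"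
      "gp \<phi> V (a ` {\<rho>\<in>F. card \<rho> < card \<tau>})" "\<And>\<rho>. \<lbrakk>\<rho> \<in> F; card \<rho> < card \<tau>\<rbrakk> \<Longrightarrow> good a \<rho> (a \<rho>)"
    consider "card \<tau> < DIM('a)" | "card \<tau> = DIM('a)" | "card \<tau> = Suc DIM('a)"
      using F(3)[OF *(1)] by linarith
    then show "\<exists>y. y \<notin> Z \<and> good a \<tau> y"
    proof cases
      case 1
      then show ?thesis using * by (intro exists_good_small) auto
    next
      case 2
      then show ?thesis using * by (intro exists_good_facet) auto
    next
      case 3
      then show ?thesis using * by (intro exists_good_cell) auto
    qed
  qed
  then obtain a where a': "inj_on a F \<and> gp \<phi> V (a ` F) \<and> (\<forall>\<tau>\<in>F. good a \<tau> (a \<tau>))" by (elim exE)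
  have a: "inj_on a F" "gp \<phi> V (a ` F)" using a' by simp_all
  have a3: "good a \<tau> (a \<tau>)" if "\<tau> \<in> F" for \<tau> using conjunct2[OF conjunct2[OF a']] that by (rule bspec)
  have aball: "a \<tau> \<in> ball 0 r" if "\<tau> \<in> F" for \<tau> using a3[OF that] by (simp add: good_def)
  have null: "flats (\<phi> ` V \<union> a ` F) \<in> null_sets lborel" using finite_V finite_F by (intro flats_null_sets) auto
  obtain z where z: "z \<notin> flats (\<phi> ` V \<union> a ` F)" "z \<in> ball 0 r"
    using exists_generic[OF null, of "\<lambda>_. True" 0] by auto
  have gpz: "gp \<phi> V (insert z (a ` F))" using a z finite_V finite_F by (intro gp_insert) auto
  have znotin: "z \<notin> a ` F" using notin_if_notin_flats[OF z(1)] by simp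
  define G where "G \<tau> = iter \<phi> a (DIM('a) - 1) \<tau> {a \<tau>, z}" for \<tau>
  define Fd where "Fd = {\<tau>. \<tau> \<in> F \<and> card \<tau> = DIM('a)}"
  have "even (\<Sum>\<sigma>\<in>T. iter \<phi> a DIM('a) \<sigma> {z})"
  proof (rule dvd_sum)
    fix \<sigma> assume \<sigma>: "\<sigma> \<in> T"
    have ne: "\<sigma> \<noteq> {}" using T(2)[OF \<sigma>] by auto
    then have \<sigma>F: "\<sigma> \<in> F" using \<sigma> by blast
    have sub: "faces \<sigma> \<subseteq> F" "\<sigma> \<notin> faces \<sigma>" using \<sigma> by (auto simp: faces_def)
    \<comment> \<open>The d-cycle of a cell omits its apex by goodness, hence also omits the generic
      \<open>z\<close>.\<close>
    have "odd (iter \<phi> a DIM('a) \<sigma> {z}) \<longleftrightarrow> odd (iter \<phi> a DIM('a) \<sigma> {a \<sigma>})"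
    proof (rule iter_cocycle_pair)
      show "gp \<phi> \<sigma> ({a \<sigma>, z} \<union> a ` faces \<sigma>)" using gpz by (rule gp_mono) (use \<sigma> \<sigma>F sub in auto)
      show "inj_on a (faces \<sigma>)" using a(1) sub(1) by (rule inj_on_subset)
      show "a \<sigma> \<noteq> z" using znotin imageI[OF \<sigma>F, of a] by metis
      have "a \<sigma> \<notin> a ` faces \<sigma>" using inj_on_image_mem_iff[OF a(1) \<sigma>F sub(1)] sub(2) by simp
      moreover have "z \<notin> a ` faces \<sigma>" using znotin image_mono[OF sub(1), of a] by (rule contra_subsetD[rotated])
      ultimately show "{a \<sigma>, z} \<inter> a ` faces \<sigma> = {}" by simp
    qed (rule T(2)[OF \<sigma>])
    moreover have "even (iter \<phi> a DIM('a) \<sigma> {a \<sigma>})"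
      using a3[OF \<sigma>F] T(2)[OF \<sigma>] by (simp add: good_def)
    ultimately show "even (iter \<phi> a DIM('a) \<sigma> {z})" by simp
  qed
  moreover have "(\<Sum>\<sigma>\<in>T. iter \<phi> a DIM('a) \<sigma> {z}) = (\<Sum>\<sigma>\<in>T. hit \<phi> \<sigma> {z}) + (\<Sum>\<sigma>\<in>T. \<Sum>v\<in>\<sigma>. G (\<sigma> - {v}))"
  proof -
    have "iter \<phi> a DIM('a) \<sigma> {z} = hit \<phi> \<sigma> {z} + (\<Sum>v\<in>\<sigma>. G (\<sigma> - {v}))" for \<sigma>
    proof -
      have "DIM('a) = Suc (DIM('a) - 1)" by simp
      then obtain j where j: "DIM('a) = Suc j" by blast
      then have "DIM('a) - 1 = j" by linarith
      then show ?thesis unfolding G_def by (simp only: j iter.simps(2))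
    qed
    then show ?thesis by (simp add: sum.distrib)
  qed
  moreover have "even (\<Sum>\<sigma>\<in>T. \<Sum>v\<in>\<sigma>. G (\<sigma> - {v}))"
  proof -
    have "(\<Sum>\<sigma>\<in>T. \<Sum>v\<in>\<sigma>. G (\<sigma> - {v})) = (\<Sum>\<sigma>\<in>T. \<Sum>\<tau>\<in>Fd. of_bool (\<tau> \<subseteq> \<sigma>) * G \<tau>)"
      unfolding Fd_def by (intro sum.cong sum_facets refl)
    also have "\<dots> = (\<Sum>\<tau>\<in>Fd. (\<Sum>\<sigma>\<in>T. of_bool (\<tau> \<subseteq> \<sigma>)) * G \<tau>)"
      by (subst sum.swap) (simp only: sum_distrib_right)
    also have "even \<dots>"
    proof (rule dvd_sum)
      fix \<tau> assume \<tau>: "\<tau> \<in> Fd"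
      show "even ((\<Sum>\<sigma>\<in>T. of_bool (\<tau> \<subseteq> \<sigma>)) * G \<tau>)"
      \<comment> \<open>A facet in an even number of cells cancels. One in an odd number misses the
        ball, whereas all apices and \<open>z\<close> lie in it, so its term is 0.\<close>
      proof (cases "even (\<Sum>\<sigma>\<in>T. of_bool (\<tau> \<subseteq> \<sigma>) :: nat)")
        case False
        then have "convex hull (\<phi> ` \<tau>) \<inter> ball 0 r = {}"
          using tri \<tau> unfolding triangulation_def Fd_def by blast
        then have "G \<tau> = 0" unfolding G_def
          using \<tau> z(2) aball faces_F[of \<tau>] by (intro iter_eq_0[where U = "ball 0 r"]) (auto simp: Fd_def simp del: mem_ball)
        then show ?thesis by simp
      qed (rule dvd_mult2)
    qed
    finally show ?thesis .
  qed
  moreover have "odd (\<Sum>\<sigma>\<in>T. hit \<phi> \<sigma> {z})"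
  proof -
    have "z \<notin> flats (\<phi> ` V)" using z(1) flats_mono[of "\<phi> ` V" "\<phi> ` V \<union> a ` F"] by blast
    then show ?thesis using tri z(2) unfolding triangulation_def by blast
  qed
  ultimately show False by simp
qed

end

section \<open>Measures of bounded support\<close>

text \<open>The simplex lies within \<eta> of its vertex v, so a hull that meets it passes within
  \<eta> of \<open>\<phi> v\<close>.\<close>

lemma nn_integral_hit_le:
  fixes M :: "nat \<Rightarrow> 'a::euclidean_space measure" and \<phi> :: "nat \<Rightarrow> 'a"
  assumes prob: "\<And>i. prob_space (M i)" and sets: "\<And>i. sets (M i) = sets borel"
    and v: "v \<in> \<tau>" "\<And>u. u \<in> \<tau> \<Longrightarrow> dist (\<phi> v) (\<phi> u) \<le> \<eta>" and I: "finite I"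
    and le: "measure (PiM I M) {x \<in> space (PiM I M). setdist {\<phi> v} (convex hull (x ` I)) \<le> \<eta>} \<le> \<epsilon>"
  shows "(\<integral>\<^sup>+ x. of_nat (hit \<phi> \<tau> (x ` I)) \<partial>PiM I M) \<le> ennreal \<epsilon>"
proof -
  interpret prob_space "PiM I M" using prob by (rule prob_space_PiM)
  let ?E = "{x \<in> space (PiM I M). setdist {\<phi> v} (convex hull (x ` I)) \<le> \<eta>}"
  have meas: "(\<lambda>x. setdist {\<phi> v} (convex hull (x ` I))) \<in> borel_measurable (PiM I M)"
    using setdist_convex_hull_measurable[where M = M and C = "{\<phi> v}" and A = "{}", OF I sets] by simp
  have "(\<integral>\<^sup>+ x. of_nat (hit \<phi> \<tau> (x ` I)) \<partial>PiM I M) \<le> (\<integral>\<^sup>+ x. indicator ?E x \<partial>PiM I M)"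
  proof (rule nn_integral_mono)
    fix x assume x: "x \<in> space (PiM I M)"
    show "of_nat (hit \<phi> \<tau> (x ` I)) \<le> (indicator ?E x :: ennreal)"
    proof (cases "convex hull (\<phi> ` \<tau>) \<inter> convex hull (x ` I) = {}")
      case False
      then obtain y where y: "y \<in> convex hull (\<phi> ` \<tau>)" "y \<in> convex hull (x ` I)" by blast
      have "convex hull (\<phi> ` \<tau>) \<subseteq> cball (\<phi> v) \<eta>" using v by (intro hull_minimal) auto
      then have "dist (\<phi> v) y \<le> \<eta>" using y by auto
      then have "setdist {\<phi> v} (convex hull (x ` I)) \<le> \<eta>"
        using setdist_le_dist[of "\<phi> v" "{\<phi> v}" y "convex hull (x ` I)"] y by simp
      then show ?thesis using x by (simp add: hit_def)
    qed (simp add: hit_def)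
  qed
  also have "\<dots> = emeasure (PiM I M) ?E" using meas by (intro nn_integral_indicator) measurable
  also have "\<dots> \<le> ennreal \<epsilon>" using le by (simp add: emeasure_eq_measure ennreal_leI)
  finally show ?thesis .
qed

text \<open>The constant: with u = 1/(d+1), the hypothesis says d! times delta is less than 2u(1-u).\<close>
lemma exists_parameters:
  fixes D :: nat and \<delta> :: real
  assumes D: "0 < D" and lt: "\<delta> < 2 * real D / ((real D + 1) * fact (D + 1))"
  shows "\<exists>s \<epsilon>. 0 < \<epsilon> \<and> \<epsilon> + real (Suc D) * s < 1 \<and>
    (\<forall>t. t \<le> 1 / 2 \<longrightarrow> 2 * t * (1 - t) \<le> fact D * (\<delta> + real (D - 1) * \<epsilon>) \<longrightarrow> t \<le> s)"
proof -
  define u where "u = 1 / (real D + 1)"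
  have u: "u \<le> 1 / 2" using D by (simp add: u_def field_simps)
  have u1: "1 - u = real D * u" by (simp add: u_def field_simps)
  have "fact D * \<delta> < fact D * (2 * real D / ((real D + 1) * fact (D + 1)))"
    using lt by (intro mult_strict_left_mono) auto
  also have "\<dots> = 2 * u * (real D * u)" by (simp add: u_def)
  finally have c: "fact D * \<delta> < 2 * u * (1 - u)" by (simp add: u1)
  \<comment> \<open>By continuity s can be taken slightly below u with \<delta> still admissible;
    the slack (d+1)s < 1 then leaves room for a positive \<epsilon>.\<close>
  have "((\<lambda>t. 2 * t * (1 - t)) \<longlongrightarrow> 2 * u * (1 - u)) (at_left u)" by (intro tendsto_intros)
  then have "\<forall>\<^sub>F t in at_left u. fact D * \<delta> < 2 * t * (1 - t)" using c by (rule order_tendstoD)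
  moreover have "\<forall>\<^sub>F t in at_left u. t < u" by (simp add: eventually_at_filter)
  ultimately have "\<forall>\<^sub>F t in at_left u. fact D * \<delta> < 2 * t * (1 - t) \<and> t < u" by (rule eventually_conj)
  then obtain s where s: "fact D * \<delta> < 2 * s * (1 - s)" "s < u"
    using eventually_happens'[OF trivial_limit_at_left_real] by blast
  have "((\<lambda>\<epsilon>. fact D * (\<delta> + real (D - 1) * \<epsilon>)) \<longlongrightarrow> fact D * (\<delta> + real (D - 1) * 0)) (at_right 0)"
    by (intro tendsto_intros)
  then have "\<forall>\<^sub>F \<epsilon> in at_right 0. fact D * (\<delta> + real (D - 1) * \<epsilon>) < 2 * s * (1 - s)"
    using s(1) by (intro order_tendstoD) auto
  moreover have "((\<lambda>\<epsilon>. \<epsilon> + real (Suc D) * s) \<longlongrightarrow> 0 + real (Suc D) * s) (at_right 0)"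
    by (intro tendsto_intros)
  then have "\<forall>\<^sub>F \<epsilon> in at_right 0. \<epsilon> + real (Suc D) * s < 1"
    using s(2) by (intro order_tendstoD) (simp_all add: u_def field_simps)
  moreover have "\<forall>\<^sub>F \<epsilon> in at_right 0. (0::real) < \<epsilon>" by (simp add: eventually_at_filter)
  ultimately have "\<forall>\<^sub>F \<epsilon> in at_right 0. fact D * (\<delta> + real (D - 1) * \<epsilon>) < 2 * s * (1 - s) \<and>
      \<epsilon> + real (Suc D) * s < 1 \<and> (0::real) < \<epsilon>" by (intro eventually_conj)
  then obtain \<epsilon> where \<epsilon>: "fact D * (\<delta> + real (D - 1) * \<epsilon>) < 2 * s * (1 - s)" "\<epsilon> + real (Suc D) * s < 1" "0 < \<epsilon>"
    using eventually_happens'[OF trivial_limit_at_right_real] by blast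
  have "t \<le> s" if t: "t \<le> 1 / 2" "2 * t * (1 - t) \<le> fact D * (\<delta> + real (D - 1) * \<epsilon>)" for t
  proof (rule ccontr)
    assume "\<not> t \<le> s"
    \<comment> \<open>The product equals t(1-t) - s(1-s); both factors are positive because s < t
      \<le> 1/2.\<close>
    then have "0 < (t - s) * (1 - t - s)" using t(1) s(2) u by (intro mult_pos_pos) auto
    then show False using t(2) \<epsilon>(1) by (simp add: algebra_simps)
  qed
  then show ?thesis using \<epsilon> by blast
qed

context ac_family begin

text \<open>The negated conclusion is the estimate for vertices; all other hypotheses of
  \<open>counterexample\<close> come from a fine mesh. The order of choice is \<epsilon> and s from
  \<delta>, next \<open>K\<close>, and the mesh from \<epsilon> and \<open>K\<close>.\<close>

lemma exists_point_of_bounded: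
  assumes r: "0 < r" and supp: "\<And>i. AE x in M i. x \<in> ball 0 r"
    and \<delta>: "0 \<le> \<delta>" "\<delta> < 2 * real DIM('a) / ((real DIM('a) + 1) * fact (DIM('a) + 1))"
  shows "\<exists>p. \<delta> < measure (PiM {..DIM('a)} M) {x \<in> space (PiM {..DIM('a)} M). p \<in> convex hull (x ` {..DIM('a)})}"
proof (rule ccontr)
  assume neg: "\<not> ?thesis"
  obtain s \<epsilon> where \<epsilon>: "0 < \<epsilon>" "\<epsilon> + real (Suc DIM('a)) * s < 1"
    and s: "\<And>t. \<lbrakk>t \<le> 1 / 2; 2 * t * (1 - t) \<le> fact DIM('a) * (\<delta> + real (DIM('a) - 1) * \<epsilon>)\<rbrakk> \<Longrightarrow> t \<le> s"
    using exists_parameters[OF DIM_positive \<delta>(2)] by blast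
  obtain K :: "'a set" where K: "compact K" and tri: "\<forall>\<eta>>0. \<exists>\<phi> T. triangulation r K \<phi> T \<and>
    (\<forall>\<sigma>\<in>T. \<forall>x\<in>\<sigma>. \<forall>y\<in>\<sigma>. dist (\<phi> x) (\<phi> y) \<le> \<eta>)"
    using fine_triangulation[OF r] by blast
  define near where "near J p \<eta> = {x \<in> space (PiM J M). setdist {p} (convex hull (x ` J)) \<le> \<eta>}" for J and p :: 'a and \<eta>
  \<comment> \<open>The index sets needed for \<open>hit_face\<close>, together with {d-1} for
    \<open>hit_cell\<close>; {d} is the case k = d. Each has at most d elements, as the uniform
    estimate requires.\<close>
  define JJ where "JJ = (\<lambda>k. {k..DIM('a)}) ` {1..DIM('a)} \<union> {{DIM('a) - 1}}"
  have JJ: "finite J" "J \<noteq> {}" "card J \<le> DIM('a)" if "J \<in> JJ" for J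
    using that by (auto simp: JJ_def)
  have "\<forall>J\<in>JJ. \<exists>\<eta>>0. \<forall>p\<in>K. measure (PiM J M) (near J p \<eta>) \<le> \<epsilon>"
    unfolding near_def using JJ K \<epsilon>(1) by (intro ballI uniformly_rarely_near_convex_hull) auto
  then obtain e where e: "\<And>J. J \<in> JJ \<Longrightarrow> e J > 0"
    "\<And>J p. \<lbrakk>J \<in> JJ; p \<in> K\<rbrakk> \<Longrightarrow> measure (PiM J M) (near J p (e J)) \<le> \<epsilon>"
    by metis
  define \<eta> where "\<eta> = Min (e ` JJ)"
  have finJJ: "finite JJ" "JJ \<noteq> {}" by (auto simp: JJ_def)
  then have \<eta>: "\<eta> > 0" "\<And>J. J \<in> JJ \<Longrightarrow> \<eta> \<le> e J" using e(1) by (auto simp: \<eta>_def)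
  obtain \<phi> T where T\<eta>: "triangulation r K \<phi> T \<and> (\<forall>\<sigma>\<in>T. \<forall>x\<in>\<sigma>. \<forall>y\<in>\<sigma>. dist (\<phi> x) (\<phi> y) \<le> \<eta>)"
    using mp[OF spec[OF tri] \<eta>(1)] by (elim exE)
  then have T: "triangulation r K \<phi> T" and mesh: "\<And>\<sigma> x y. \<lbrakk>\<sigma> \<in> T; x \<in> \<sigma>; y \<in> \<sigma>\<rbrakk> \<Longrightarrow> dist (\<phi> x) (\<phi> y) \<le> \<eta>"
    by simp_all
  have cell: "(\<integral>\<^sup>+ x. of_nat (hit \<phi> \<tau> (x ` J)) \<partial>PiM J M) \<le> ennreal \<epsilon>"
    if \<tau>: "\<tau> \<subseteq> \<sigma>" "\<sigma> \<in> T" "\<tau> \<noteq> {}" and J: "J \<in> JJ" for \<tau> \<sigma> J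
  proof -
    obtain v where v: "v \<in> \<tau>" using \<tau>(3) by blast
    then have "\<phi> v \<in> K" using \<tau> T unfolding triangulation_def by blast
    show ?thesis
    proof (rule nn_integral_hit_le[OF prob sets v])
      show "dist (\<phi> v) (\<phi> u) \<le> e J" if "u \<in> \<tau>" for u
        using order_trans[OF mesh[OF \<tau>(2) subsetD[OF \<tau>(1) v] subsetD[OF \<tau>(1) that]] \<eta>(2)[OF J]] .
      show "finite J" using J by (rule JJ)
      show "measure (PiM J M) {x \<in> space (PiM J M). setdist {\<phi> v} (convex hull (x ` J)) \<le> e J} \<le> \<epsilon>"
        using e(2)[OF J \<open>\<phi> v \<in> K\<close>] by (simp add: near_def)
    qed
  qed
  have card\<sigma>: "card \<sigma> = Suc DIM('a)" if "\<sigma> \<in> T" for \<sigma> using T that by (simp add: triangulation_def)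
  have "counterexample M r \<delta> \<epsilon> s K \<phi> T"
  proof (unfold_locales)
    fix v assume "v \<in> \<Union>T"
    let ?I = "{..DIM('a)}"
    let ?E = "{x \<in> space (PiM ?I M). \<phi> v \<in> convex hull (x ` ?I)}"
    have "Measurable.pred (PiM ?I M) (\<lambda>x. {\<phi> v} \<inter> convex hull ({} \<union> x ` ?I) \<noteq> {})"
      using sets by (intro convex_hulls_meet_measurable) auto
    then have "?E \<in> sets (PiM ?I M)" by (simp add: pred_def)
    moreover have "(\<integral>\<^sup>+ x. of_nat (hit \<phi> {v} (x ` ?I)) \<partial>PiM ?I M) = (\<integral>\<^sup>+ x. indicator ?E x \<partial>PiM ?I M)"
      by (intro nn_integral_cong) (simp add: hit_def indicator_def)
    ultimately have "(\<integral>\<^sup>+ x. of_nat (hit \<phi> {v} (x ` ?I)) \<partial>PiM ?I M) = ennreal (measure (PiM ?I M) ?E)"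
      by (simp add: P.emeasure_eq_measure)
    also have "\<dots> \<le> ennreal \<delta>" using neg by (intro ennreal_leI) (auto simp: not_less)
    finally show "(\<integral>\<^sup>+ x. of_nat (hit \<phi> {v} (x ` ?I)) \<partial>PiM ?I M) \<le> ennreal \<delta>" .
  next
    fix \<tau> \<sigma> k assume *: "\<tau> \<subseteq> \<sigma>" "\<sigma> \<in> T" "card \<tau> = Suc k" "1 \<le> k" "k \<le> DIM('a)"
    then show "(\<integral>\<^sup>+ x. of_nat (hit \<phi> \<tau> (x ` {k..DIM('a)})) \<partial>PiM {k..DIM('a)} M) \<le> ennreal \<epsilon>"
      by (intro cell[of \<tau> \<sigma>]) (auto simp: JJ_def)
  next
    fix \<sigma> and i :: nat assume \<sigma>: "\<sigma> \<in> T" and i: "i \<in> {DIM('a) - 1, DIM('a)}"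
    have fin: "finite \<sigma>" "\<sigma> \<noteq> {}" using card\<sigma>[OF \<sigma>] by (auto intro: card_ge_0_finite)
    have iJ: "{i} \<in> JJ"
    proof (cases "i = DIM('a)")
      case True
      then have "{i} = {DIM('a)..DIM('a)}" by simp
      moreover have "DIM('a) \<in> {1..DIM('a)}" by (simp add: Suc_le_eq)
      ultimately show ?thesis unfolding JJ_def by blast
    qed (use i in \<open>simp add: JJ_def\<close>)
    have m: "(\<lambda>x. hit \<phi> \<sigma> {x}) \<in> borel_measurable (M i)"
      using iter_insert_measurable[OF fin(1) _ sets, of "{}" \<phi> undefined 0 i] by simp
    then have meas: "(\<lambda>x. of_nat (hit \<phi> \<sigma> {x}) :: ennreal) \<in> borel_measurable (M i)"
      by (rule measurable_compose[OF _ of_nat_ennreal_measurable])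
    have "{x \<in> space (M i). odd (hit \<phi> \<sigma> {x})} \<in> sets (M i)"
      using measurable_sets[OF meas, of "{1}"] by (simp add: vimage_def hit_def Int_def conj_commute)
    moreover have "(\<integral>\<^sup>+ x. of_nat (hit \<phi> \<sigma> {x}) \<partial>M i) = (\<integral>\<^sup>+ x. indicator {x \<in> space (M i). odd (hit \<phi> \<sigma> {x})} x \<partial>M i)"
      by (intro nn_integral_cong) (simp add: indicator_def hit_def)
    moreover have "(\<integral>\<^sup>+ x. of_nat (hit \<phi> \<sigma> (x ` {i})) \<partial>PiM {i} M) = (\<integral>\<^sup>+ x. of_nat (hit \<phi> \<sigma> {x}) \<partial>M i)"
      using product_nn_integral_singleton[OF meas] by simp
    ultimately have "ennreal (measure (M i) {x \<in> space (M i). odd (hit \<phi> \<sigma> {x})}) \<le> ennreal \<epsilon>"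
      using cell[OF subset_refl \<sigma> fin(2) iJ] by (simp add: N.emeasure_eq_measure)
    then show "measure (M i) {x \<in> space (M i). odd (hit \<phi> \<sigma> {x})} \<le> \<epsilon>"
      using \<epsilon>(1) by (simp add: ennreal_le_iff)
  qed (use r supp T \<delta> \<epsilon> s in auto)
  then show False by (rule counterexample.contradiction)
qed

end

section \<open>Comparison of product measures\<close>

text \<open>Fubini, one factor C per coordinate. In use \<open>N i\<close> is \<open>m i\<close>
  conditioned on a large ball, whose density is at most C.\<close>

lemma nn_integral_PiM_dominated:
  assumes m: "product_sigma_finite m" and N: "product_sigma_finite N"
    and sets: "\<And>i. sets (N i) = sets (m i)"
    and dom: "\<And>i g. g \<in> borel_measurable (m i) \<Longrightarrow> (\<integral>\<^sup>+ x. g x \<partial>N i) \<le> C * (\<integral>\<^sup>+ x. g x \<partial>m i)"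
    and "finite I" and f: "f \<in> borel_measurable (PiM I m)"
  shows "(\<integral>\<^sup>+ x. f x \<partial>PiM I N) \<le> C ^ card I * (\<integral>\<^sup>+ x. f x \<partial>PiM I m)"
  using assms(5) f
proof (induction I arbitrary: f)
  case empty
  then show ?case by (simp add: PiM_empty)
next
  case (insert i I)
  interpret m: product_sigma_finite m by (rule m)
  interpret N: product_sigma_finite N by (rule N)
  interpret i: sigma_finite_measure "m i" by (rule m.sigma_finite_measures)
  have setsP: "sets (PiM J N) = sets (PiM J m)" for J using sets by (intro sets_PiM_cong) auto
  have spaceP: "space (PiM J N) = space (PiM J m)" for J using setsP by (rule sets_eq_imp_space_eq)
  note [measurable] = insert.prems
  have fN: "f \<in> borel_measurable (PiM (insert i I) N)"
    using insert.prems by (simp cong: measurable_cong_sets add: measurable_cong_sets[OF setsP refl])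
  have "(\<integral>\<^sup>+ x. f x \<partial>PiM (insert i I) N) = (\<integral>\<^sup>+ x. (\<integral>\<^sup>+ y. f (x(i := y)) \<partial>N i) \<partial>PiM I N)"
    using insert.hyps fN by (rule N.product_nn_integral_insert)
  also have "\<dots> \<le> (\<integral>\<^sup>+ x. C * (\<integral>\<^sup>+ y. f (x(i := y)) \<partial>m i) \<partial>PiM I N)"
  proof (rule nn_integral_mono)
    fix x assume "x \<in> space (PiM I N)"
    then have [measurable]: "x \<in> space (PiM I m)" by (simp add: spaceP)
    show "(\<integral>\<^sup>+ y. f (x(i := y)) \<partial>N i) \<le> C * (\<integral>\<^sup>+ y. f (x(i := y)) \<partial>m i)"
      using insert.hyps by (intro dom) measurable
  qed
  also have "\<dots> \<le> C ^ card I * (\<integral>\<^sup>+ x. C * (\<integral>\<^sup>+ y. f (x(i := y)) \<partial>m i) \<partial>PiM I m)"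
    by (rule insert.IH) measurable
  also have "\<dots> = C ^ card (insert i I) * (\<integral>\<^sup>+ x. (\<integral>\<^sup>+ y. f (x(i := y)) \<partial>m i) \<partial>PiM I m)"
    using insert.hyps by (subst nn_integral_cmult) (measurable, simp add: mult_ac)
  also have "(\<integral>\<^sup>+ x. (\<integral>\<^sup>+ y. f (x(i := y)) \<partial>m i) \<partial>PiM I m) = (\<integral>\<^sup>+ x. f x \<partial>PiM (insert i I) m)"
    using insert.hyps insert.prems by (rule m.product_nn_integral_insert[symmetric])
  finally show ?case .
qed

section \<open>The general case\<close>

lemma eventually_measure_ball_gt:
  fixes M :: "'a::euclidean_space measure"
  assumes "prob_space M" "sets M = sets borel" "\<kappa> < 1"
  shows "\<forall>\<^sub>F j in sequentially. \<kappa> < measure M (ball 0 (real j))"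
proof -
  interpret prob_space M by fact
  have "(\<lambda>j. measure M (ball 0 (real j))) \<longlonglongrightarrow> measure M (\<Union>j. ball 0 (real j))"
  proof (rule finite_Lim_measure_incseq)
    show "range (\<lambda>j. ball 0 (real j)) \<subseteq> events" using assms(2) by (simp add: image_subset_iff)
    show "incseq (\<lambda>j. ball (0 :: 'a) (real j))" unfolding incseq_def by (intro allI impI subset_ball) simp
  qed
  also have "(\<Union>j. ball 0 (real j)) = space M"
  proof -
    have "\<exists>j. x \<in> ball 0 (real j)" for x :: 'a using reals_Archimedean2[of "norm x"] by simp
    then show ?thesis using sets_eq_imp_space_eq[OF assms(2)] by auto
  qed
  also have "measure M (space M) = 1" by (rule prob_space)
  finally show ?thesis using assms(3) by (rule order_tendstoD)
qed

context ac_family begin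

text \<open>Conditioning on a ball of mass more than \<kappa> gives laws of bounded support with
  density at most 1/\<kappa>. A point good for them keeps at least the fraction \<kappa>^(d+1) of
  its probability under the original product.\<close>

lemma exists_point_approx:
  assumes M: "finite (range M)" and \<kappa>: "0 < \<kappa>" "\<kappa> < 1"
    and \<delta>: "0 \<le> \<delta>" "\<delta> < 2 * real DIM('a) / ((real DIM('a) + 1) * fact (DIM('a) + 1))"
  shows "\<exists>p. \<kappa> ^ Suc DIM('a) * \<delta> \<le>
    measure (PiM {..DIM('a)} M) {x \<in> space (PiM {..DIM('a)} M). p \<in> convex hull (x ` {..DIM('a)})}"
proof -
  let ?I = "{..DIM('a)}"
  have "\<forall>\<^sub>F j in sequentially. \<forall>N\<in>range M. \<kappa> < measure N (ball 0 (real j))"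
    using prob sets \<kappa>(2) by (intro eventually_ball_finite M) (auto intro!: eventually_measure_ball_gt)
  then have "\<forall>\<^sub>F j in sequentially. (\<forall>N\<in>range M. \<kappa> < measure N (ball 0 (real j))) \<and> 0 < j"
    using eventually_gt_at_top by (rule eventually_conj)
  \<comment> \<open>Finitely many distinct measures admit one common radius.\<close>
  then obtain j :: nat where j: "\<And>i. \<kappa> < measure (M i) (ball 0 (real j))" "0 < j"
    using eventually_happens'[OF sequentially_bot] by blast
  define B where "B = ball (0 :: 'a) (real j)"
  have B: "B \<in> sets (M i)" "\<kappa> < measure (M i) B" for i using sets j(1) by (simp_all add: B_def)
  have eB: "emeasure (M i) B = ennreal (measure (M i) B)" for i by (rule N.emeasure_eq_measure)
  have eB0: "emeasure (M i) B \<noteq> 0" "emeasure (M i) B \<noteq> \<infinity>" for i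
    using B(2)[of i] \<kappa>(1) unfolding eB by (auto simp: ennreal_eq_0_iff)
  define N where "N i = uniform_measure (M i) B" for i
  interpret N: ac_family N
  proof (rule ac_family.intro)
    show "prob_space (N i)" for i unfolding N_def using eB0 by (rule prob_space_uniform_measure)
    show "sets (N i) = sets borel" for i unfolding N_def by (simp add: sets)
    show "absolutely_continuous lborel (N i)" for i
      unfolding absolutely_continuous_def
    proof
      fix A :: "'a set" assume A: "A \<in> null_sets lborel"
      then have "A \<in> null_sets (M i)" using ac[of i] by (auto simp: absolutely_continuous_def)
      then have "A \<in> sets (M i)" "emeasure (M i) (B \<inter> A) = 0"
        using B(1)[of i] by (auto intro: emeasure_eq_0[of A])
      then show "A \<in> null_sets (N i)"
        using B(1)[of i] by (intro null_setsI) (simp_all add: N_def emeasure_uniform_measure)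
    qed
  qed
  have "\<exists>p. \<delta> < measure (PiM ?I N) {x \<in> space (PiM ?I N). p \<in> convex hull (x ` ?I)}"
  proof (rule N.exists_point_of_bounded)
    show "0 < real j" using j(2) by simp
    show "AE x in N i. x \<in> ball 0 (real j)" for i
      unfolding N_def B_def[symmetric] using B(1) by (intro AE_uniform_measureI) auto
  qed (use \<delta> in auto)
  then obtain p where p: "\<delta> < measure (PiM ?I N) {x \<in> space (PiM ?I N). p \<in> convex hull (x ` ?I)}" by blast
  let ?E = "{x \<in> space (PiM ?I M). p \<in> convex hull (x ` ?I)}"
  have setsN: "sets (N i) = sets (M i)" for i by (simp add: N_def)
  then have setsP: "sets (PiM ?I N) = sets (PiM ?I M)" by (intro sets_PiM_cong) auto
  then have spaceP: "space (PiM ?I N) = space (PiM ?I M)" by (rule sets_eq_imp_space_eq)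
  have "Measurable.pred (PiM ?I M) (\<lambda>x. {p} \<inter> convex hull ({} \<union> x ` ?I) \<noteq> {})"
    using sets by (intro convex_hulls_meet_measurable) auto
  then have E: "?E \<in> sets (PiM ?I M)" by (simp add: pred_def)
  have "(\<integral>\<^sup>+ x. indicator ?E x \<partial>PiM ?I N) \<le> ennreal (1 / \<kappa>) ^ card ?I * (\<integral>\<^sup>+ x. indicator ?E x \<partial>PiM ?I M)"
  proof (rule nn_integral_PiM_dominated)
    show "product_sigma_finite M" "product_sigma_finite N" by unfold_locales
    fix i and g :: "'a \<Rightarrow> ennreal" assume g: "g \<in> borel_measurable (M i)"
    have "(\<integral>\<^sup>+ x. g x \<partial>N i) = (\<integral>\<^sup>+ x. g x * indicator B x \<partial>M i) / emeasure (M i) B"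
      unfolding N_def using g B(1) by (rule nn_integral_uniform_measure)
    also have "\<dots> = (\<integral>\<^sup>+ x. g x * indicator B x \<partial>M i) * ennreal (inverse (measure (M i) B))"
      using B(2)[of i] \<kappa>(1) by (simp add: eB divide_ennreal_def inverse_ennreal)
    also have "\<dots> \<le> (\<integral>\<^sup>+ x. g x \<partial>M i) * ennreal (1 / \<kappa>)"
    proof (intro mult_mono nn_integral_mono ennreal_leI)
      show "g x * indicator B x \<le> g x" for x by (simp add: indicator_def)
      show "inverse (measure (M i) B) \<le> 1 / \<kappa>"
        unfolding inverse_eq_divide using B(2)[of i] \<kappa>(1) by (intro divide_left_mono) auto
    qed auto
    also have "\<dots> = ennreal (1 / \<kappa>) * (\<integral>\<^sup>+ x. g x \<partial>M i)" by (rule mult.commute)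
    finally show "(\<integral>\<^sup>+ x. g x \<partial>N i) \<le> ennreal (1 / \<kappa>) * (\<integral>\<^sup>+ x. g x \<partial>M i)" .
  qed (use setsN E in auto)
  also have "(\<integral>\<^sup>+ x. indicator ?E x \<partial>PiM ?I M) = ennreal (measure (PiM ?I M) ?E)"
    using E by (simp add: P.emeasure_eq_measure)
  also have "(\<integral>\<^sup>+ x. indicator ?E x \<partial>PiM ?I N) = ennreal (measure (PiM ?I N) ?E)"
    using E setsP by (simp add: N.P.emeasure_eq_measure)
  finally have "measure (PiM ?I N) ?E \<le> (1 / \<kappa>) ^ Suc DIM('a) * measure (PiM ?I M) ?E"
    using \<kappa>(1) by (simp add: ennreal_power ennreal_mult[symmetric] ennreal_le_iff del: power_Suc)
  then have "\<delta> \<le> (1 / \<kappa>) ^ Suc DIM('a) * measure (PiM ?I M) ?E" using p by (simp add: spaceP del: power_Suc)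
  then have "\<kappa> ^ Suc DIM('a) * \<delta> \<le> measure (PiM ?I M) ?E"
    using \<kappa>(1) by (simp add: power_one_over field_simps del: power_Suc)
  then show ?thesis by blast
qed

text \<open>The approximate points form a bounded sequence, and upper semicontinuity carries the
  estimate to the limit of a convergent subsequence.\<close>

lemma exists_point:
  assumes M: "finite (range M)"
  shows "\<exists>p. 2 * real DIM('a) / ((real DIM('a) + 1) * fact (DIM('a) + 1)) \<le>
    measure (PiM {..DIM('a)} M) {x \<in> space (PiM {..DIM('a)} M). p \<in> convex hull (x ` {..DIM('a)})}"
proof -
  let ?I = "{..DIM('a)}"
  define c where "c = 2 * real DIM('a) / ((real DIM('a) + 1) * fact (DIM('a) + 1))"
  define m where "m p = measure (PiM ?I M) {x \<in> space (PiM ?I M). p \<in> convex hull (x ` ?I)}" for p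
  have c: "0 < c" unfolding c_def by (intro divide_pos_pos mult_pos_pos) auto
  \<comment> \<open>One sequence tending to 1 serves both as the retained mass and as the factor
    keeping \<delta> = \<open>\<kappa> n * c\<close> strictly below c. Starting at 1/2 bounds the
    probabilities away from 0 uniformly in n.\<close>
  define \<kappa> where "\<kappa> n = 1 - inverse (real (Suc (Suc n)))" for n
  have \<kappa>: "1 / 2 \<le> \<kappa> n" "\<kappa> n < 1" for n by (auto simp: \<kappa>_def field_simps)
  have "\<exists>p. \<kappa> n ^ Suc DIM('a) * (\<kappa> n * c) \<le> m p" for n
    unfolding m_def by (rule exists_point_approx[OF M, folded c_def]) (use \<kappa>[of n] c in auto)
  then obtain p where p: "\<And>n. \<kappa> n ^ Suc DIM('a) * (\<kappa> n * c) \<le> m (p n)" by metis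
  have lim_\<kappa>: "\<kappa> \<longlonglongrightarrow> 1"
    unfolding \<kappa>_def using tendsto_diff[OF tendsto_const LIMSEQ_Suc[OF LIMSEQ_inverse_real_of_nat], of 1] by simp
  have lim: "(\<lambda>n. \<kappa> n ^ Suc DIM('a) * (\<kappa> n * c)) \<longlonglongrightarrow> c"
  proof -
    have "(\<lambda>n. \<kappa> n ^ Suc DIM('a) * (\<kappa> n * c)) \<longlonglongrightarrow> 1 ^ Suc DIM('a) * (1 * c)"
      by (intro tendsto_mult tendsto_power lim_\<kappa> tendsto_const)
    then show ?thesis by (simp only: power_one mult_1)
  qed
  have "\<exists>R. \<forall>n. p n \<in> cball 0 R"
  proof -
    \<comment> \<open>A hull reaching outside a ball has a vertex outside it. The events that some
      vertex is far away have probability tending to 0, so the points \<open>p n\<close>, covered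
      with probability bounded below, cannot escape to infinity.\<close>
    define A where "A j = {x \<in> space (PiM ?I M). \<exists>i\<in>?I. real j \<le> norm (x i)}" for j
    have norm_meas: "(\<lambda>x. norm (x i)) \<in> borel_measurable (PiM ?I M)" if "i \<in> ?I" for i
      using that by measurable
    have "(\<lambda>j. measure (PiM ?I M) (A j)) \<longlonglongrightarrow> measure (PiM ?I M) (\<Inter>j. A j)"
    proof (rule P.finite_Lim_measure_decseq)
      show "range A \<subseteq> sets (PiM ?I M)" unfolding A_def using norm_meas by auto
      show "decseq A" unfolding A_def decseq_def by (auto intro: order_trans[OF of_nat_mono])
    qed
    moreover have "(\<Inter>j. A j) = {}"
    proof -
      have "\<exists>j. x \<notin> A j" for x
      proof -
        obtain j where j: "Max ((\<lambda>i. norm (x i)) ` ?I) < real j" using reals_Archimedean2 by blast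
        have "norm (x i) < real j" if "i \<in> ?I" for i
          using j that by (intro le_less_trans[OF Max_ge j]) auto
        then show ?thesis unfolding A_def by (auto simp: not_le intro!: exI[of _ j])
      qed
      then show ?thesis by blast
    qed
    ultimately have lim0: "(\<lambda>j. measure (PiM ?I M) (A j)) \<longlonglongrightarrow> 0" by simp
    have c0: "0 < (1 / 2) ^ Suc DIM('a) * (1 / 2 * c)" using c by simp
    obtain j where j: "measure (PiM ?I M) (A j) < (1 / 2) ^ Suc DIM('a) * (1 / 2 * c)"
      using eventually_happens'[OF sequentially_bot order_tendstoD(2)[OF lim0 c0]] by blast
    have "p n \<in> cball 0 (real j)" for n
    proof (rule ccontr)
      assume n: "p n \<notin> cball 0 (real j)"
      have "{x \<in> space (PiM ?I M). p n \<in> convex hull (x ` ?I)} \<subseteq> A j"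
      proof
        fix x assume x: "x \<in> {x \<in> space (PiM ?I M). p n \<in> convex hull (x ` ?I)}"
        have "\<not> x ` ?I \<subseteq> cball 0 (real j)" 
          using n x hull_minimal[of "x ` ?I" "cball 0 (real j)" convex, OF _ convex_cball] by blast
        then obtain i where i: "i \<in> ?I" "x i \<notin> cball 0 (real j)" by blast
        then have "real j \<le> norm (x i)" by simp
        then show "x \<in> A j" using x i(1) unfolding A_def by blast
      qed
      then have "m (p n) \<le> measure (PiM ?I M) (A j)"
        unfolding m_def using norm_meas by (intro P.finite_measure_mono) (auto simp: A_def)
      moreover have "(1 / 2) ^ Suc DIM('a) * (1 / 2 * c) \<le> \<kappa> n ^ Suc DIM('a) * (\<kappa> n * c)"
        using \<kappa>[of n] c by (intro mult_mono power_mono) auto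
      ultimately show False using j p[of n] by simp
    qed
    then show ?thesis by blast
  qed
  then obtain R where "\<And>n. p n \<in> cball 0 R" by blast
  then obtain q s where q: "strict_mono (s :: nat \<Rightarrow> nat)" "(p \<circ> s) \<longlonglongrightarrow> q"
    using compact_cball[of "0 :: 'a" R] unfolding compact_eq_seq_compact_metric seq_compact_def by metis
  have "c \<le> m q"
    unfolding m_def
  \<comment> \<open>Here the tolerance is constantly 0: the points \<open>p n\<close> lie in the
    hull itself.\<close>
  proof (rule measure_in_convex_hull_ge[OF prob sets _ _ q(2) tendsto_const LIMSEQ_subseq_LIMSEQ[OF lim q(1)]])
    fix n
    have meas: "(\<lambda>x. setdist {(p \<circ> s) n} (convex hull (x ` ?I))) \<in> borel_measurable (PiM ?I M)"
      using setdist_convex_hull_measurable[where M = M and C = "{(p \<circ> s) n}" and A = "{}", OF _ sets] by simp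
    have "m (p (s n)) \<le> measure (PiM ?I M) {x \<in> space (PiM ?I M). setdist {(p \<circ> s) n} (convex hull (x ` ?I)) \<le> 0}"
      unfolding m_def using meas
      by (intro P.finite_measure_mono) (auto simp: setdist_eq_0I)
    then show "((\<lambda>n. \<kappa> n ^ Suc DIM('a) * (\<kappa> n * c)) \<circ> s) n \<le>
        measure (PiM ?I M) {x \<in> space (PiM ?I M). setdist {(p \<circ> s) n} (convex hull (x ` ?I)) \<le> 0}"
      using p[of "s n"] by simp
  qed auto
  then show ?thesis unfolding c_def m_def by blast
qed

end

section \<open>Transfer to independent random points\<close>

text \<open>The joint law of independent variables is the product of their laws, and the covering
  event is measurable in the product.\<close>

lemma measure_indep_vars_convex_hull:
  fixes m :: "nat \<Rightarrow> 'a::euclidean_space measure"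
  assumes "prob_space M" and indep: "prob_space.indep_vars M (\<lambda>i. borel) v I"
    and distr: "\<And>i. i \<in> I \<Longrightarrow> distr M borel (v i) = m i" and I: "finite I" "I \<noteq> {}"
  shows "measure M {\<omega> \<in> space M. p \<in> convex hull ((\<lambda>i. v i \<omega>) ` I)} =
    measure (PiM I m) {x \<in> space (PiM I m). p \<in> convex hull (x ` I)}"
proof -
  interpret prob_space M by fact
  let ?B = "\<lambda>_ :: nat. borel :: 'a measure"
  let ?X = "\<lambda>\<omega>. \<lambda>i\<in>I. v i \<omega>"
  let ?E = "{x \<in> space (PiM I ?B). p \<in> convex hull (x ` I)}"
  have rv: "v i \<in> borel_measurable M" if "i \<in> I" for i using indep that by (rule indep_vars_def2[THEN iffD1, THEN conjunct1, rule_format])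
  have "distr M (PiM I ?B) ?X = PiM I (\<lambda>i. distr M borel (v i))"
    using indep_vars_iff_distr_eq_PiM'[OF I(2), where M' = ?B and X = v] rv indep by blast
  also have "\<dots> = PiM I m" using distr by (intro PiM_cong) auto
  finally have eq: "distr M (PiM I ?B) ?X = PiM I m" .
  then have space: "space (PiM I m) = space (PiM I ?B)" by (metis space_distr)
  have "Measurable.pred (PiM I ?B) (\<lambda>x. {p} \<inter> convex hull ({} \<union> x ` I) \<noteq> {})"
    using I by (intro convex_hulls_meet_measurable) auto
  then have E: "?E \<in> sets (PiM I ?B)" by (simp add: pred_def)
  have X: "?X \<in> measurable M (PiM I ?B)" using rv by (intro measurable_restrict) auto
  have "measure (PiM I m) {x \<in> space (PiM I m). p \<in> convex hull (x ` I)} = measure (distr M (PiM I ?B) ?X) ?E"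
    unfolding eq space ..
  also have "\<dots> = measure M (?X -` ?E \<inter> space M)" using X E by (rule measure_distr)
  also have "?X -` ?E \<inter> space M = {\<omega> \<in> space M. p \<in> convex hull ((\<lambda>i. v i \<omega>) ` I)}"
    using measurable_space[OF X] by auto
  finally show ?thesis by simp
qed

(* The first conjunct realises the random points as the coordinates of the product space;
   the second is about arbitrary independent random points on a probability space with
   sample type 'b. A type cannot be quantified under the existential, so without the
   first conjunct the choice of p could formally depend on the type 'b. *)
theorem mainTheorem1:
  fixes m :: "nat \<Rightarrow> (real ^ 'n) measure" and d :: nat
  assumes d: "d = CARD('n)"
    and prob: "\<And>i. i \<le> d \<Longrightarrow> prob_space (m i)"
    and borel: "\<And>i. i \<le> d \<Longrightarrow> sets (m i) = sets borel"
    and ac: "\<And>i. i \<le> d \<Longrightarrow> absolutely_continuous lborel (m i)"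
  shows "\<exists>p :: real ^ 'n.
    measure (PiM {..d} m) {v \<in> space (PiM {..d} m). p \<in> convex hull (v ` {..d})}
      \<ge> 2 * real d / ((real d + 1) * fact (d + 1)) \<and>
    (\<forall>(M :: 'b measure) v.
      prob_space M \<and>
      prob_space.indep_vars M (\<lambda>i. borel) v {..d} \<and>
      (\<forall>i\<le>d. distr M borel (v i) = m i) \<longrightarrow>
      measure M {\<omega> \<in> space M. p \<in> convex hull ((\<lambda>i. v i \<omega>) ` {..d})}
        \<ge> 2 * real d / ((real d + 1) * fact (d + 1)))"
proof -
  \<comment> \<open>Constant continuation beyond d makes every index satisfy the hypotheses of
    \<open>ac_family\<close>, and keeps the range finite, as the common truncation radius
    requires.\<close>
  define m' where "m' i = m (min i d)" for i
  have D: "DIM(real ^ 'n) = d" by (simp add: d)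
  interpret ac_family m'
    by (rule ac_family.intro) (simp_all add: m'_def prob borel ac)
  have "range m' \<subseteq> m ` {..d}" by (auto simp: m'_def)
  then have "finite (range m')" by (rule finite_subset) simp
  moreover have "PiM {..d} m' = PiM {..d} m" by (intro PiM_cong) (simp_all add: m'_def)
  ultimately obtain p where p: "2 * real d / ((real d + 1) * fact (d + 1)) \<le>
    measure (PiM {..d} m) {v \<in> space (PiM {..d} m). p \<in> convex hull (v ` {..d})}"
    using exists_point unfolding D by auto
  show ?thesis
  proof (intro exI[of _ p] conjI allI impI p)
    fix M :: "'b measure" and v
    assume "prob_space M \<and> prob_space.indep_vars M (\<lambda>i. borel) v {..d} \<and> (\<forall>i\<le>d. distr M borel (v i) = m i)"
    then show "2 * real d / ((real d + 1) * fact (d + 1)) \<le>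
        measure M {\<omega> \<in> space M. p \<in> convex hull ((\<lambda>i. v i \<omega>) ` {..d})}"
      using p by (subst measure_indep_vars_convex_hull[where m = m]) auto
  qed
qed

end
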